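(* Let $(M,g)$ be a Riemannian manifold, let $\bar\nabla$ be a metric connection on $TM$ with parallel skew-symmetric torsion and curvature tensor $R$, and let $\mathrm{Hol}$ be its holonomy group. Suppose that $\bar\nabla R$ is a section of a geometric vector bundle $CM$ corresponding to a $\mathrm{Hol}$-representation $C$. Let $VM$ and $\tilde VM$ be geometric vector bundles corresponding to $\mathrm{Hol}$-representations $V$ and $\tilde V$, and let $D:\Gamma(VM)\to\Gamma(\tilde VM)$ be a natural first order differential operator. If $$\mathrm{Hom}_{\mathrm{Hol}}\big(C,\ \mathrm{Hom}(V,\tilde V)\big)=\{0\},$$ then $D$ commutes with the standard Laplace operator: $[\Delta,D]=\Delta_{\tilde V}\circ D-D\circ\Delta_V=0$.
   Context: Conventions. The torsion of $\bar\nabla$ is $T(X,Y)=\bar\nabla_XY-\bar\nabla_YX-[X,Y]$; $\bar\nabla$ has parallel skew-symmetric torsion if $\theta(X,Y,Z)=g(T(X,Y),Z)$ is a $\bar\nabla$-parallel $3$-form. The curvature of any connection is $R_{X,Y}=[\nabla_X,\nabla_Y]-\nabla_{[X,Y]}$. The bundle $\mathfrak{so}\,TM$ is identified with $\Lambda^2TM$ by $(X\wedge Y)\star Z=g(X,Z)Y-g(Y,Z)X$, with the scalar product on $\Lambda^2TM$ for which $\{E_\mu\wedge E_\nu\}_{\mu<\nu}$ is orthonormal whenever $\{E_\mu\}$ is. In symbols such as $T\otimes V$ the letter $T$ denotes the standard Euclidean vector space on which $\mathrm{SO}\,T$ acts. Holonomy reduction. $\mathrm{Hol}\subset\mathrm{SO}\,T$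 is the (closed) structure group of a holonomy reduction, i.e. of a principal subbundle $\mathrm{Hol}\,M\subset\mathrm{SO}\,M$ of the bundle of oriented orthonormal frames tangent to $\bar\nabla$. The holonomy algebra bundle $\mathfrak{hol}\,M\subset\mathfrak{so}\,TM\cong\Lambda^2TM$ is the corresponding $\bar\nabla$-parallel bundle of Lie subalgebras; it contains all $R_{X,Y}$. Let $\mathrm{pr}_{\mathfrak{hol}}:\Lambda^2TM\to\mathfrak{hol}\,M$ be the orthogonal projection. Geometric vector bundles. A geometric vector bundle is a vector bundle $VM$ with a connection $\nabla$ and a parallel infinitesimal representation $\star:\mathfrak{hol}\,M\otimes VM\to VM$ such that the curvature of $\nabla$ is $R^\nabla_{X,Y}=R_{X,Y}\,\star$. The bundle $VM=\mathrm{Hol}\,M\times_{\mathrm{Hol}}V$ associated to a representation $V$ of $\mathrm{Hol}$, with the induced connection, is the geometric vector bundle corresponding to $V$. Homomorphisms of geometric vector bundles are parallel bundle homomorphisms commuting with $\star$; a $\mathrm{Hol}$-equivariant linear map of representations extends to such a homomorphism. That $\bar\nabla R$ is a section of $CM$ means that $C$ is a $\mathrm{Hol}$-subrepresentation of $T^*\otimes\Lambda^2T^*\otimes\mathfrak{hol}$ and that $\bar\nabla R$ takes values in the associated subbundle $CM\subset T^*M\otimes\Lambda^2T^*M\otimes\mathfrak{hol}\,M$. Natural first order differential operators. A natural first order differential operator $D:\Gamma(VM)\to\Gamma(\tilde VM)$ is an operator of the form $D=D_\diamond+F$, where $F:VM\to\tilde VM$ is a homomorphism of geometric vector bundles (extending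 a $\mathrm{Hol}$-equivariant map $V\to\tilde V$) and $D_\diamond=\sum_\mu E_\mu\diamond\nabla_{E_\mu}$ for the parallel extension $TM\otimes VM\to\tilde VM$, $X\otimes v\mapsto X\diamond v$, of a $\mathrm{Hol}$-equivariant linear map $T\otimes V\to\tilde V$; here $\{E_\mu\}$ is a local orthonormal frame. Standard Laplace operator. On each geometric vector bundle, $\Delta=\Delta_V=\nabla^*\nabla+q(R)$ with $$\nabla^*\nabla=-\sum_\mu\big(\nabla_{E_\mu}\nabla_{E_\mu}-\nabla_{\bar\nabla_{E_\mu}E_\mu}\big),\qquad q(R)=\tfrac12\sum_{\mu,\nu}\mathrm{pr}_{\mathfrak{hol}}(E_\mu\wedge E_\nu)\star R_{E_\mu,E_\nu}\star .$$ *)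

theory Defs
  imports "HOL-Analysis.Analysis"
begin

section \<open>Smooth maps between open subsets of Euclidean spaces\<close>

text \<open>In finite dimensions, a differentiable map all of whose directional derivatives are of class
  \<open>C\<^sup>k\<close> is of class \<open>C\<^sup>k\<^sup>+\<^sup>1\<close>. The predicates are meant for open sets only.\<close>

primrec Ck_on :: "nat \<Rightarrow> 'a::euclidean_space set \<Rightarrow> ('a \<Rightarrow> 'b::real_normed_vector) \<Rightarrow> bool" where
  "Ck_on 0 U f \<longleftrightarrow> continuous_on U f"
| "Ck_on (Suc k) U f \<longleftrightarrow>
     (\<forall>x\<in>U. f differentiable at x) \<and> (\<forall>v. Ck_on k U (\<lambda>x. frechet_derivative f (at x) v))"

definition smooth_on :: "'a::euclidean_space set \<Rightarrow> ('a \<Rightarrow> 'b::real_normed_vector) \<Rightarrow> bool" where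
  "smooth_on U f \<longleftrightarrow> (\<forall>k. Ck_on k U f)"


section \<open>Smooth manifolds, tangent vectors, vector fields\<close>

text \<open>The manifold is the whole type \<open>'m\<close> (Hausdorff and second countable), with an atlas of
  charts in \<open>\<real>\<^sup>n\<close>, \<open>n = CARD('n)\<close>.

  A tangent vector at \<open>p\<close> is represented by its action, as a directional derivative in a chart, on
  the real functions which are smooth near \<open>p\<close>; it is made extensional by sending every other
  function to \<open>0\<close>. Linear operations on tangent vectors are pointwise.\<close>

type_synonym ('m, 'n) atlas = "('m set \<times> ('m \<Rightarrow> real ^ 'n)) set"
type_synonym 'm tvec = "('m \<Rightarrow> real) \<Rightarrow> real"
type_synonym 'm vfield = "'m \<Rightarrow> 'm tvec"

definition smooth_atlas :: "('m::topological_space, 'n::finite) atlas \<Rightarrow> bool" where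
  "smooth_atlas A \<longleftrightarrow>
     (\<Union>(U, \<phi>)\<in>A. U) = UNIV \<and>
     (\<forall>(U, \<phi>)\<in>A. open U \<and> open (\<phi> ` U) \<and> homeomorphism U (\<phi> ` U) \<phi> (inv_into U \<phi>)) \<and>
     (\<forall>(U, \<phi>)\<in>A. \<forall>(W, \<psi>)\<in>A. smooth_on (\<phi> ` (U \<inter> W)) (\<psi> \<circ> inv_into U \<phi>))"

definition smooth_fun ::
  "('m::topological_space, 'n::finite) atlas \<Rightarrow> 'm set \<Rightarrow> ('m \<Rightarrow> 'b::real_normed_vector) \<Rightarrow> bool" where
  "smooth_fun A W f \<longleftrightarrow>
     open W \<and> (\<forall>(U, \<phi>)\<in>A. smooth_on (\<phi> ` (U \<inter> W)) (f \<circ> inv_into U \<phi>))"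

definition smooth_at ::
  "('m::topological_space, 'n::finite) atlas \<Rightarrow> 'm \<Rightarrow> ('m \<Rightarrow> 'b::real_normed_vector) \<Rightarrow> bool" where
  "smooth_at A p f \<longleftrightarrow> (\<exists>W. p \<in> W \<and> smooth_fun A W f)"

definition tangent_space :: "('m::topological_space, 'n::finite) atlas \<Rightarrow> 'm \<Rightarrow> 'm tvec set" where
  "tangent_space A p =
     {X. \<exists>U \<phi> v. (U, \<phi>) \<in> A \<and> p \<in> U \<and>
        X = (\<lambda>f. if smooth_at A p f
                 then frechet_derivative (f \<circ> inv_into U \<phi>) (at (\<phi> p)) v else 0)}"

definition smooth_vf :: "('m::topological_space, 'n::finite) atlas \<Rightarrow> 'm set \<Rightarrow> 'm vfield \<Rightarrow> bool" where
  "smooth_vf A U X \<longleftrightarrow>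
     open U \<and> (\<forall>p\<in>U. X p \<in> tangent_space A p) \<and>
     (\<forall>W (f :: 'm \<Rightarrow> real). W \<subseteq> U \<longrightarrow> smooth_fun A W f \<longrightarrow> smooth_fun A W (\<lambda>p. X p f))"

definition lie_bracket ::
  "('m::topological_space, 'n::finite) atlas \<Rightarrow> 'm vfield \<Rightarrow> 'm vfield \<Rightarrow> 'm vfield" where
  "lie_bracket A X Y = (\<lambda>p f. if smooth_at A p f
     then X p (\<lambda>q. Y q f) - Y p (\<lambda>q. X q f) else 0)"

text \<open>Derivative of a vector-valued function along a tangent vector.\<close>

definition deriv_along :: "'m tvec \<Rightarrow> ('m \<Rightarrow> 'v::euclidean_space) \<Rightarrow> 'v" where
  "deriv_along x F = (\<Sum>b\<in>Basis. x (\<lambda>q. F q \<bullet> b) *\<^sub>R b)"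


section \<open>Riemannian metrics and metric connections with parallel skew-symmetric torsion\<close>

type_synonym 'm metric = "'m \<Rightarrow> 'm tvec \<Rightarrow> 'm tvec \<Rightarrow> real"

definition riemannian_manifold ::
  "('m::{t2_space,second_countable_topology}, 'n::finite) atlas \<Rightarrow> 'm metric \<Rightarrow> bool" where
  "riemannian_manifold A g \<longleftrightarrow>
     smooth_atlas A \<and>
     (\<forall>p. \<forall>x\<in>tangent_space A p. \<forall>y\<in>tangent_space A p.
        g p x y = g p y x \<and> (x \<noteq> (\<lambda>f. 0) \<longrightarrow> g p x x > 0) \<and>
        (\<forall>z\<in>tangent_space A p. \<forall>a b.
           g p (\<lambda>f. a * x f + b * y f) z = a * g p x z + b * g p y z)) \<and>
     (\<forall>U X Y. smooth_vf A U X \<longrightarrow> smooth_vf A U Y \<longrightarrow> smooth_fun A U (\<lambda>p. g p (X p) (Y p)))"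

text \<open>A connection \<open>nab p x Y\<close> \<open>= (\<nabla>\<^sub>x Y)(p)\<close> differentiates vector fields \<open>Y\<close> defined near \<open>p\<close> along
  \<open>x \<in> T\<^sub>p M\<close>. It is given on local vector fields (sheaf-wise); the locality axiom says that only
  the germ of \<open>Y\<close> at \<open>p\<close> matters.\<close>

type_synonym 'm conn = "'m \<Rightarrow> 'm tvec \<Rightarrow> 'm vfield \<Rightarrow> 'm tvec"

definition connection :: "('m::topological_space, 'n::finite) atlas \<Rightarrow> 'm conn \<Rightarrow> bool" where
  "connection A nab \<longleftrightarrow>
     (\<forall>U X Y. smooth_vf A U X \<longrightarrow> smooth_vf A U Y \<longrightarrow> smooth_vf A U (\<lambda>p. nab p (X p) Y)) \<and>
     (\<forall>U Y p. smooth_vf A U Y \<longrightarrow> p \<in> U \<longrightarrow>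
        (\<forall>x\<in>tangent_space A p.
           nab p x Y \<in> tangent_space A p \<and>
           (\<forall>y\<in>tangent_space A p. \<forall>a b.
              nab p (\<lambda>f. a * x f + b * y f) Y = (\<lambda>f. a * nab p x Y f + b * nab p y Y f)) \<and>
           (\<forall>Z. smooth_vf A U Z \<longrightarrow>
              nab p x (\<lambda>q f. Y q f + Z q f) = (\<lambda>f. nab p x Y f + nab p x Z f)) \<and>
           (\<forall>h :: 'm \<Rightarrow> real. smooth_fun A U h \<longrightarrow>
              nab p x (\<lambda>q f. h q * Y q f) = (\<lambda>f. x h * Y p f + h p * nab p x Y f)) \<and>
           (\<forall>Z. (\<forall>q\<in>U. Z q = Y q) \<longrightarrow> nab p x Z = nab p x Y)))"

definition metric_connection ::
  "('m::topological_space, 'n::finite) atlas \<Rightarrow> 'm metric \<Rightarrow> 'm conn \<Rightarrow> bool" where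
  "metric_connection A g nab \<longleftrightarrow>
     connection A nab \<and>
     (\<forall>U Y Z p. smooth_vf A U Y \<longrightarrow> smooth_vf A U Z \<longrightarrow> p \<in> U \<longrightarrow>
        (\<forall>x\<in>tangent_space A p.
           x (\<lambda>q. g q (Y q) (Z q)) = g p (nab p x Y) (Z p) + g p (Y p) (nab p x Z)))"

definition torsion ::
  "('m::topological_space, 'n::finite) atlas \<Rightarrow> 'm conn \<Rightarrow> 'm vfield \<Rightarrow> 'm vfield \<Rightarrow> 'm vfield" where
  "torsion A nab X Y = (\<lambda>p f. nab p (X p) Y f - nab p (Y p) X f - lie_bracket A X Y p f)"

definition torsion_form ::
  "('m::topological_space, 'n::finite) atlas \<Rightarrow> 'm metric \<Rightarrow> 'm conn \<Rightarrow>
   'm vfield \<Rightarrow> 'm vfield \<Rightarrow> 'm vfield \<Rightarrow> 'm \<Rightarrow> real" where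
  "torsion_form A g nab X Y Z p = g p (torsion A nab X Y p) (Z p)"

definition parallel_skew_torsion ::
  "('m::topological_space, 'n::finite) atlas \<Rightarrow> 'm metric \<Rightarrow> 'm conn \<Rightarrow> bool" where
  "parallel_skew_torsion A g nab \<longleftrightarrow>
     (\<forall>U W X Y Z p. smooth_vf A U W \<longrightarrow> smooth_vf A U X \<longrightarrow> smooth_vf A U Y \<longrightarrow> smooth_vf A U Z \<longrightarrow>
        p \<in> U \<longrightarrow>
        torsion_form A g nab X Y Z p = - torsion_form A g nab Y X Z p \<and>
        torsion_form A g nab X Y Z p = - torsion_form A g nab X Z Y p \<and>
        W p (torsion_form A g nab X Y Z) =
          torsion_form A g nab (\<lambda>q. nab q (W q) X) Y Z p +
          torsion_form A g nab X (\<lambda>q. nab q (W q) Y) Z p +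
          torsion_form A g nab X Y (\<lambda>q. nab q (W q) Z) p)"

definition curvature ::
  "('m::topological_space, 'n::finite) atlas \<Rightarrow> 'm conn \<Rightarrow>
   'm vfield \<Rightarrow> 'm vfield \<Rightarrow> 'm vfield \<Rightarrow> 'm vfield" where
  "curvature A nab X Y Z = (\<lambda>p f.
     nab p (X p) (\<lambda>q. nab q (Y q) Z) f - nab p (Y p) (\<lambda>q. nab q (X q) Z) f
       - nab p (lie_bracket A X Y p) Z f)"

text \<open>\<open>(\<nabla>\<^sub>W R)\<^bsub>X,Y\<^esub> Z\<close>\<close>

definition nabla_curvature ::
  "('m::topological_space, 'n::finite) atlas \<Rightarrow> 'm conn \<Rightarrow>
   'm vfield \<Rightarrow> 'm vfield \<Rightarrow> 'm vfield \<Rightarrow> 'm vfield \<Rightarrow> 'm vfield" where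
  "nabla_curvature A nab W X Y Z = (\<lambda>p f.
     nab p (W p) (curvature A nab X Y Z) f
       - curvature A nab (\<lambda>q. nab q (W q) X) Y Z p f
       - curvature A nab X (\<lambda>q. nab q (W q) Y) Z p f
       - curvature A nab X Y (\<lambda>q. nab q (W q) Z) p f)"


section \<open>Closed subgroups of the special orthogonal group and their representations\<close>

type_synonym 'n mat = "real ^ 'n ^ 'n"

definition closed_subgroup_SO :: "('n::finite) mat set \<Rightarrow> bool" where
  "closed_subgroup_SO H \<longleftrightarrow>
     H \<subseteq> {h. orthogonal_matrix h \<and> det h = 1} \<and> closed H \<and> mat 1 \<in> H \<and>
     (\<forall>h\<in>H. \<forall>k\<in>H. h ** k \<in> H) \<and> (\<forall>h\<in>H. matrix_inv h \<in> H)"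

text \<open>The Lie algebra is the tangent space of the group at the identity.\<close>

definition lie_curve :: "('n::finite) mat set \<Rightarrow> 'n mat \<Rightarrow> (real \<Rightarrow> 'n mat) \<Rightarrow> bool" where
  "lie_curve H X c \<longleftrightarrow>
     smooth_on UNIV c \<and> range c \<subseteq> H \<and> c 0 = mat 1 \<and> (c has_vector_derivative X) (at 0)"

definition lie_algebra :: "('n::finite) mat set \<Rightarrow> 'n mat set" where
  "lie_algebra H = {X. \<exists>c. lie_curve H X c}"

text \<open>Smoothness of a representation as a map on the embedded submanifold \<open>H\<close> of the space of
  matrices: locally it is the restriction of a smooth map on an open set of matrices.\<close>

definition lie_representation ::
  "('n::finite) mat set \<Rightarrow> ('n mat \<Rightarrow> 'v::euclidean_space \<Rightarrow> 'v) \<Rightarrow> bool" where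
  "lie_representation H \<rho> \<longleftrightarrow>
     (\<forall>h\<in>H. linear (\<rho> h)) \<and> \<rho> (mat 1) = id \<and>
     (\<forall>h\<in>H. \<forall>k\<in>H. \<rho> (h ** k) = \<rho> h \<circ> \<rho> k) \<and>
     (\<forall>v. \<forall>h\<in>H. \<exists>W F. open W \<and> h \<in> W \<and> smooth_on W F \<and> (\<forall>k\<in>W \<inter> H. F k = \<rho> k v))"

text \<open>The infinitesimal representation, \<open>X \<star> v = d/dt \<rho>(c(t)) v\<close> at \<open>t = 0\<close>; the result does not
  depend on the curve \<open>c\<close> in \<open>H\<close> with \<open>c(0) = 1\<close>, \<open>c'(0) = X\<close>.\<close>

definition inf_rep ::
  "('n::finite) mat set \<Rightarrow> ('n mat \<Rightarrow> 'v::euclidean_space \<Rightarrow> 'v) \<Rightarrow> 'n mat \<Rightarrow> 'v \<Rightarrow> 'v" where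
  "inf_rep H \<rho> X v = vector_derivative (\<lambda>t. \<rho> ((SOME c. lie_curve H X c) t) v) (at 0)"

text \<open>\<open>(x \<and> y) \<star> z = \<langle>x,z\<rangle> y - \<langle>y,z\<rangle> x\<close>, as a matrix. For the inner product below,
  \<open>{e\<^sub>i \<and> e\<^sub>j | i < j}\<close> is orthonormal.\<close>

definition wedge :: "real ^ 'n \<Rightarrow> real ^ 'n \<Rightarrow> ('n::finite) mat" where
  "wedge x y = matrix (\<lambda>z. (x \<bullet> z) *\<^sub>R y - (y \<bullet> z) *\<^sub>R x)"

definition lambda2_inner :: "('n::finite) mat \<Rightarrow> 'n mat \<Rightarrow> real" where
  "lambda2_inner X Y = (\<Sum>i\<in>UNIV. \<Sum>j\<in>UNIV. X $ i $ j * Y $ i $ j) / 2"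

definition pr_hol :: "('n::finite) mat set \<Rightarrow> 'n mat \<Rightarrow> 'n mat" where
  "pr_hol H X =
     (THE Y. Y \<in> lie_algebra H \<and> (\<forall>Z\<in>lie_algebra H. lambda2_inner (X - Y) Z = 0))"

text \<open>Elements of \<open>T\<^sup>* \<otimes> \<Lambda>\<^sup>2T\<^sup>* \<otimes> hol\<close>, as trilinear maps with values in \<open>hol\<close>.\<close>

type_synonym 'n dcurv = "real ^ 'n \<Rightarrow> real ^ 'n \<Rightarrow> real ^ 'n \<Rightarrow> 'n mat"

definition dcurv_space :: "('n::finite) mat set \<Rightarrow> 'n dcurv set" where
  "dcurv_space H = {\<kappa>.
     (\<forall>y z. linear (\<lambda>x. \<kappa> x y z)) \<and> (\<forall>x z. linear (\<lambda>y. \<kappa> x y z)) \<and> (\<forall>x y. linear (\<kappa> x y)) \<and>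
     (\<forall>x y z. \<kappa> x y z = - \<kappa> x z y) \<and> (\<forall>x y z. \<kappa> x y z \<in> lie_algebra H)}"

definition dcurv_act :: "('n::finite) mat \<Rightarrow> 'n dcurv \<Rightarrow> 'n dcurv" where
  "dcurv_act h \<kappa> = (\<lambda>x y z.
     h ** \<kappa> (matrix_inv h *v x) (matrix_inv h *v y) (matrix_inv h *v z) ** matrix_inv h)"

definition dcurv_subrep :: "('n::finite) mat set \<Rightarrow> 'n dcurv set \<Rightarrow> bool" where
  "dcurv_subrep H C \<longleftrightarrow>
     C \<subseteq> dcurv_space H \<and> (\<lambda>x y z. 0) \<in> C \<and>
     (\<forall>\<kappa>\<in>C. \<forall>\<mu>\<in>C. \<forall>a b. (\<lambda>x y z. a *\<^sub>R \<kappa> x y z + b *\<^sub>R \<mu> x y z) \<in> C) \<and>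
     (\<forall>h\<in>H. \<forall>\<kappa>\<in>C. dcurv_act h \<kappa> \<in> C)"

text \<open>\<open>Hom\<^sub>H(C, Hom(V, V'))\<close>, where \<open>h\<close> acts on \<open>f : V \<rightarrow> V'\<close> by \<open>\<rho>'(h) \<circ> f \<circ> \<rho>(h\<^sup>-\<^sup>1)\<close>. Maps on \<open>C\<close> are
  made extensional by the value \<open>0\<close> outside \<open>C\<close>.\<close>

definition Hom_rep ::
  "('n::finite) mat set \<Rightarrow> 'n dcurv set \<Rightarrow> ('n mat \<Rightarrow> 'v::euclidean_space \<Rightarrow> 'v) \<Rightarrow>
   ('n mat \<Rightarrow> 'w::euclidean_space \<Rightarrow> 'w) \<Rightarrow> ('n dcurv \<Rightarrow> 'v \<Rightarrow> 'w) set" where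
  "Hom_rep H C \<rho> \<rho>' = {\<Phi>.
     (\<forall>\<kappa>. \<kappa> \<notin> C \<longrightarrow> \<Phi> \<kappa> = (\<lambda>v. 0)) \<and>
     (\<forall>\<kappa>\<in>C. linear (\<Phi> \<kappa>)) \<and>
     (\<forall>\<kappa>\<in>C. \<forall>\<mu>\<in>C. \<forall>a b v.
        \<Phi> (\<lambda>x y z. a *\<^sub>R \<kappa> x y z + b *\<^sub>R \<mu> x y z) v = a *\<^sub>R \<Phi> \<kappa> v + b *\<^sub>R \<Phi> \<mu> v) \<and>
     (\<forall>h\<in>H. \<forall>\<kappa>\<in>C. \<Phi> (dcurv_act h \<kappa>) = \<rho>' h \<circ> \<Phi> \<kappa> \<circ> \<rho> (matrix_inv h))}"


section \<open>Holonomy reductions\<close>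

text \<open>A frame at \<open>p\<close> is a linear isometry \<open>u : T = \<real>\<^sup>n \<rightarrow> T\<^sub>p M\<close>; the structure group acts by
  \<open>u \<cdot> h = u \<circ> h\<close>. A principal subbundle is a set of frames whose fibres are orbits of the
  structure group and which has smooth local sections. As the structure group consists of matrices
  of determinant \<open>1\<close>, the frames in the subbundle determine an orientation of the manifold for which
  they are all oriented.\<close>

type_synonym ('m, 'n) frame = "real ^ 'n \<Rightarrow> 'm tvec"

definition orthonormal_frames ::
  "('m::topological_space, 'n::finite) atlas \<Rightarrow> 'm metric \<Rightarrow> ('m \<times> ('m, 'n) frame) set" where
  "orthonormal_frames A g = {(p, u).
     range u = tangent_space A p \<and>
     (\<forall>a b x y. u (a *\<^sub>R x + b *\<^sub>R y) = (\<lambda>f. a * u x f + b * u y f)) \<and>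
     (\<forall>x y. g p (u x) (u y) = x \<bullet> y)}"

definition frame_act :: "('m, 'n::finite) frame \<Rightarrow> 'n mat \<Rightarrow> ('m, 'n) frame" where
  "frame_act u h = (\<lambda>x. u (h *v x))"

definition local_section ::
  "('m::topological_space, 'n::finite) atlas \<Rightarrow> ('m \<times> ('m, 'n) frame) set \<Rightarrow> 'm set \<Rightarrow>
   ('m \<Rightarrow> ('m, 'n) frame) \<Rightarrow> bool" where
  "local_section A P U \<sigma> \<longleftrightarrow>
     open U \<and> (\<forall>p\<in>U. (p, \<sigma> p) \<in> P) \<and> (\<forall>x. smooth_vf A U (\<lambda>p. \<sigma> p x))"

text \<open>For a local section \<open>\<sigma>\<close> the connection form \<open>\<omega>\<close> is given by \<open>\<nabla>\<^sub>x(\<sigma> b) = \<sigma> (\<omega>(x) b)\<close>, so it is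
  the pull-back by \<open>\<sigma>\<close> of the connection form on the frame bundle. The horizontal distribution is
  tangent to the subbundle iff \<open>\<omega>\<close> takes values in the Lie algebra of its structure group.\<close>

definition connection_form ::
  "'m conn \<Rightarrow> ('m \<Rightarrow> ('m, 'n::finite) frame) \<Rightarrow> 'm \<Rightarrow> 'm tvec \<Rightarrow> 'n mat" where
  "connection_form nab \<sigma> p x = matrix (\<lambda>b. inv (\<sigma> p) (nab p x (\<lambda>q. \<sigma> q b)))"

definition holonomy_reduction ::
  "('m::topological_space, 'n::finite) atlas \<Rightarrow> 'm metric \<Rightarrow> 'm conn \<Rightarrow> 'n mat set \<Rightarrow>
   ('m \<times> ('m, 'n) frame) set \<Rightarrow> bool" where
  "holonomy_reduction A g nab H P \<longleftrightarrow>
     closed_subgroup_SO H \<and> P \<subseteq> orthonormal_frames A g \<and>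
     (\<forall>(p, u)\<in>P. {u'. (p, u') \<in> P} = frame_act u ` H) \<and>
     (\<forall>p. \<exists>U \<sigma>. p \<in> U \<and> local_section A P U \<sigma>) \<and>
     (\<forall>U \<sigma>. local_section A P U \<sigma> \<longrightarrow>
        (\<forall>p\<in>U. \<forall>x\<in>tangent_space A p. connection_form nab \<sigma> p x \<in> lie_algebra H))"

text \<open>Curvature \<open>R\<^bsub>\<sigma> a,\<sigma> b\<^esub>\<close> and its covariant derivative \<open>(\<nabla>\<^bsub>\<sigma> a\<^esub> R)\<^bsub>\<sigma> b,\<sigma> c\<^esub>\<close> at \<open>p\<close>, read in the
  frame \<open>\<sigma> p\<close>.\<close>

definition curvature_form ::
  "('m::topological_space, 'n::finite) atlas \<Rightarrow> 'm conn \<Rightarrow> ('m \<Rightarrow> ('m, 'n) frame) \<Rightarrow> 'm \<Rightarrow>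
   real ^ 'n \<Rightarrow> real ^ 'n \<Rightarrow> 'n mat" where
  "curvature_form A nab \<sigma> p a b =
     matrix (\<lambda>d. inv (\<sigma> p) (curvature A nab (\<lambda>q. \<sigma> q a) (\<lambda>q. \<sigma> q b) (\<lambda>q. \<sigma> q d) p))"

definition nabla_curvature_form ::
  "('m::topological_space, 'n::finite) atlas \<Rightarrow> 'm conn \<Rightarrow> ('m \<Rightarrow> ('m, 'n) frame) \<Rightarrow> 'm \<Rightarrow>
   'n dcurv" where
  "nabla_curvature_form A nab \<sigma> p = (\<lambda>a b c.
     matrix (\<lambda>d. inv (\<sigma> p)
       (nabla_curvature A nab (\<lambda>q. \<sigma> q a) (\<lambda>q. \<sigma> q b) (\<lambda>q. \<sigma> q c) (\<lambda>q. \<sigma> q d) p)))"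

definition nabla_curvature_section_of ::
  "('m::topological_space, 'n::finite) atlas \<Rightarrow> 'm conn \<Rightarrow> ('m \<times> ('m, 'n) frame) set \<Rightarrow>
   'n dcurv set \<Rightarrow> bool" where
  "nabla_curvature_section_of A nab P C \<longleftrightarrow>
     (\<forall>U \<sigma>. local_section A P U \<sigma> \<longrightarrow> (\<forall>p\<in>U. nabla_curvature_form A nab \<sigma> p \<in> C))"


section \<open>Geometric vector bundles associated to representations\<close>

text \<open>The fibre at \<open>p\<close> of \<open>VM = P \<times>\<^sub>H V\<close> is identified, as usual, with the space of \<open>H\<close>-equivariant
  maps \<open>P\<^sub>p \<rightarrow> V\<close>, so that a section of \<open>VM\<close> is an \<open>H\<close>-equivariant function on \<open>P\<close>. It is smooth iff
  its composition with every smooth local section of \<open>P\<close> is. Values outside \<open>P\<close> are irrelevant.\<close>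

type_synonym ('m, 'n, 'v) sec = "'m \<times> ('m, 'n) frame \<Rightarrow> 'v"

definition sections ::
  "('m::topological_space, 'n::finite) atlas \<Rightarrow> 'n mat set \<Rightarrow> ('m \<times> ('m, 'n) frame) set \<Rightarrow>
   ('n mat \<Rightarrow> 'v::euclidean_space \<Rightarrow> 'v) \<Rightarrow> ('m, 'n, 'v) sec set" where
  "sections A H P \<rho> = {s.
     (\<forall>(p, u)\<in>P. \<forall>h\<in>H. s (p, frame_act u h) = \<rho> (matrix_inv h) (s (p, u))) \<and>
     (\<forall>U \<sigma>. local_section A P U \<sigma> \<longrightarrow> smooth_fun A U (\<lambda>q. s (q, \<sigma> q)))}"

text \<open>The operators below are evaluated at \<open>(p, u) \<in> P\<close> by means of a chosen local section \<open>\<sigma>\<close> of \<open>P\<close>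
  with \<open>\<sigma> p = u\<close>; \<open>{\<sigma> e\<^sub>\<mu>}\<close> is then a local orthonormal frame. None of them depends on the choice.\<close>

definition gauge_at ::
  "('m::topological_space, 'n::finite) atlas \<Rightarrow> ('m \<times> ('m, 'n) frame) set \<Rightarrow>
   'm \<Rightarrow> ('m, 'n) frame \<Rightarrow> 'm \<Rightarrow> ('m, 'n) frame" where
  "gauge_at A P p u = (SOME \<sigma>. \<exists>U. p \<in> U \<and> local_section A P U \<sigma> \<and> \<sigma> p = u)"

definition gauge_field ::
  "('m::topological_space, 'n::finite) atlas \<Rightarrow> ('m \<times> ('m, 'n) frame) set \<Rightarrow>
   'm \<Rightarrow> ('m, 'n) frame \<Rightarrow> 'n \<Rightarrow> 'm vfield" where
  "gauge_field A P p u \<mu> = (\<lambda>q. gauge_at A P p u q (axis \<mu> 1))"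

text \<open>The induced connection, \<open>\<nabla>\<^sub>X s = X(s \<circ> \<sigma>) + \<omega>(X) \<star> (s \<circ> \<sigma>)\<close> with respect to \<open>\<sigma>\<close>.\<close>

definition cov_deriv ::
  "('m::topological_space, 'n::finite) atlas \<Rightarrow> 'm conn \<Rightarrow> 'n mat set \<Rightarrow>
   ('m \<times> ('m, 'n) frame) set \<Rightarrow> ('n mat \<Rightarrow> 'v::euclidean_space \<Rightarrow> 'v) \<Rightarrow>
   'm vfield \<Rightarrow> ('m, 'n, 'v) sec \<Rightarrow> ('m, 'n, 'v) sec" where
  "cov_deriv A nab H P \<rho> X s = (\<lambda>(p, u).
     let \<sigma> = gauge_at A P p u
     in deriv_along (X p) (\<lambda>q. s (q, \<sigma> q)) +
        inf_rep H \<rho> (connection_form nab \<sigma> p (X p)) (s (p, u)))"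

definition rough_laplace ::
  "('m::topological_space, 'n::finite) atlas \<Rightarrow> 'm conn \<Rightarrow> 'n mat set \<Rightarrow>
   ('m \<times> ('m, 'n) frame) set \<Rightarrow> ('n mat \<Rightarrow> 'v::euclidean_space \<Rightarrow> 'v) \<Rightarrow>
   ('m, 'n, 'v) sec \<Rightarrow> ('m, 'n, 'v) sec" where
  "rough_laplace A nab H P \<rho> s = (\<lambda>(p, u).
     let E = gauge_field A P p u
     in - (\<Sum>\<mu>\<in>UNIV. cov_deriv A nab H P \<rho> (E \<mu>) (cov_deriv A nab H P \<rho> (E \<mu>) s) (p, u)
             - cov_deriv A nab H P \<rho> (\<lambda>q. nab q (E \<mu> q) (E \<mu>)) s (p, u)))"

definition q_curvature ::
  "('m::topological_space, 'n::finite) atlas \<Rightarrow> 'm conn \<Rightarrow> 'n mat set \<Rightarrow>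
   ('m \<times> ('m, 'n) frame) set \<Rightarrow> ('n mat \<Rightarrow> 'v::euclidean_space \<Rightarrow> 'v) \<Rightarrow>
   ('m, 'n, 'v) sec \<Rightarrow> ('m, 'n, 'v) sec" where
  "q_curvature A nab H P \<rho> s = (\<lambda>(p, u).
     (1 / 2) *\<^sub>R (\<Sum>\<mu>\<in>UNIV. \<Sum>\<nu>\<in>UNIV.
        inf_rep H \<rho> (pr_hol H (wedge (axis \<mu> 1) (axis \<nu> 1)))
          (inf_rep H \<rho> (curvature_form A nab (gauge_at A P p u) p (axis \<mu> 1) (axis \<nu> 1))
            (s (p, u)))))"

definition standard_laplace ::
  "('m::topological_space, 'n::finite) atlas \<Rightarrow> 'm conn \<Rightarrow> 'n mat set \<Rightarrow>
   ('m \<times> ('m, 'n) frame) set \<Rightarrow> ('n mat \<Rightarrow> 'v::euclidean_space \<Rightarrow> 'v) \<Rightarrow>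
   ('m, 'n, 'v) sec \<Rightarrow> ('m, 'n, 'v) sec" where
  "standard_laplace A nab H P \<rho> s = (\<lambda>pu.
     rough_laplace A nab H P \<rho> s pu + q_curvature A nab H P \<rho> s pu)"

text \<open>The equivariant map \<open>dia : T \<otimes> V \<rightarrow> V'\<close> is given as a bilinear map on \<open>T \<times> V\<close>; read in the frame
  \<open>u\<close>, the orthonormal vectors \<open>E\<^sub>\<mu> = u e\<^sub>\<mu>\<close> of \<open>T\<^sub>p M\<close> become the standard basis vectors \<open>e\<^sub>\<mu>\<close>.\<close>

definition D_diamond ::
  "('m::topological_space, 'n::finite) atlas \<Rightarrow> 'm conn \<Rightarrow> 'n mat set \<Rightarrow>
   ('m \<times> ('m, 'n) frame) set \<Rightarrow> ('n mat \<Rightarrow> 'v::euclidean_space \<Rightarrow> 'v) \<Rightarrow>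
   (real ^ 'n \<Rightarrow> 'v \<Rightarrow> 'w::euclidean_space) \<Rightarrow> ('m, 'n, 'v) sec \<Rightarrow> ('m, 'n, 'w) sec" where
  "D_diamond A nab H P \<rho> dia s = (\<lambda>(p, u).
     \<Sum>\<mu>\<in>UNIV. dia (axis \<mu> 1) (cov_deriv A nab H P \<rho> (gauge_field A P p u \<mu>) s (p, u)))"

definition natural_first_order ::
  "('m::topological_space, 'n::finite) atlas \<Rightarrow> 'm conn \<Rightarrow> 'n mat set \<Rightarrow>
   ('m \<times> ('m, 'n) frame) set \<Rightarrow> ('n mat \<Rightarrow> 'v::euclidean_space \<Rightarrow> 'v) \<Rightarrow>
   ('n mat \<Rightarrow> 'w::euclidean_space \<Rightarrow> 'w) \<Rightarrow>
   (('m, 'n, 'v) sec \<Rightarrow> ('m, 'n, 'w) sec) \<Rightarrow> bool" where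
  "natural_first_order A nab H P \<rho> \<rho>' D \<longleftrightarrow>
     (\<exists>dia F. bilinear dia \<and> (\<forall>h\<in>H. \<forall>x v. dia (h *v x) (\<rho> h v) = \<rho>' h (dia x v)) \<and>
        linear F \<and> (\<forall>h\<in>H. \<forall>v. F (\<rho> h v) = \<rho>' h (F v)) \<and>
        (\<forall>s\<in>sections A H P \<rho>. \<forall>pu\<in>P. D s pu = D_diamond A nab H P \<rho> dia s pu + F (s pu)))"

end

theory Submission
  imports Defs
begin

text \<open>In a gauge \<open>\<sigma>\<close>, sections become \<open>V\<close>-valued functions and \<open>\<nabla>\<close> maps \<open>V\<close>-valued to
  \<open>T \<otimes> V\<close>-valued functions. Parallel homomorphisms commute with \<open>\<Delta>\<close>, so everything reduces to the
  commutator of \<open>\<Delta>\<close> with \<open>\<nabla> : V \<rightarrow> T \<otimes> V\<close>. Interchanging third derivatives with the Ricci identity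
  produces terms with \<open>R\<close>, \<open>T\<close> and \<open>\<nabla>R\<close>: those with \<open>T\<close> cancel because the torsion is skew and
  parallel, and those with \<open>R\<close> are cancelled by the part of \<open>q(R)\<close> on \<open>T \<otimes> V\<close> that mixes the two
  factors. The latter uses the pair symmetry of \<open>R\<close>, which holds because the first Bianchi identity
  expresses the cyclic sum of \<open>R\<close> by a four-form in the torsion. What remains is linear in \<open>\<nabla>R\<close> and
  equivariant, that is, an element of \<open>Hom\<^sub>H(C, Hom(V, V'))\<close>.\<close>


section \<open>Smooth maps on open subsets of Euclidean spaces\<close>

text \<open>Operators are evaluated at (p, u) in a gauge picked by Hilbert choice, so neighbouring
  points need not share one. The remedy: a covariant derivative depends on the gauge only through
  its value at p, and \<open>nabla\<close> sends equivariant functions for \<rho> to equivariant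
  functions for \<open>tens \<rho>\<close>. Hence the rough Laplacian is minus the trace of an
  iterated \<open>nabla\<close>, an expression free of gauges, which can be recomputed in a single
  gauge. There the commutator is (\<Delta> \<nabla> s)_k - \<nabla>_k \<Delta> s = - sum_i
  (\<nabla>_i R)_{ik} \<star> s - 1/2 sum_{\<mu>,\<nu>} E_{\<mu>\<nu>} \<star> (\<nabla>_k
  R)_{\<mu>\<nu>} \<star> s; the first sum comes from differentiating the Ricci identity, the second
  from differentiating q(R). Reordering also leaves 2 sum_i R_{ik} \<star> \<nabla>_i s and a Ricci
  contraction. On T \<otimes> V, q(R) has two cross terms, with E on T and R on V or conversely;
  they agree, and give the same factor 2, because R is a symmetric operator on bivectors. With
  torsion present this symmetry is not automatic.\<close>

lemma Ck_on_cong: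
  assumes "open U" "\<And>x. x \<in> U \<Longrightarrow> f x = g x" "Ck_on k U f"
  shows "Ck_on k U g"
  using assms(2,3)
proof (induction k arbitrary: f g)
  case 0
  then show ?case using continuous_on_cong[of U U f g] by auto
next
  case (Suc k)
  have d: "g differentiable at x" if "x \<in> U" for x
  proof -
    have "(f has_derivative frechet_derivative f (at x)) (at x)"
      using Suc.prems that frechet_derivative_works by auto
    then show ?thesis
      using has_derivative_transform_within_open[of f _ x UNIV U g] Suc.prems(1) that \<open>open U\<close>
      unfolding differentiable_def by blast
  qed
  have e: "frechet_derivative f (at x) = frechet_derivative g (at x)" if "x \<in> U" for x
    using frechet_derivative_transform_within_open[of f x U g] Suc.prems that \<open>open U\<close> by auto
  have "Ck_on k U (\<lambda>x. frechet_derivative g (at x) v)" for v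
    using Suc.IH[of "\<lambda>x. frechet_derivative f (at x) v"] Suc.prems e by simp
  then show ?case using d by simp
qed

lemma Ck_on_subset: "Ck_on k U f \<Longrightarrow> V \<subseteq> U \<Longrightarrow> Ck_on k V f"
  by (induction k arbitrary: f) (auto intro: continuous_on_subset)

text \<open>The recursive definition of class k+1 does not mention class k, so the inclusion is an
  induction resting on differentiable maps being continuous.\<close>

lemma Ck_on_Suc_imp: "Ck_on (Suc k) U f \<Longrightarrow> Ck_on k U f"
proof (induction k arbitrary: f)
  case 0
  then show ?case
    by (auto intro!: differentiable_imp_continuous_on differentiable_at_imp_differentiable_on)
next
  case (Suc k)
  have "\<forall>x\<in>U. f differentiable at x"
    "\<And>v. Ck_on (Suc k) U (\<lambda>x. frechet_derivative f (at x) v)"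
    using Suc.prems unfolding Ck_on.simps(2)[of "Suc k"] by auto
  then show ?case using Suc.IH unfolding Ck_on.simps(2)[of k] by auto
qed

lemma Ck_on_const: "Ck_on k U (\<lambda>x. c)"
  by (induction k arbitrary: c) auto

lemma Ck_on_ident: "Ck_on k U (\<lambda>x. x)"
  by (cases k) (auto simp: Ck_on_const)

lemma has_derivative_imp_frechet:
  assumes "(f has_derivative f') (at x)"
  shows "f differentiable at x" "frechet_derivative f (at x) = f'"
  subgoal using assms unfolding differentiable_def by blast
  subgoal by (rule frechet_derivative_at[OF assms, symmetric])
  done

section \<open>Closure of C^k maps under linear maps, sums, products and composition\<close>

lemma frechet_derivative_bounded_linear:
  assumes "bounded_linear L" "f differentiable at x"
  shows "(\<lambda>x. L (f x)) differentiable at x"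
    "frechet_derivative (\<lambda>x. L (f x)) (at x) = (\<lambda>v. L (frechet_derivative f (at x) v))"
proof -
  have "((\<lambda>x. L (f x)) has_derivative (\<lambda>v. L (frechet_derivative f (at x) v))) (at x)"
    by (rule bounded_linear.has_derivative) (use assms frechet_derivative_works in auto)
  then show "(\<lambda>x. L (f x)) differentiable at x"
    "frechet_derivative (\<lambda>x. L (f x)) (at x) = (\<lambda>v. L (frechet_derivative f (at x) v))"
    by (rule has_derivative_imp_frechet)+
qed

lemma Ck_on_bounded_linear:
  assumes "open U" "bounded_linear L" "Ck_on k U f"
  shows "Ck_on k U (\<lambda>x. L (f x))"
  using assms(3)
proof (induction k arbitrary: f)
  case 0
  then show ?case by (auto intro: bounded_linear.continuous_on[OF assms(2)])
next
  case (Suc k)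
  have "Ck_on k U (\<lambda>x. frechet_derivative (\<lambda>x. L (f x)) (at x) v)" for v
    by (rule Ck_on_cong[OF assms(1) _ Suc.IH[of "\<lambda>x. frechet_derivative f (at x) v"]])
      (use Suc.prems frechet_derivative_bounded_linear(2)[OF assms(2), of f] in \<open>auto simp: fun_eq_iff\<close>)
  then show ?case using Suc.prems frechet_derivative_bounded_linear(1)[OF assms(2), of f] by auto
qed

lemma frechet_derivative_add_at:
  assumes "f differentiable at x" "g differentiable at x"
  shows "frechet_derivative (\<lambda>x. f x + g x) (at x) =
    (\<lambda>v. frechet_derivative f (at x) v + frechet_derivative g (at x) v)"
  by (rule has_derivative_imp_frechet(2)[OF has_derivative_add])
    (use assms frechet_derivative_works in auto)

lemma Ck_on_add:
  assumes "open U" "Ck_on k U f" "Ck_on k U g"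
  shows "Ck_on k U (\<lambda>x. f x + g x)"
  using assms(2,3)
proof (induction k arbitrary: f g)
  case 0
  then show ?case by (auto intro: continuous_on_add)
next
  case (Suc k)
  have "Ck_on k U (\<lambda>x. frechet_derivative (\<lambda>x. f x + g x) (at x) v)" for v
    by (rule Ck_on_cong[OF assms(1) _ Suc.IH[of "\<lambda>x. frechet_derivative f (at x) v"
          "\<lambda>x. frechet_derivative g (at x) v"]])
      (use Suc.prems frechet_derivative_add_at[of f _ g] in \<open>auto simp: fun_eq_iff\<close>)
  then show ?case using Suc.prems by auto
qed

lemma Ck_on_sum:
  assumes "open U" "\<And>i. i \<in> I \<Longrightarrow> Ck_on k U (f i)"
  shows "Ck_on k U (\<lambda>x. \<Sum>i\<in>I. f i x)"
  using assms(2) by (induction I rule: infinite_finite_induct) (auto simp: Ck_on_const Ck_on_add assms(1))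

lemma frechet_derivative_bilinear:
  assumes "bounded_bilinear B" "f differentiable at x" "g differentiable at x"
  shows "(\<lambda>x. B (f x) (g x)) differentiable at x"
    "frechet_derivative (\<lambda>x. B (f x) (g x)) (at x) =
      (\<lambda>v. B (f x) (frechet_derivative g (at x) v) + B (frechet_derivative f (at x) v) (g x))"
proof -
  have "((\<lambda>x. B (f x) (g x)) has_derivative (\<lambda>v. B (f x) (frechet_derivative g (at x) v)
     + B (frechet_derivative f (at x) v) (g x))) (at x)"
    by (rule bounded_bilinear.FDERIV) (use assms frechet_derivative_works in auto)
  then show "(\<lambda>x. B (f x) (g x)) differentiable at x"
    "frechet_derivative (\<lambda>x. B (f x) (g x)) (at x) =
      (\<lambda>v. B (f x) (frechet_derivative g (at x) v) + B (frechet_derivative f (at x) v) (g x))"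
    by (rule has_derivative_imp_frechet)+
qed

lemma Ck_on_bilinear:
  assumes "open U" "bounded_bilinear B" "Ck_on k U f" "Ck_on k U g"
  shows "Ck_on k U (\<lambda>x. B (f x) (g x))"
  using assms(3,4)
proof (induction k arbitrary: f g)
  case 0
  then show ?case by (auto intro: bounded_bilinear.continuous_on[OF assms(2)])
next
  case (Suc k)
  have c: "Ck_on k U f" "Ck_on k U g" using Suc.prems Ck_on_Suc_imp by auto
  have "Ck_on k U (\<lambda>x. frechet_derivative (\<lambda>x. B (f x) (g x)) (at x) v)" for v
    by (rule Ck_on_cong[OF assms(1) _ Ck_on_add[OF assms(1)
          Suc.IH[of f "\<lambda>x. frechet_derivative g (at x) v"]
          Suc.IH[of "\<lambda>x. frechet_derivative f (at x) v" g]]])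
      (use Suc.prems c frechet_derivative_bilinear(2)[OF assms(2), of f _ g] in \<open>auto simp: fun_eq_iff\<close>)
  then show ?case using Suc.prems frechet_derivative_bilinear(1)[OF assms(2), of f _ g] by auto
qed

text \<open>The chain rule is expanded in the basis, as a sum of (df(v) . b) times (d_b g) o f. This
  has the shape of the induction hypothesis with g replaced by its partial derivative d_b g, which
  is why g varies in the induction while f stays fixed.\<close>

lemma Ck_on_compose:
  fixes f :: "'a::euclidean_space \<Rightarrow> 'b::euclidean_space"
  assumes "open U" "open V" "f ` U \<subseteq> V" "Ck_on k U f" "Ck_on k V g"
  shows "Ck_on k U (\<lambda>x. g (f x))"
  using assms(4,5)
proof (induction k arbitrary: g)
  case 0
  then show ?case using continuous_on_compose2 assms(3) by auto
next
  case (Suc k)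
  have d: "((\<lambda>x. g (f x)) has_derivative
      (\<lambda>v. frechet_derivative g (at (f x)) (frechet_derivative f (at x) v))) (at x)" if "x \<in> U" for x
    by (rule has_derivative_compose[of f])
      (use that Suc.prems assms(3) frechet_derivative_works[of f] frechet_derivative_works[of g] in auto)
  have e: "frechet_derivative (\<lambda>x. g (f x)) (at x) v =
      (\<Sum>b\<in>Basis. (frechet_derivative f (at x) v \<bullet> b) *\<^sub>R frechet_derivative g (at (f x)) b)"
    if "x \<in> U" for x v
  proof -
    have "linear (frechet_derivative g (at (f x)))"
      using that Suc.prems assms(3) by (auto intro!: linear_frechet_derivative)
    then have "frechet_derivative g (at (f x)) (\<Sum>b\<in>Basis. (frechet_derivative f (at x) v \<bullet> b) *\<^sub>R b) =
      (\<Sum>b\<in>Basis. (frechet_derivative f (at x) v \<bullet> b) *\<^sub>R frechet_derivative g (at (f x)) b)"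
      by (simp add: linear_sum linear_cmul)
    then show ?thesis
      using frechet_derivative_at[OF d[OF that]] by (simp add: euclidean_representation fun_eq_iff)
  qed
  have "Ck_on k U (\<lambda>x. frechet_derivative (\<lambda>x. g (f x)) (at x) v)" for v
  proof (rule Ck_on_cong[OF assms(1) _ Ck_on_sum[OF assms(1)]])
    show "Ck_on k U (\<lambda>x. (frechet_derivative f (at x) v \<bullet> b) *\<^sub>R frechet_derivative g (at (f x)) b)"
      if "b \<in> Basis" for b
    proof (rule Ck_on_bilinear[OF assms(1) bounded_bilinear_scaleR])
      show "Ck_on k U (\<lambda>x. frechet_derivative f (at x) v \<bullet> b)"
        by (rule Ck_on_bounded_linear[OF assms(1) bounded_linear_inner_left]) (use Suc.prems in auto)
      show "Ck_on k U (\<lambda>x. frechet_derivative g (at (f x)) b)"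
        by (rule Suc.IH[OF Ck_on_Suc_imp[OF Suc.prems(1)], of "\<lambda>y. frechet_derivative g (at y) b"])
          (use Suc.prems in auto)
    qed
  qed (use e in auto)
  then show ?case using d by (auto simp: differentiable_def)
qed

section \<open>Smooth maps and the symmetry of second derivatives\<close>

lemma smooth_on_cong: "open U \<Longrightarrow> (\<And>x. x \<in> U \<Longrightarrow> f x = g x) \<Longrightarrow> smooth_on U f \<Longrightarrow> smooth_on U g"
  using Ck_on_cong unfolding smooth_on_def by blast

lemma smooth_on_subset: "smooth_on U f \<Longrightarrow> V \<subseteq> U \<Longrightarrow> smooth_on V f"
  using Ck_on_subset unfolding smooth_on_def by blast

lemma smooth_on_const: "smooth_on U (\<lambda>x. c)"
  by (simp add: smooth_on_def Ck_on_const)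

lemma smooth_on_ident: "smooth_on U (\<lambda>x. x)"
  by (simp add: smooth_on_def Ck_on_ident)

lemma smooth_on_bounded_linear:
  "open U \<Longrightarrow> bounded_linear L \<Longrightarrow> smooth_on U f \<Longrightarrow> smooth_on U (\<lambda>x. L (f x))"
  by (simp add: smooth_on_def Ck_on_bounded_linear)

lemma smooth_on_add:
  "open U \<Longrightarrow> smooth_on U f \<Longrightarrow> smooth_on U g \<Longrightarrow> smooth_on U (\<lambda>x. f x + g x)"
  by (simp add: smooth_on_def Ck_on_add)

lemma smooth_on_sum:
  "open U \<Longrightarrow> (\<And>i. i \<in> I \<Longrightarrow> smooth_on U (f i)) \<Longrightarrow> smooth_on U (\<lambda>x. \<Sum>i\<in>I. f i x)"
  by (simp add: smooth_on_def Ck_on_sum)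

lemma smooth_on_bilinear:
  "open U \<Longrightarrow> bounded_bilinear B \<Longrightarrow> smooth_on U f \<Longrightarrow> smooth_on U g \<Longrightarrow> smooth_on U (\<lambda>x. B (f x) (g x))"
  by (simp add: smooth_on_def Ck_on_bilinear)

lemma smooth_on_compose:
  fixes f :: "'a::euclidean_space \<Rightarrow> 'b::euclidean_space"
  shows "open U \<Longrightarrow> open V \<Longrightarrow> f ` U \<subseteq> V \<Longrightarrow> smooth_on U f \<Longrightarrow> smooth_on V g
    \<Longrightarrow> smooth_on U (\<lambda>x. g (f x))"
  unfolding smooth_on_def using Ck_on_compose by metis

lemma smooth_on_differentiable: "smooth_on U f \<Longrightarrow> x \<in> U \<Longrightarrow> f differentiable at x"
  unfolding smooth_on_def using Ck_on.simps(2)[of 0 U f] by blast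

lemma smooth_on_frechet: "smooth_on U f \<Longrightarrow> smooth_on U (\<lambda>x. frechet_derivative f (at x) v)"
  unfolding smooth_on_def using Ck_on.simps(2) by blast

lemma smooth_on_continuous_on: "smooth_on U f \<Longrightarrow> continuous_on U f"
  unfolding smooth_on_def using Ck_on.simps(1) by metis

lemma smooth_on_componentwise:
  fixes f :: "'a::euclidean_space \<Rightarrow> 'b::euclidean_space"
  assumes "open U" "\<And>b. b \<in> Basis \<Longrightarrow> smooth_on U (\<lambda>x. f x \<bullet> b)"
  shows "smooth_on U f"
proof -
  have "smooth_on U (\<lambda>x. \<Sum>b\<in>Basis. (f x \<bullet> b) *\<^sub>R b)"
    using assms by (intro smooth_on_sum assms(1) smooth_on_bounded_linear[where L="\<lambda>t. t *\<^sub>R _"]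
        bounded_linear_scaleR_left) auto
  then show ?thesis by (simp add: euclidean_representation)
qed

text \<open>Both mixed derivatives are limits of \<open>(f(t,t) - f(t,0) - f(0,t) + f(0,0)) / t\<^sup>2\<close>; by the mean
  value theorem applied twice the quotient is a value of the mixed derivative near the origin.\<close>

lemma mixed_difference_mvt:
  fixes f :: "real \<Rightarrow> real \<Rightarrow> real"
  assumes t: "0 < t"
    and 1: "\<And>a b. a \<in> {0..t} \<Longrightarrow> b \<in> {0..t} \<Longrightarrow> ((\<lambda>a. f a b) has_real_derivative fa a b) (at a)"
    and 2: "\<And>a b. a \<in> {0..t} \<Longrightarrow> b \<in> {0..t} \<Longrightarrow> ((\<lambda>b. fa a b) has_real_derivative fab a b) (at b)"
  shows "\<exists>a\<in>{0..t}. \<exists>b\<in>{0..t}. f t t - f t 0 - f 0 t + f 0 0 = t * t * fab a b"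
proof -
  have "\<exists>a. 0 < a \<and> a < t \<and> (f t t - f t 0) - (f 0 t - f 0 0) = (t - 0) * (fa a t - fa a 0)"
    by (rule MVT2[of 0 t "\<lambda>a. f a t - f a 0"]) (use t in \<open>auto intro!: DERIV_diff 1\<close>)
  then obtain a where a: "0 < a" "a < t" "(f t t - f t 0) - (f 0 t - f 0 0) = t * (fa a t - fa a 0)"
    by auto
  have "\<exists>b. 0 < b \<and> b < t \<and> fa a t - fa a 0 = (t - 0) * fab a b"
    by (rule MVT2[of 0 t "fa a"]) (use t a in \<open>auto intro!: 2\<close>)
  then obtain b where "0 < b" "b < t" "fa a t - fa a 0 = t * fab a b" by auto
  then show ?thesis using a by (intro bexI[of _ a] bexI[of _ b]) (auto simp: algebra_simps)
qed

lemma second_derivative_symmetric_real: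
  fixes f :: "'a::euclidean_space \<Rightarrow> real"
  assumes U: "open U" "x \<in> U" and f: "smooth_on U f"
  shows "frechet_derivative (\<lambda>y. frechet_derivative f (at y) v) (at x) w =
         frechet_derivative (\<lambda>y. frechet_derivative f (at y) w) (at x) v"
proof -
  define D where "D v y = frechet_derivative f (at y) v" for v y
  define D2 where "D2 v w y = frechet_derivative (D v) (at y) w" for v w y
  have line: "((\<lambda>s. h (c + s *\<^sub>R w)) has_real_derivative frechet_derivative h (at (c + s *\<^sub>R w)) w) (at s)"
    if "smooth_on U h" "c + s *\<^sub>R w \<in> U" for h :: "'a \<Rightarrow> real" and s c w
  proof -
    let ?z = "\<lambda>s. c + s *\<^sub>R w"
    note df = smooth_on_differentiable[OF that]
    have h: "(h has_derivative frechet_derivative h (at (?z s))) (at (?z s))"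
      using df by (simp only: frechet_derivative_works)
    have "(?z has_derivative (\<lambda>r. r *\<^sub>R w)) (at s)"
      by (auto intro!: derivative_eq_intros)
    from has_derivative_compose[OF this h]
    have "((\<lambda>s. h (?z s)) has_derivative (\<lambda>r. frechet_derivative h (at (?z s)) (r *\<^sub>R w))) (at s)" .
    moreover have "frechet_derivative h (at (?z s)) (r *\<^sub>R w) = frechet_derivative h (at (?z s)) w * r" for r
      using linear_cmul[OF linear_frechet_derivative[OF df], of r w] by (simp add: mult.commute)
    ultimately show ?thesis by (simp add: has_field_derivative_def mult_commute_abs)
  qed
  have smD: "smooth_on U (D v)" "smooth_on U (D2 v w)" for v w
    unfolding D2_def D_def by (intro smooth_on_frechet f)+
  have "\<bar>D2 v w x - D2 w v x\<bar> \<le> e" if e: "e > 0" for e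
  proof -
    have "isCont (D2 v w) x" "isCont (D2 w v) x"
      using smooth_on_continuous_on[OF smD(2)] U by (auto simp: continuous_on_eq_continuous_at)
    then have c: "\<exists>d>0. \<forall>y. dist y x < d \<longrightarrow> dist (D2 v w y) (D2 v w x) < e/2"
      "\<exists>d>0. \<forall>y. dist y x < d \<longrightarrow> dist (D2 w v y) (D2 w v x) < e/2"
      unfolding continuous_at_eps_delta using e half_gt_zero by blast+
    obtain d1 d2 where d: "d1 > 0" "\<And>y. dist y x < d1 \<Longrightarrow> dist (D2 v w y) (D2 v w x) < e/2"
      "d2 > 0" "\<And>y. dist y x < d2 \<Longrightarrow> dist (D2 w v y) (D2 w v x) < e/2"
      using c by blast
    obtain d3 where d3: "d3 > 0" "ball x d3 \<subseteq> U" using U open_contains_ball by blast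
    define \<delta> where "\<delta> = Min {d1, d2, d3}"
    have \<delta>: "\<delta> > 0" "\<delta> \<le> d1" "\<delta> \<le> d2" "\<delta> \<le> d3" using d d3 by (auto simp: \<delta>_def)
    \<comment> \<open>This size keeps the parallelogram x + a v + b w with a, b in [0, t] inside the
      \<delta>-ball; the summand 1 covers v = w = 0.\<close>
    define t where "t = \<delta> / (2 * (norm v + norm w + 1))"
    have n: "norm v + norm w + 1 > 0" by (smt (verit) norm_ge_zero)
    have t: "t > 0" using \<delta> n by (simp add: t_def)
    have near: "dist (x + a *\<^sub>R v + b *\<^sub>R w) x < \<delta>" if "a \<in> {0..t}" "b \<in> {0..t}" for a b
    proof -
      have "norm (a *\<^sub>R v + b *\<^sub>R w) \<le> t * norm v + t * norm w"
        using that by (intro norm_triangle_mono) (auto intro: mult_right_mono)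
      also have "\<dots> < t * (2 * (norm v + norm w + 1))"
        using t by (simp add: distrib_left) (smt (verit) mult_nonneg_nonneg norm_ge_zero)
      also have "\<dots> = \<delta>" using n by (simp add: t_def)
      finally show ?thesis by (simp add: dist_norm algebra_simps)
    qed
    have inU: "x + a *\<^sub>R v + b *\<^sub>R w \<in> U" if "a \<in> {0..t}" "b \<in> {0..t}" for a b
      using near[OF that] \<delta> d3 by (auto simp: dist_commute subset_iff)
    define G where "G a b = f (x + a *\<^sub>R v + b *\<^sub>R w)" for a b
    have "\<exists>a\<in>{0..t}. \<exists>b\<in>{0..t}. G t t - G t 0 - G 0 t + G 0 0 = t * t * D2 v w (x + a *\<^sub>R v + b *\<^sub>R w)"
    proof (rule mixed_difference_mvt[OF t])
      show "((\<lambda>a. G a b) has_real_derivative D v (x + a *\<^sub>R v + b *\<^sub>R w)) (at a)"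
        if "a \<in> {0..t}" "b \<in> {0..t}" for a b
        using line[OF f, of "x + b *\<^sub>R w" a v] inU[OF that]
        unfolding G_def D_def by (simp add: algebra_simps)
      show "((\<lambda>b. D v (x + a *\<^sub>R v + b *\<^sub>R w)) has_real_derivative D2 v w (x + a *\<^sub>R v + b *\<^sub>R w)) (at b)"
        if "a \<in> {0..t}" "b \<in> {0..t}" for a b
        using line[OF smD(1), of "x + a *\<^sub>R v" b w] inU[OF that]
        unfolding D2_def by (simp add: algebra_simps)
    qed
    then obtain a b where ab: "a \<in> {0..t}" "b \<in> {0..t}"
      "G t t - G t 0 - G 0 t + G 0 0 = t * t * D2 v w (x + a *\<^sub>R v + b *\<^sub>R w)" by blast
    \<comment> \<open>The mixed difference is symmetric in the two variables, so the same lemma with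
      exchanged roles expresses it through the other mixed derivative.\<close>
    have "\<exists>b\<in>{0..t}. \<exists>a\<in>{0..t}. (\<lambda>b a. G a b) t t - (\<lambda>b a. G a b) t 0 - (\<lambda>b a. G a b) 0 t
       + (\<lambda>b a. G a b) 0 0 = t * t * D2 w v (x + a *\<^sub>R v + b *\<^sub>R w)"
    proof (rule mixed_difference_mvt[OF t])
      show "((\<lambda>b. G a b) has_real_derivative D w (x + a *\<^sub>R v + b *\<^sub>R w)) (at b)"
        if "b \<in> {0..t}" "a \<in> {0..t}" for a b
        using line[OF f, of "x + a *\<^sub>R v" b w] inU[OF that(2,1)]
        unfolding G_def D_def by (simp add: algebra_simps)
      show "((\<lambda>a. D w (x + a *\<^sub>R v + b *\<^sub>R w)) has_real_derivative D2 w v (x + a *\<^sub>R v + b *\<^sub>R w)) (at a)"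
        if "b \<in> {0..t}" "a \<in> {0..t}" for a b
        using line[OF smD(1), of "x + b *\<^sub>R w" a v] inU[OF that(2,1)]
        unfolding D2_def by (simp add: algebra_simps)
    qed
    then obtain a' b' where ab': "a' \<in> {0..t}" "b' \<in> {0..t}"
      "G t t - G 0 t - G t 0 + G 0 0 = t * t * D2 w v (x + a' *\<^sub>R v + b' *\<^sub>R w)" by blast
    have "t * t * D2 v w (x + a *\<^sub>R v + b *\<^sub>R w) = t * t * D2 w v (x + a' *\<^sub>R v + b' *\<^sub>R w)"
      using ab(3) ab'(3) by linarith
    then have "D2 v w (x + a *\<^sub>R v + b *\<^sub>R w) = D2 w v (x + a' *\<^sub>R v + b' *\<^sub>R w)"
      using t by simp
    moreover have "dist (D2 v w (x + a *\<^sub>R v + b *\<^sub>R w)) (D2 v w x) < e/2"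
      by (rule d(2)) (use near[OF ab(1,2)] \<delta> in linarith)
    moreover have "dist (D2 w v (x + a' *\<^sub>R v + b' *\<^sub>R w)) (D2 w v x) < e/2"
      by (rule d(4)) (use near[OF ab'(1,2)] \<delta> in linarith)
    ultimately show ?thesis unfolding dist_real_def by linarith
  qed
  then have "\<bar>D2 v w x - D2 w v x\<bar> \<le> 0" using field_le_epsilon[of "\<bar>D2 v w x - D2 w v x\<bar>" 0] by auto
  then show ?thesis by (simp add: D2_def D_def[abs_def])
qed


section \<open>Smooth functions and tangent vectors on a manifold\<close>

locale smooth_manifold =
  fixes A :: "('m::topological_space, 'n::finite) atlas"
  assumes atlas: "smooth_atlas A"
begin

section \<open>Charts and smooth functions\<close>

lemma chart_open: "(U, \<phi>) \<in> A \<Longrightarrow> open U" "(U, \<phi>) \<in> A \<Longrightarrow> open (\<phi> ` U)"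
  and chart_homeomorphism: "(U, \<phi>) \<in> A \<Longrightarrow> homeomorphism U (\<phi> ` U) \<phi> (inv_into U \<phi>)"
  and chart_transition: "(U, \<phi>) \<in> A \<Longrightarrow> (W, \<psi>) \<in> A \<Longrightarrow>
    smooth_on (\<phi> ` (U \<inter> W)) (\<psi> \<circ> inv_into U \<phi>)"
  using atlas unfolding smooth_atlas_def by blast+

lemma chart_exists: obtains U \<phi> where "(U, \<phi>) \<in> A" "p \<in> U"
proof -
  have "p \<in> (\<Union>(U, \<phi>)\<in>A. U)" using atlas unfolding smooth_atlas_def by simp
  then show thesis using that by blast
qed

lemma chart_inverse: "(U, \<phi>) \<in> A \<Longrightarrow> q \<in> U \<Longrightarrow> inv_into U \<phi> (\<phi> q) = q"
  using chart_homeomorphism homeomorphism_apply1 by blast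

lemma chart_image_open:
  assumes "(U, \<phi>) \<in> A" "open W"
  shows "open (\<phi> ` (U \<inter> W))"
proof -
  have "openin (top_of_set (\<phi> ` U)) (\<phi> ` (U \<inter> W))"
    by (rule homeomorphism_imp_open_map[OF chart_homeomorphism[OF assms(1)]]) (use assms in auto)
  then show ?thesis using openin_open_eq[OF chart_open(2)[OF assms(1)]] by blast
qed

lemma smooth_funI:
  assumes "open W" "\<And>U \<phi>. (U, \<phi>) \<in> A \<Longrightarrow> smooth_on (\<phi> ` (U \<inter> W)) (\<lambda>y. f (inv_into U \<phi> y))"
  shows "smooth_fun A W f"
  using assms unfolding smooth_fun_def by (auto simp: comp_def)

lemma smooth_fun_open: "smooth_fun A W f \<Longrightarrow> open W"
  unfolding smooth_fun_def by simp

lemma smooth_fun_chart: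
  "smooth_fun A W f \<Longrightarrow> (U, \<phi>) \<in> A \<Longrightarrow> smooth_on (\<phi> ` (U \<inter> W)) (\<lambda>y. f (inv_into U \<phi> y))"
  unfolding smooth_fun_def by (auto simp: comp_def)

lemma smooth_fun_subset: "smooth_fun A W f \<Longrightarrow> open W' \<Longrightarrow> W' \<subseteq> W \<Longrightarrow> smooth_fun A W' f"
  by (rule smooth_funI) (auto intro: smooth_on_subset[OF smooth_fun_chart])

lemma smooth_fun_cong:
  assumes "smooth_fun A W f" "\<And>q. q \<in> W \<Longrightarrow> f q = g q"
  shows "smooth_fun A W g"
proof (rule smooth_funI)
  fix U \<phi> assume c: "(U, \<phi>) \<in> A"
  show "smooth_on (\<phi> ` (U \<inter> W)) (\<lambda>y. g (inv_into U \<phi> y))"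
    by (rule smooth_on_cong[OF chart_image_open[OF c smooth_fun_open[OF assms(1)]] _ smooth_fun_chart[OF assms(1) c]])
      (auto simp: chart_inverse[OF c] assms(2))
qed (rule smooth_fun_open[OF assms(1)])

lemma smooth_fun_const: "open W \<Longrightarrow> smooth_fun A W (\<lambda>q. c)"
  by (rule smooth_funI) (auto intro: smooth_on_const)

lemma smooth_fun_bounded_linear:
  assumes "bounded_linear L" "smooth_fun A W f" shows "smooth_fun A W (\<lambda>q. L (f q))"
  using smooth_fun_open[OF assms(2)]
  by (intro smooth_funI smooth_on_bounded_linear[OF chart_image_open assms(1)] smooth_fun_chart[OF assms(2)])

lemma smooth_fun_linear:
  fixes L :: "'a::euclidean_space \<Rightarrow> 'b::real_normed_vector"
  shows "linear L \<Longrightarrow> smooth_fun A W f \<Longrightarrow> smooth_fun A W (\<lambda>q. L (f q))"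
  by (rule smooth_fun_bounded_linear) (simp add: linear_conv_bounded_linear[symmetric])

lemma smooth_fun_add:
  assumes "smooth_fun A W f" "smooth_fun A W g" shows "smooth_fun A W (\<lambda>q. f q + g q)"
  using smooth_fun_open[OF assms(1)]
  by (intro smooth_funI smooth_on_add[OF chart_image_open] smooth_fun_chart[OF assms(1)]
      smooth_fun_chart[OF assms(2)])

lemma smooth_fun_minus:
  assumes "smooth_fun A W f" shows "smooth_fun A W (\<lambda>q. - f q)"
  by (rule smooth_fun_bounded_linear[OF bounded_linear_minus[OF bounded_linear_ident] assms])

lemma smooth_fun_diff:
  assumes "smooth_fun A W f" "smooth_fun A W g" shows "smooth_fun A W (\<lambda>q. f q - g q)"
  using smooth_fun_add[OF assms(1) smooth_fun_minus[OF assms(2)]] by simp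

lemma smooth_fun_sum:
  assumes "open W" "\<And>i. i \<in> I \<Longrightarrow> smooth_fun A W (f i)" shows "smooth_fun A W (\<lambda>q. \<Sum>i\<in>I. f i q)"
  by (rule smooth_funI[OF assms(1)], rule smooth_on_sum[OF chart_image_open[OF _ assms(1)]])
    (auto intro: smooth_fun_chart[OF assms(2)])

lemma smooth_fun_bilinear:
  assumes "bounded_bilinear B" "smooth_fun A W f" "smooth_fun A W g"
  shows "smooth_fun A W (\<lambda>q. B (f q) (g q))"
  using smooth_fun_open[OF assms(2)]
  by (intro smooth_funI smooth_on_bilinear[OF chart_image_open assms(1)]
      smooth_fun_chart[OF assms(2)] smooth_fun_chart[OF assms(3)])

lemma smooth_fun_compose:
  fixes f :: "'m \<Rightarrow> 'b::euclidean_space"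
  assumes "smooth_fun A W f" "open V" "f ` W \<subseteq> V" "smooth_on V F"
  shows "smooth_fun A W (\<lambda>q. F (f q))"
proof (rule smooth_funI)
  fix U \<phi> assume c: "(U, \<phi>) \<in> A"
  show "smooth_on (\<phi> ` (U \<inter> W)) (\<lambda>y. F (f (inv_into U \<phi> y)))"
    by (rule smooth_on_compose[OF chart_image_open[OF c smooth_fun_open[OF assms(1)]] assms(2)
          _ smooth_fun_chart[OF assms(1) c] assms(4)])
      (use assms(3) in \<open>auto simp: chart_inverse[OF c]\<close>)
qed (rule smooth_fun_open[OF assms(1)])

lemma smooth_fun_componentwise:
  fixes f :: "'m \<Rightarrow> 'b::euclidean_space"
  assumes "open W" "\<And>b. b \<in> Basis \<Longrightarrow> smooth_fun A W (\<lambda>q. f q \<bullet> b)"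
  shows "smooth_fun A W f"
  by (rule smooth_funI[OF assms(1)], rule smooth_on_componentwise[OF chart_image_open[OF _ assms(1)]])
    (auto intro: smooth_fun_chart[OF assms(2)])

lemma smooth_fun_vec:
  fixes f :: "'m \<Rightarrow> 'b::euclidean_space ^ 'k::finite"
  assumes "open W" "\<And>i. smooth_fun A W (\<lambda>q. f q $ i)"
  shows "smooth_fun A W f"
proof (rule smooth_fun_componentwise[OF assms(1)])
  fix b :: "'b ^ 'k" assume "b \<in> Basis"
  then obtain i c where b: "b = axis i c" unfolding Basis_vec_def by auto
  show "smooth_fun A W (\<lambda>q. f q \<bullet> b)"
    unfolding b inner_axis by (rule smooth_fun_bounded_linear[OF bounded_linear_inner_left assms(2)])
qed

lemma smooth_fun_chart_map: "(U, \<phi>) \<in> A \<Longrightarrow> smooth_fun A U \<phi>"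
  using chart_transition[of _ _ U \<phi>] chart_open(1) by (intro smooth_funI) (auto simp: comp_def)

lemma smooth_atI: "smooth_fun A W f \<Longrightarrow> p \<in> W \<Longrightarrow> smooth_at A p f"
  unfolding smooth_at_def by blast

section \<open>Tangent vectors and directional derivatives in a chart\<close>

lemma chart_differentiable:
  assumes "smooth_at A p f" "(U, \<phi>) \<in> A" "p \<in> U"
  shows "((\<lambda>y. f (inv_into U \<phi> y)) has_derivative
    frechet_derivative (\<lambda>y. f (inv_into U \<phi> y)) (at (\<phi> p))) (at (\<phi> p))"
proof -
  obtain W where "p \<in> W" "smooth_fun A W f" using assms(1) unfolding smooth_at_def by blast
  then have "(\<lambda>y. f (inv_into U \<phi> y)) differentiable at (\<phi> p)"
    using assms(2,3) by (intro smooth_on_differentiable[OF smooth_fun_chart]) auto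
  then show ?thesis by (simp only: frechet_derivative_works)
qed

text \<open>A tangent vector comes with some chart; the differential of the transition map carries
  its coordinate vector to any other chart around p.\<close>

lemma tangent_space_chart:
  assumes x: "x \<in> tangent_space A p" and c: "(U, \<phi>) \<in> A" "p \<in> U"
  obtains v where "x = (\<lambda>f. if smooth_at A p f
    then frechet_derivative (\<lambda>y. f (inv_into U \<phi> y)) (at (\<phi> p)) v else 0)"
proof -
  obtain U1 \<psi> w where c1: "(U1, \<psi>) \<in> A" "p \<in> U1" and
    x: "x = (\<lambda>f. if smooth_at A p f then frechet_derivative (f \<circ> inv_into U1 \<psi>) (at (\<psi> p)) w else 0)"
    using x unfolding tangent_space_def by blast
  define v where "v = frechet_derivative (\<lambda>y. \<phi> (inv_into U1 \<psi> y)) (at (\<psi> p)) w"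
  have "frechet_derivative (f \<circ> inv_into U1 \<psi>) (at (\<psi> p)) w =
        frechet_derivative (\<lambda>y. f (inv_into U \<phi> y)) (at (\<phi> p)) v" if f: "smooth_at A p f" for f :: "'m \<Rightarrow> real"
  proof -
    have 1: "((\<lambda>y. \<phi> (inv_into U1 \<psi> y)) has_derivative
        frechet_derivative (\<lambda>y. \<phi> (inv_into U1 \<psi> y)) (at (\<psi> p))) (at (\<psi> p))"
      by (rule chart_differentiable[OF smooth_atI[OF smooth_fun_chart_map[OF c(1)] c(2)] c1])
    have 2: "((\<lambda>y. f (inv_into U \<phi> y)) has_derivative
        frechet_derivative (\<lambda>y. f (inv_into U \<phi> y)) (at (\<phi> p))) (at (\<phi> (inv_into U1 \<psi> (\<psi> p))))"
      using chart_differentiable[OF f c] by (simp add: chart_inverse[OF c1])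
    have "((\<lambda>y. f (inv_into U \<phi> (\<phi> (inv_into U1 \<psi> y)))) has_derivative
      (\<lambda>w. frechet_derivative (\<lambda>y. f (inv_into U \<phi> y)) (at (\<phi> p))
         (frechet_derivative (\<lambda>y. \<phi> (inv_into U1 \<psi> y)) (at (\<psi> p)) w))) (at (\<psi> p))"
      by (rule has_derivative_compose[OF 1 2])
    then have "((f \<circ> inv_into U1 \<psi>) has_derivative
      (\<lambda>w. frechet_derivative (\<lambda>y. f (inv_into U \<phi> y)) (at (\<phi> p))
         (frechet_derivative (\<lambda>y. \<phi> (inv_into U1 \<psi> y)) (at (\<psi> p)) w))) (at (\<psi> p))"
      by (rule has_derivative_transform_within_open[OF _ chart_image_open[OF c1(1) chart_open(1)[OF c(1)]]])
        (use c c1 in \<open>auto simp: chart_inverse\<close>)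
    then show ?thesis unfolding v_def using has_derivative_imp_frechet(2) by metis
  qed
  then show thesis using that[of v] x by (auto simp: fun_eq_iff)
qed

lemma deriv_along_real: "deriv_along x (f :: 'm \<Rightarrow> real) = x f"
  unfolding deriv_along_def by simp

lemma smooth_at_inner:
  fixes F :: "'m \<Rightarrow> 'v::euclidean_space"
  assumes "smooth_at A p F" shows "smooth_at A p (\<lambda>q. F q \<bullet> b)"
proof -
  obtain W where "p \<in> W" "smooth_fun A W F" using assms unfolding smooth_at_def by blast
  then show ?thesis
    using smooth_atI[OF smooth_fun_bounded_linear[OF bounded_linear_inner_left]] by blast
qed

lemma deriv_along_chart_rep:
  fixes F :: "'m \<Rightarrow> 'v::euclidean_space"
  assumes x: "x = (\<lambda>f. if smooth_at A p f
    then frechet_derivative (\<lambda>y. f (inv_into U \<phi> y)) (at (\<phi> p)) v else 0)"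
    and c: "(U, \<phi>) \<in> A" "p \<in> U" and F: "smooth_at A p F"
  shows "deriv_along x F = frechet_derivative (\<lambda>y. F (inv_into U \<phi> y)) (at (\<phi> p)) v"
proof -
  have "x (\<lambda>q. F q \<bullet> b) = frechet_derivative (\<lambda>y. F (inv_into U \<phi> y)) (at (\<phi> p)) v \<bullet> b" for b
  proof -
    have "((\<lambda>y. F (inv_into U \<phi> y) \<bullet> b) has_derivative
       (\<lambda>v. frechet_derivative (\<lambda>y. F (inv_into U \<phi> y)) (at (\<phi> p)) v \<bullet> b)) (at (\<phi> p))"
      by (rule bounded_linear.has_derivative[OF bounded_linear_inner_left chart_differentiable[OF F c]])
    then show ?thesis using smooth_at_inner[OF F] unfolding x
      by (simp add: has_derivative_imp_frechet(2))
  qed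
  then show ?thesis unfolding deriv_along_def by (simp add: euclidean_representation)
qed

text \<open>The coordinate vector of x is recovered as the derivative of the chart map itself along
  x. This replaces an existential witness by an expression that varies smoothly when x is the value
  of a smooth field.\<close>

lemma deriv_along_chart:
  fixes F :: "'m \<Rightarrow> 'v::euclidean_space"
  assumes x: "x \<in> tangent_space A p" and c: "(U, \<phi>) \<in> A" "p \<in> U" and F: "smooth_at A p F"
  shows "deriv_along x F = frechet_derivative (\<lambda>y. F (inv_into U \<phi> y)) (at (\<phi> p)) (deriv_along x \<phi>)"
proof -
  obtain v where v: "x = (\<lambda>f. if smooth_at A p f
    then frechet_derivative (\<lambda>y. f (inv_into U \<phi> y)) (at (\<phi> p)) v else 0)"
    using tangent_space_chart[OF x c] by blast
  have "((\<lambda>y. \<phi> (inv_into U \<phi> y)) has_derivative (\<lambda>v. v)) (at (\<phi> p))"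
    by (rule has_derivative_transform_within_open[OF has_derivative_ident chart_open(2)[OF c(1)]])
      (use c in \<open>auto simp: chart_inverse\<close>)
  then have "deriv_along x \<phi> = v"
    using deriv_along_chart_rep[OF v c smooth_atI[OF smooth_fun_chart_map[OF c(1)] c(2)]]
    by (simp add: has_derivative_imp_frechet(2))
  then show ?thesis using deriv_along_chart_rep[OF v c F] by simp
qed

lemma deriv_along_has_derivative:
  fixes F :: "'m \<Rightarrow> 'v::euclidean_space"
  assumes x: "x \<in> tangent_space A p" and c: "(U, \<phi>) \<in> A" "p \<in> U"
    and F: "((\<lambda>y. F (inv_into U \<phi> y)) has_derivative D) (at (\<phi> p))" and s: "smooth_at A p F"
  shows "deriv_along x F = D (deriv_along x \<phi>)"
  using deriv_along_chart[OF x c s] has_derivative_imp_frechet(2)[OF F] by simp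

text \<open>Tangent vectors are functions on global functions, so locality has to be derived.
  Smoothness of F matters because x vanishes by convention on functions not smooth near p.\<close>

lemma deriv_along_cong:
  fixes F :: "'m \<Rightarrow> 'v::euclidean_space"
  assumes x: "x \<in> tangent_space A p" and F: "smooth_fun A W F" "p \<in> W" and e: "\<And>q. q \<in> W \<Longrightarrow> F q = G q"
  shows "deriv_along x F = deriv_along x G"
proof -
  obtain U \<phi> where c: "(U, \<phi>) \<in> A" "p \<in> U" by (rule chart_exists)
  have "((\<lambda>y. G (inv_into U \<phi> y)) has_derivative
     frechet_derivative (\<lambda>y. F (inv_into U \<phi> y)) (at (\<phi> p))) (at (\<phi> p))"
    by (rule has_derivative_transform_within_open[OF chart_differentiable[OF smooth_atI[OF F] c]
        chart_image_open[OF c(1) smooth_fun_open[OF F(1)]]])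
      (use c F(2) in \<open>auto simp: chart_inverse e\<close>)
  from deriv_along_has_derivative[OF x c this smooth_atI[OF smooth_fun_cong[OF F(1) e] F(2)]]
  show ?thesis using deriv_along_chart[OF x c smooth_atI[OF F]] by simp
qed

lemma deriv_along_const: "x \<in> tangent_space A p \<Longrightarrow> deriv_along x (\<lambda>q. c) = 0"
proof -
  assume x: "x \<in> tangent_space A p"
  obtain U \<phi> where c: "(U, \<phi>) \<in> A" "p \<in> U" by (rule chart_exists)
  show ?thesis
    using deriv_along_has_derivative[OF x c has_derivative_const smooth_atI[OF smooth_fun_const[OF open_UNIV]]] by simp
qed

lemma deriv_along_bounded_linear:
  fixes F :: "'m \<Rightarrow> 'v::euclidean_space" and L :: "'v \<Rightarrow> 'w::euclidean_space"
  assumes x: "x \<in> tangent_space A p" and L: "bounded_linear L" and F: "smooth_fun A W F" "p \<in> W"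
  shows "deriv_along x (\<lambda>q. L (F q)) = L (deriv_along x F)"
proof -
  obtain U \<phi> where c: "(U, \<phi>) \<in> A" "p \<in> U" by (rule chart_exists)
  show ?thesis
    using deriv_along_has_derivative[OF x c bounded_linear.has_derivative[OF L chart_differentiable[OF smooth_atI[OF F] c]]
        smooth_atI[OF smooth_fun_bounded_linear[OF L F(1)] F(2)]]
      deriv_along_chart[OF x c smooth_atI[OF F]] by simp
qed

lemma deriv_along_linear:
  fixes F :: "'m \<Rightarrow> 'v::euclidean_space" and L :: "'v \<Rightarrow> 'w::euclidean_space"
  shows "x \<in> tangent_space A p \<Longrightarrow> linear L \<Longrightarrow> smooth_fun A W F \<Longrightarrow> p \<in> W \<Longrightarrow>
    deriv_along x (\<lambda>q. L (F q)) = L (deriv_along x F)"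
  by (rule deriv_along_bounded_linear) (simp_all add: linear_conv_bounded_linear[symmetric])

lemma deriv_along_add:
  fixes F :: "'m \<Rightarrow> 'v::euclidean_space"
  assumes x: "x \<in> tangent_space A p" and F: "smooth_fun A W F" "smooth_fun A W G" "p \<in> W"
  shows "deriv_along x (\<lambda>q. F q + G q) = deriv_along x F + deriv_along x G"
proof -
  obtain U \<phi> where c: "(U, \<phi>) \<in> A" "p \<in> U" by (rule chart_exists)
  note s = smooth_atI[OF F(1,3)] smooth_atI[OF F(2,3)]
  show ?thesis
    using deriv_along_has_derivative[OF x c has_derivative_add[OF chart_differentiable[OF s(1) c]
          chart_differentiable[OF s(2) c]] smooth_atI[OF smooth_fun_add[OF F(1,2)] F(3)]]
      deriv_along_chart[OF x c s(1)] deriv_along_chart[OF x c s(2)] by simp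
qed

lemma deriv_along_minus:
  fixes F :: "'m \<Rightarrow> 'v::euclidean_space"
  assumes x: "x \<in> tangent_space A p" and F: "smooth_fun A W F" "p \<in> W"
  shows "deriv_along x (\<lambda>q. - F q) = - deriv_along x F"
  by (rule deriv_along_bounded_linear[OF x bounded_linear_minus[OF bounded_linear_ident] F])

lemma deriv_along_diff:
  fixes F :: "'m \<Rightarrow> 'v::euclidean_space"
  assumes x: "x \<in> tangent_space A p" and F: "smooth_fun A W F" "smooth_fun A W G" "p \<in> W"
  shows "deriv_along x (\<lambda>q. F q - G q) = deriv_along x F - deriv_along x G"
  using deriv_along_add[OF x F(1) smooth_fun_minus[OF F(2)] F(3)] deriv_along_minus[OF x F(2,3)] by simp

lemma deriv_along_sum:
  fixes F :: "'i \<Rightarrow> 'm \<Rightarrow> 'v::euclidean_space"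
  assumes x: "x \<in> tangent_space A p" and W: "open W" "p \<in> W" and F: "\<And>i. i \<in> I \<Longrightarrow> smooth_fun A W (F i)"
  shows "deriv_along x (\<lambda>q. \<Sum>i\<in>I. F i q) = (\<Sum>i\<in>I. deriv_along x (F i))"
  using F
proof (induction I rule: infinite_finite_induct)
  case (insert i I)
  then have "smooth_fun A W (\<lambda>q. \<Sum>i\<in>I. F i q)" by (intro smooth_fun_sum W) auto
  then show ?case using insert deriv_along_add[OF x _ _ W(2), of "F i" "\<lambda>q. \<Sum>i\<in>I. F i q"] by simp
qed (auto simp: deriv_along_const[OF x])

lemma deriv_along_bilinear:
  fixes F :: "'m \<Rightarrow> 'u::euclidean_space" and G :: "'m \<Rightarrow> 'v::euclidean_space"
    and B :: "'u \<Rightarrow> 'v \<Rightarrow> 'w::euclidean_space"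
  assumes x: "x \<in> tangent_space A p" and B: "bounded_bilinear B"
    and F: "smooth_fun A W F" "smooth_fun A W G" "p \<in> W"
  shows "deriv_along x (\<lambda>q. B (F q) (G q)) = B (F p) (deriv_along x G) + B (deriv_along x F) (G p)"
proof -
  obtain U \<phi> where c: "(U, \<phi>) \<in> A" "p \<in> U" by (rule chart_exists)
  note s = smooth_atI[OF F(1,3)] smooth_atI[OF F(2,3)]
  show ?thesis
    using deriv_along_has_derivative[OF x c bounded_bilinear.FDERIV[OF B chart_differentiable[OF s(1) c]
          chart_differentiable[OF s(2) c]] smooth_atI[OF smooth_fun_bilinear[OF B F(1,2)] F(3)]]
      deriv_along_chart[OF x c s(1)] deriv_along_chart[OF x c s(2)] by (simp add: chart_inverse[OF c])
qed

lemma deriv_along_compose: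
  fixes F :: "'m \<Rightarrow> 'u::euclidean_space" and \<Phi> :: "'u \<Rightarrow> 'v::euclidean_space"
  assumes x: "x \<in> tangent_space A p" and F: "smooth_fun A W F" "p \<in> W"
    and V: "open V" "F ` W \<subseteq> V" "smooth_on V \<Phi>"
  shows "deriv_along x (\<lambda>q. \<Phi> (F q)) = frechet_derivative \<Phi> (at (F p)) (deriv_along x F)"
proof -
  obtain U \<phi> where c: "(U, \<phi>) \<in> A" "p \<in> U" by (rule chart_exists)
  have "\<Phi> differentiable at (F p)" using V F(2) by (intro smooth_on_differentiable[OF V(3)]) auto
  then have 1: "(\<Phi> has_derivative frechet_derivative \<Phi> (at (F p))) (at (F (inv_into U \<phi> (\<phi> p))))"
    by (simp add: chart_inverse[OF c] frechet_derivative_works[symmetric])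
  show ?thesis
    using deriv_along_has_derivative[OF x c has_derivative_compose[OF chart_differentiable[OF smooth_atI[OF F] c] 1]
        smooth_atI[OF smooth_fun_compose[OF F(1) V] F(2)]]
      deriv_along_chart[OF x c smooth_atI[OF F]] by simp
qed

section \<open>Vector fields and their Lie bracket\<close>

lemma smooth_vf_open: "smooth_vf A U X \<Longrightarrow> open U"
  and smooth_vf_tangent: "smooth_vf A U X \<Longrightarrow> p \<in> U \<Longrightarrow> X p \<in> tangent_space A p"
  unfolding smooth_vf_def by auto

lemma smooth_vf_subset: "smooth_vf A U X \<Longrightarrow> open W \<Longrightarrow> W \<subseteq> U \<Longrightarrow> smooth_vf A W X"
  unfolding smooth_vf_def by (meson subset_iff order_trans)

lemma smooth_vf_deriv:
  fixes F :: "'m \<Rightarrow> 'v::euclidean_space"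
  assumes X: "smooth_vf A U X" and F: "smooth_fun A W F" "W \<subseteq> U"
  shows "smooth_fun A W (\<lambda>q. deriv_along (X q) F)"
proof -
  have "smooth_fun A W (\<lambda>q. X q (\<lambda>q. F q \<bullet> b))" for b
    using X F(2) smooth_fun_bounded_linear[OF bounded_linear_inner_left F(1)]
    unfolding smooth_vf_def by blast
  then have "smooth_fun A W (\<lambda>q. X q (\<lambda>q. F q \<bullet> b) *\<^sub>R b)" for b
    by (rule smooth_fun_bounded_linear[OF bounded_linear_scaleR_left])
  then show ?thesis unfolding deriv_along_def
    by (intro smooth_fun_sum smooth_fun_open[OF F(1)])
qed

text \<open>Both sides are 0 on functions not smooth at p, so testing on smooth ones
  suffices.\<close>

lemma tangent_eqI:
  assumes "x \<in> tangent_space A p" "y \<in> tangent_space A p"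
    "\<And>f :: 'm \<Rightarrow> real. smooth_at A p f \<Longrightarrow> x f = y f"
  shows "x = y"
  using assms unfolding tangent_space_def by fastforce

text \<open>The commutator of derivations has to be exhibited as a directional derivative in a
  chart. Its second order part cancels by symmetry of second derivatives, and the rest is first
  order with explicit coordinates.\<close>

lemma lie_bracket_tangent:
  assumes X: "smooth_vf A U X" and Y: "smooth_vf A U Y" and p: "p \<in> U"
  shows "lie_bracket A X Y p \<in> tangent_space A p"
proof -
  obtain U0 \<phi> where c: "(U0, \<phi>) \<in> A" "p \<in> U0" by (rule chart_exists)
  define W where "W = U \<inter> U0"
  have W: "open W" "p \<in> W" "W \<subseteq> U" "W \<subseteq> U0"
    using p c chart_open(1)[OF c(1)] smooth_vf_open[OF X] by (auto simp: W_def)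
  have \<phi>: "smooth_fun A W \<phi>" by (rule smooth_fun_subset[OF smooth_fun_chart_map[OF c(1)] W(1,4)])
  define a where "a q = deriv_along (X q) \<phi>" for q
  define b where "b q = deriv_along (Y q) \<phi>" for q
  have ab: "smooth_fun A W a" "smooth_fun A W b"
    unfolding a_def b_def by (rule smooth_vf_deriv[OF _ \<phi> W(3)], fact)+
  note t = smooth_vf_tangent[OF X p] smooth_vf_tangent[OF Y p]
  \<comment> \<open>The classical coordinate formula: differentiate the components of Y along X and
    those of X along Y.\<close>
  define v where "v = deriv_along (X p) b - deriv_along (Y p) a"
  have "lie_bracket A X Y p f = frechet_derivative (f \<circ> inv_into U0 \<phi>) (at (\<phi> p)) v"
    if f: "smooth_at A p f" for f
  proof -
    obtain W1 where W1: "p \<in> W1" "smooth_fun A W1 f" using f unfolding smooth_at_def by blast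
    define W' where "W' = W \<inter> W1"
    have W': "open W'" "p \<in> W'" "W' \<subseteq> W" "W' \<subseteq> W1" "W' \<subseteq> U" "W' \<subseteq> U0"
      using W W1 smooth_fun_open[OF W1(2)] by (auto simp: W'_def)
    have fs: "smooth_fun A W' f" by (rule smooth_fun_subset[OF W1(2) W'(1,4)])
    define F where "F = (\<lambda>y. f (inv_into U0 \<phi> y))"
    define V where "V = \<phi> ` (U0 \<inter> W')"
    have V: "open V" "\<phi> ` W' \<subseteq> V" "\<phi> p \<in> V"
      using chart_image_open[OF c(1) W'(1)] W' by (auto simp: V_def)
    have F: "smooth_on V F" unfolding F_def V_def by (rule smooth_fun_chart[OF fs c(1)])
    have linF: "linear (frechet_derivative F (at y))" if "y \<in> V" for y
      by (rule linear_frechet_derivative[OF smooth_on_differentiable[OF F that]])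
    have expand: "frechet_derivative F (at y) u = (\<Sum>j\<in>UNIV. u $ j * frechet_derivative F (at y) (axis j 1))"
      if "y \<in> V" for y u
    proof -
      have "frechet_derivative F (at y) u = frechet_derivative F (at y) (\<Sum>j\<in>UNIV. (u $ j) *\<^sub>R axis j 1)"
        using basis_expansion[of u] by (simp add: scalar_mult_eq_scaleR)
      then show ?thesis by (simp add: linear_sum[OF linF[OF that]] linear_cmul[OF linF[OF that]])
    qed
    define f' where "f' j q = frechet_derivative F (at (\<phi> q)) (axis j 1)" for j q
    have \<phi>': "smooth_fun A W' \<phi>" by (rule smooth_fun_subset[OF \<phi> W'(1,3)])
    have f's: "smooth_fun A W' (f' j)" for j
      unfolding f'_def
      by (rule smooth_fun_compose[OF \<phi>' V(1,2), of "\<lambda>y. frechet_derivative F (at y) (axis j 1)"])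
        (rule smooth_on_frechet[OF F])
    have along: "Z q f = (\<Sum>j\<in>UNIV. deriv_along (Z q) \<phi> $ j * f' j q)"
      if "smooth_vf A U Z" "q \<in> W'" for Z q
    proof -
      have q: "q \<in> U" "q \<in> U0" "\<phi> q \<in> V" using that W' V(2) by auto
      have "Z q f = frechet_derivative F (at (\<phi> q)) (deriv_along (Z q) \<phi>)"
        using deriv_along_chart[OF smooth_vf_tangent[OF that(1) q(1)] c(1) q(2) smooth_atI[OF fs that(2)]]
        unfolding deriv_along_real F_def .
      then show ?thesis unfolding f'_def using expand[OF q(3)] by (rule trans)
    qed
    have second: "Z p (f' j) = (\<Sum>i\<in>UNIV. deriv_along (Z p) \<phi> $ i *
        frechet_derivative (\<lambda>y. frechet_derivative F (at y) (axis j 1)) (at (\<phi> p)) (axis i 1))"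
      if "smooth_vf A U Z" for Z j
    proof -
      let ?G = "\<lambda>y. frechet_derivative F (at y) (axis j 1)"
      have lin: "linear (frechet_derivative ?G (at (\<phi> p)))"
        by (rule linear_frechet_derivative[OF smooth_on_differentiable[OF smooth_on_frechet[OF F] V(3)]])
      have "Z p (f' j) = deriv_along (Z p) (f' j)" by (simp add: deriv_along_real)
      also have "\<dots> = frechet_derivative ?G (at (\<phi> p)) (deriv_along (Z p) \<phi>)"
        unfolding f'_def
        by (rule deriv_along_compose[OF smooth_vf_tangent[OF that p] \<phi>' W'(2) V(1,2) smooth_on_frechet[OF F]])
      also have "\<dots> = frechet_derivative ?G (at (\<phi> p)) (\<Sum>i\<in>UNIV. (deriv_along (Z p) \<phi> $ i) *\<^sub>R axis i 1)"
        using basis_expansion[of "deriv_along (Z p) \<phi>"] by (simp add: scalar_mult_eq_scaleR)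
      finally show ?thesis by (simp add: linear_sum[OF lin] linear_cmul[OF lin])
    qed
    have iter: "Z p (\<lambda>q. Z' q f) = (\<Sum>j\<in>UNIV. deriv_along (Z' p) \<phi> $ j * Z p (f' j)
        + deriv_along (Z p) (\<lambda>q. deriv_along (Z' q) \<phi>) $ j * f' j p)"
      if Z: "smooth_vf A U Z" "smooth_vf A U Z'" for Z Z'
    proof -
      define z where "z = (\<lambda>q. deriv_along (Z' q) \<phi>)"
      have z: "smooth_fun A W' z" unfolding z_def by (rule smooth_vf_deriv[OF Z(2) \<phi>' W'(5)])
      have zj: "smooth_fun A W' (\<lambda>q. z q $ j)" for j
        by (rule smooth_fun_bounded_linear[OF bounded_linear_vec_nth z])
      have zf: "smooth_fun A W' (\<lambda>q. z q $ j * f' j q)" for j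
        by (rule smooth_fun_bilinear[OF bounded_bilinear_mult zj f's])
      note tz = smooth_vf_tangent[OF Z(1) p]
      have "Z p (\<lambda>q. Z' q f) = deriv_along (Z p) (\<lambda>q. Z' q f)" by (simp add: deriv_along_real)
      also have "\<dots> = deriv_along (Z p) (\<lambda>q. \<Sum>j\<in>UNIV. z q $ j * f' j q)"
        by (rule deriv_along_cong[OF tz _ W'(2), symmetric, OF smooth_fun_sum[OF W'(1) zf]])
          (simp add: z_def deriv_along_real along[OF Z(2)])
      also have "\<dots> = (\<Sum>j\<in>UNIV. z p $ j * deriv_along (Z p) (f' j)
          + deriv_along (Z p) (\<lambda>q. z q $ j) * f' j p)"
        by (subst deriv_along_sum[OF tz W'(1,2) zf])
          (simp_all add: deriv_along_bilinear[OF tz bounded_bilinear_mult zj f's W'(2)])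
      finally have "Z p (\<lambda>q. Z' q f) = (\<Sum>j\<in>UNIV. z p $ j * Z p (f' j) + deriv_along (Z p) z $ j * f' j p)"
        using deriv_along_bounded_linear[OF tz bounded_linear_vec_nth z W'(2)]
        by (simp add: deriv_along_real)
      then show ?thesis by (simp add: z_def)
    qed
    \<comment> \<open>The second order terms of the two iterated derivatives are equal.\<close>
    have sym: "(\<Sum>j\<in>UNIV. b p $ j * X p (f' j)) = (\<Sum>j\<in>UNIV. a p $ j * Y p (f' j))"
    proof -
      let ?H = "\<lambda>j i. frechet_derivative (\<lambda>y. frechet_derivative F (at y) (axis j 1)) (at (\<phi> p)) (axis i 1)"
      have "(\<Sum>j\<in>UNIV. b p $ j * X p (f' j)) = (\<Sum>j\<in>UNIV. \<Sum>i\<in>UNIV. b p $ j * (a p $ i * ?H j i))"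
        by (simp add: second[OF X] a_def sum_distrib_left)
      also have "\<dots> = (\<Sum>i\<in>UNIV. \<Sum>j\<in>UNIV. b p $ j * (a p $ i * ?H j i))" by (rule sum.swap)
      also have "\<dots> = (\<Sum>i\<in>UNIV. \<Sum>j\<in>UNIV. a p $ i * (b p $ j * ?H i j))"
        by (intro sum.cong refl) (simp add: second_derivative_symmetric_real[OF V(1,3) F])
      finally show ?thesis by (simp add: second[OF Y] b_def sum_distrib_left)
    qed
    have "lie_bracket A X Y p f = X p (\<lambda>q. Y q f) - Y p (\<lambda>q. X q f)"
      using f by (simp add: lie_bracket_def)
    also have "\<dots> = (\<Sum>j\<in>UNIV. v $ j * f' j p)"
      using sym unfolding iter[OF X Y] iter[OF Y X] v_def
      by (simp add: sum.distrib a_def[abs_def] b_def[abs_def] sum_subtractf left_diff_distrib)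
    also have "\<dots> = frechet_derivative F (at (\<phi> p)) v"
      unfolding f'_def by (rule expand[OF V(3), symmetric])
    finally show ?thesis by (simp add: F_def comp_def)
  qed
  then have "lie_bracket A X Y p =
      (\<lambda>f. if smooth_at A p f then frechet_derivative (f \<circ> inv_into U0 \<phi>) (at (\<phi> p)) v else 0)"
    by (auto simp: fun_eq_iff lie_bracket_def)
  then show ?thesis using c unfolding tangent_space_def by blast
qed

lemma lie_bracket_deriv_along:
  fixes F :: "'m \<Rightarrow> 'v::euclidean_space"
  assumes X: "smooth_vf A U X" and Y: "smooth_vf A U Y" and F: "smooth_fun A W F" "p \<in> W" "W \<subseteq> U"
  shows "deriv_along (lie_bracket A X Y p) F =
    deriv_along (X p) (\<lambda>q. deriv_along (Y q) F) - deriv_along (Y p) (\<lambda>q. deriv_along (X q) F)"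
proof -
  have p: "p \<in> U" using F by auto
  have comp: "deriv_along x (\<lambda>q. deriv_along (Z q) F) \<bullet> b = x (\<lambda>q. Z q (\<lambda>r. F r \<bullet> b))"
    if "x \<in> tangent_space A p" "smooth_vf A U Z" "b \<in> Basis" for x Z b
  proof -
    have e: "deriv_along (Z q) F \<bullet> b = Z q (\<lambda>r. F r \<bullet> b)" if "b \<in> Basis" for q b
      unfolding deriv_along_def using that by (simp add: inner_sum_left inner_Basis if_distrib sum.delta cong: if_cong)
    show ?thesis
      using deriv_along_bounded_linear[OF that(1) bounded_linear_inner_left[of b]
          smooth_vf_deriv[OF that(2) F(1,3)] F(2)] e[OF that(3)]
      by (simp add: deriv_along_real)
  qed
  have "deriv_along (lie_bracket A X Y p) F \<bullet> b =
    (deriv_along (X p) (\<lambda>q. deriv_along (Y q) F) - deriv_along (Y p) (\<lambda>q. deriv_along (X q) F)) \<bullet> b"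
    if b: "b \<in> Basis" for b
  proof -
    have "deriv_along (lie_bracket A X Y p) F \<bullet> b = lie_bracket A X Y p (\<lambda>r. F r \<bullet> b)"
      unfolding deriv_along_def using b
      by (simp add: inner_sum_left inner_Basis if_distrib sum.delta cong: if_cong)
    also have "\<dots> = X p (\<lambda>q. Y q (\<lambda>r. F r \<bullet> b)) - Y p (\<lambda>q. X q (\<lambda>r. F r \<bullet> b))"
      using smooth_at_inner[OF smooth_atI[OF F(1,2)]] by (simp add: lie_bracket_def)
    finally show ?thesis
      using comp[OF smooth_vf_tangent[OF X p] Y b] comp[OF smooth_vf_tangent[OF Y p] X b]
      by (simp add: inner_diff_left)
  qed
  then show ?thesis by (rule euclidean_eqI)
qed

lemma smooth_vf_lie_bracket:
  assumes X: "smooth_vf A U X" and Y: "smooth_vf A U Y"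
  shows "smooth_vf A U (lie_bracket A X Y)"
  unfolding smooth_vf_def
proof (intro conjI ballI allI impI)
  show "open U" by (rule smooth_vf_open[OF X])
  show "lie_bracket A X Y p \<in> tangent_space A p" if "p \<in> U" for p
    by (rule lie_bracket_tangent[OF X Y that])
  fix W and f :: "'m \<Rightarrow> real" assume f: "W \<subseteq> U" "smooth_fun A W f"
  have "smooth_fun A W (\<lambda>p. deriv_along (X p) (\<lambda>q. deriv_along (Y q) f)
     - deriv_along (Y p) (\<lambda>q. deriv_along (X q) f))"
    by (intro smooth_fun_diff smooth_vf_deriv[OF X] smooth_vf_deriv[OF Y] f)
  then show "smooth_fun A W (\<lambda>p. lie_bracket A X Y p f)"
    by (rule smooth_fun_cong)
      (use lie_bracket_deriv_along[OF X Y f(2) _ f(1)] in \<open>simp add: deriv_along_real\<close>)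
qed

end


section \<open>Lie algebra and infinitesimal representations\<close>

lemma bounded_bilinear_matrix_mult:
  "bounded_bilinear ((**) :: real^'m^'k::finite \<Rightarrow> real^'n::finite^'m::finite \<Rightarrow> real^'n^'k)"
  unfolding bilinear_conv_bounded_bilinear[symmetric] bilinear_def
  by (auto intro!: linearI simp: vec_eq_iff matrix_matrix_mult_def algebra_simps sum.distrib
      scaleR_sum_right sum_distrib_left)

lemma bounded_bilinear_matrix_vector:
  "bounded_bilinear ((*v) :: real^'n::finite^'m::finite \<Rightarrow> real^'n \<Rightarrow> real^'m)"
  unfolding bilinear_conv_bounded_bilinear[symmetric] bilinear_def
  by (auto intro!: linearI simp: vec_eq_iff matrix_vector_mult_def algebra_simps sum.distrib
      scaleR_sum_right sum_distrib_left)

lemma linear_transpose: "linear (transpose :: real^'n::finite^'m::finite \<Rightarrow> _)"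
  by (auto intro!: linearI simp: vec_eq_iff transpose_def)

lemma matrix_mult_nth: "(X ** Y) $ i $ j = (\<Sum>k\<in>UNIV. X $ i $ k * Y $ k $ j)"
  by (simp add: matrix_matrix_mult_def)

lemma transpose_nth: "transpose X $ i $ j = X $ j $ i"
  by (simp add: transpose_def)

lemma mat_nth: "mat c $ i $ j = (if i = j then c else 0)"
  by (simp add: mat_def)

text \<open>For the Frobenius product, conjugation by k and by its transpose are adjoint; this makes
  the projection to the Lie algebra equivariant.\<close>

lemma matrix_inner_conj:
  fixes X Z k :: "real^'n::finite^'n"
  shows "(k ** X ** transpose k) \<bullet> Z = X \<bullet> (transpose k ** Z ** k)"
proof -
  have "(k ** X ** transpose k) \<bullet> Z =
    (\<Sum>i\<in>UNIV. \<Sum>j\<in>UNIV. \<Sum>b\<in>UNIV. \<Sum>a\<in>UNIV. k $ i $ a * X $ a $ b * k $ j $ b * Z $ i $ j)"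
    by (simp add: inner_vec_def matrix_mult_nth transpose_nth sum_distrib_right sum_distrib_left mult_ac)
  also have "\<dots> = (\<Sum>i\<in>UNIV. \<Sum>b\<in>UNIV. \<Sum>j\<in>UNIV. \<Sum>a\<in>UNIV. k $ i $ a * X $ a $ b * k $ j $ b * Z $ i $ j)"
    by (intro sum.cong refl sum.swap)
  also have "\<dots> = (\<Sum>b\<in>UNIV. \<Sum>i\<in>UNIV. \<Sum>j\<in>UNIV. \<Sum>a\<in>UNIV. k $ i $ a * X $ a $ b * k $ j $ b * Z $ i $ j)"
    by (rule sum.swap)
  also have "\<dots> = (\<Sum>b\<in>UNIV. \<Sum>i\<in>UNIV. \<Sum>a\<in>UNIV. \<Sum>j\<in>UNIV. k $ i $ a * X $ a $ b * k $ j $ b * Z $ i $ j)"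
    by (intro sum.cong refl sum.swap)
  also have "\<dots> = (\<Sum>b\<in>UNIV. \<Sum>a\<in>UNIV. \<Sum>i\<in>UNIV. \<Sum>j\<in>UNIV. k $ i $ a * X $ a $ b * k $ j $ b * Z $ i $ j)"
    by (intro sum.cong refl sum.swap)
  also have "\<dots> = (\<Sum>a\<in>UNIV. \<Sum>b\<in>UNIV. \<Sum>i\<in>UNIV. \<Sum>j\<in>UNIV. k $ i $ a * X $ a $ b * k $ j $ b * Z $ i $ j)"
    by (rule sum.swap)
  also have "\<dots> = (\<Sum>a\<in>UNIV. \<Sum>b\<in>UNIV. \<Sum>j\<in>UNIV. \<Sum>i\<in>UNIV. k $ i $ a * X $ a $ b * k $ j $ b * Z $ i $ j)"
    by (intro sum.cong refl sum.swap)
  also have "\<dots> = X \<bullet> (transpose k ** Z ** k)"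
    by (simp add: inner_vec_def matrix_mult_nth transpose_nth sum_distrib_right sum_distrib_left mult_ac)
  finally show ?thesis .
qed

lemma has_vector_derivative_bounded_linear:
  "bounded_linear L \<Longrightarrow> (f has_vector_derivative f') F \<Longrightarrow> ((\<lambda>x. L (f x)) has_vector_derivative L f') F"
  using bounded_linear.has_vector_derivative by blast

text \<open>\<open>inf_rep\<close> chooses a curve with the given velocity and is meaningful only on
  the Lie algebra. Projecting first gives an operation defined and bilinear on all matrices, which
  agrees with \<open>inf_rep\<close> on the Lie algebra and already contains the projection
  occurring in q(R).\<close>

definition star :: "('n::finite) mat set \<Rightarrow> ('n mat \<Rightarrow> 'v::euclidean_space \<Rightarrow> 'v) \<Rightarrow> 'n mat \<Rightarrow> 'v \<Rightarrow> 'v" where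
  "star H \<rho> X v = inf_rep H \<rho> (pr_hol H X) v"

text \<open>The representation on \<open>T \<otimes> V\<close>, whose elements are given by their \<open>V\<close>-valued components.\<close>

definition tens :: "(('n::finite) mat \<Rightarrow> 'v::euclidean_space \<Rightarrow> 'v) \<Rightarrow> 'n mat \<Rightarrow> 'v ^ 'n \<Rightarrow> 'v ^ 'n" where
  "tens \<rho> h F = (\<chi> j. \<Sum>l\<in>UNIV. (h $ j $ l) *\<^sub>R \<rho> h (F $ l))"

locale so_subgroup =
  fixes H :: "('n::finite) mat set"
  assumes subgroup: "closed_subgroup_SO H"
begin

section \<open>The structure group and its Lie algebra\<close>

lemma H_one: "mat 1 \<in> H" and H_mult: "h \<in> H \<Longrightarrow> k \<in> H \<Longrightarrow> h ** k \<in> H"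
  and H_orthogonal: "h \<in> H \<Longrightarrow> orthogonal_matrix h"
  using subgroup unfolding closed_subgroup_SO_def by auto

lemma H_transpose_mult:
  assumes "h \<in> H" shows "h ** transpose h = mat 1" "transpose h ** h = mat 1"
  using H_orthogonal[OF assms] unfolding orthogonal_matrix_def by auto

lemma H_inv: assumes "h \<in> H" shows "matrix_inv h = transpose h"
proof -
  have "h ** matrix_inv h = mat 1 \<and> matrix_inv h ** h = mat 1"
    unfolding matrix_inv_def by (rule someI[of _ "transpose h"]) (use H_transpose_mult[OF assms] in auto)
  then have "transpose h ** (h ** matrix_inv h) = transpose h" by simp
  then show ?thesis using H_transpose_mult[OF assms] by (simp add: matrix_mul_assoc)
qed

lemma H_transpose: "h \<in> H \<Longrightarrow> transpose h \<in> H"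
  using subgroup H_inv unfolding closed_subgroup_SO_def by force

lemma lie_curveI:
  assumes "smooth_on UNIV c" "\<And>t. c t \<in> H" "c 0 = mat 1" "(c has_vector_derivative X) (at 0)"
  shows "lie_curve H X c"
  using assms unfolding lie_curve_def by auto

lemma lie_curveD:
  assumes "lie_curve H X c"
  shows "smooth_on UNIV c" "c t \<in> H" "c 0 = mat 1" "(c has_vector_derivative X) (at 0)"
  using assms unfolding lie_curve_def by auto

lemma lie_curve_scale:
  assumes c: "lie_curve H X c" shows "lie_curve H (a *\<^sub>R X) (\<lambda>t. c (a * t))"
proof (rule lie_curveI)
  show "smooth_on UNIV (\<lambda>t. c (a * t))"
    by (rule smooth_on_compose[of _ UNIV "\<lambda>t. a * t"])
      (auto intro: lie_curveD[OF c] smooth_on_bounded_linear[OF _ bounded_linear_mult_right] smooth_on_ident)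
  have "((\<lambda>t. a * t) has_vector_derivative a) (at 0)"
    by (auto intro!: derivative_eq_intros simp: has_vector_derivative_def)
  then have "((c \<circ> (\<lambda>t. a * t)) has_vector_derivative a *\<^sub>R X) (at 0)"
    by (rule vector_diff_chain_at) (use lie_curveD(4)[OF c] in simp)
  then show "((\<lambda>t. c (a * t)) has_vector_derivative a *\<^sub>R X) (at 0)" by (simp add: comp_def)
qed (use lie_curveD[OF c] in auto)

text \<open>At the identity the derivative of a product is the sum of the derivatives; this is why
  velocities of curves in H are closed under addition.\<close>

lemma lie_curve_mult:
  assumes c: "lie_curve H X c" and d: "lie_curve H Y d"
  shows "lie_curve H (X + Y) (\<lambda>t. c t ** d t)"
proof (rule lie_curveI)
  show "smooth_on UNIV (\<lambda>t. c t ** d t)"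
    by (rule smooth_on_bilinear[OF open_UNIV bounded_bilinear_matrix_mult lie_curveD(1)[OF c] lie_curveD(1)[OF d]])
  show "((\<lambda>t. c t ** d t) has_vector_derivative X + Y) (at 0)"
    using bounded_bilinear.has_vector_derivative[OF bounded_bilinear_matrix_mult lie_curveD(4)[OF c] lie_curveD(4)[OF d]]
    by (simp add: lie_curveD(3)[OF c] lie_curveD(3)[OF d] add.commute)
qed (use lie_curveD[OF c] lie_curveD[OF d] H_mult in auto)

lemma lie_curve_conj:
  assumes c: "lie_curve H X c" and h: "h \<in> H"
  shows "lie_curve H (h ** X ** transpose h) (\<lambda>t. h ** c t ** transpose h)"
proof (rule lie_curveI)
  have bl: "bounded_linear (\<lambda>X. h ** X ** transpose h)"
    by (rule bounded_linear_compose[OF bounded_bilinear.bounded_linear_left[OF bounded_bilinear_matrix_mult]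
        bounded_bilinear.bounded_linear_right[OF bounded_bilinear_matrix_mult]])
  show "smooth_on UNIV (\<lambda>t. h ** c t ** transpose h)"
    by (rule smooth_on_bounded_linear[OF open_UNIV bl lie_curveD(1)[OF c]])
  show "((\<lambda>t. h ** c t ** transpose h) has_vector_derivative h ** X ** transpose h) (at 0)"
    by (rule has_vector_derivative_bounded_linear[OF bl lie_curveD(4)[OF c]])
qed (use lie_curveD[OF c] H_mult H_transpose[OF h] h H_transpose_mult[OF h] in auto)

lemma subspace_lie_algebra: "subspace (lie_algebra H)"
proof (rule subspaceI)
  have "lie_curve H 0 (\<lambda>t. mat 1)"
    by (rule lie_curveI) (auto simp: smooth_on_const H_one)
  then show "0 \<in> lie_algebra H" unfolding lie_algebra_def by blast
qed (auto simp: lie_algebra_def intro: lie_curve_mult lie_curve_scale)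

lemma lie_algebra_conj: "X \<in> lie_algebra H \<Longrightarrow> h \<in> H \<Longrightarrow> h ** X ** transpose h \<in> lie_algebra H"
  unfolding lie_algebra_def using lie_curve_conj by blast

lemma lie_curve_transpose:
  assumes "lie_curve H X c"
  shows "((\<lambda>t. transpose (c t)) has_vector_derivative transpose X) (at 0)"
  by (rule has_vector_derivative_bounded_linear[OF linear_transpose[unfolded linear_conv_bounded_linear]
        lie_curveD(4)[OF assms]])

text \<open>Differentiate c(t) c(t)^T = 1 at t = 0.\<close>

lemma lie_algebra_skew: assumes "X \<in> lie_algebra H" shows "transpose X = - X"
proof -
  obtain c where c: "lie_curve H X c" using assms unfolding lie_algebra_def by blast
  have "((\<lambda>t. c t ** transpose (c t)) has_vector_derivative c 0 ** transpose X + X ** transpose (c 0)) (at 0)"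
    by (rule bounded_bilinear.has_vector_derivative[OF bounded_bilinear_matrix_mult lie_curveD(4)[OF c]
        lie_curve_transpose[OF c]])
  moreover have "(\<lambda>t. c t ** transpose (c t)) = (\<lambda>t. mat 1)"
    using H_transpose_mult lie_curveD(2)[OF c] by auto
  ultimately have "transpose X + X = 0"
    using vector_derivative_unique_at[OF _ has_vector_derivative_const] by (simp add: lie_curveD(3)[OF c])
  then show ?thesis by (simp add: eq_neg_iff_add_eq_0)
qed

text \<open>\<open>lambda2_inner\<close> is half the Frobenius product, so this is orthogonal
  projection onto a subspace of all matrices; it justifies the description operator in
  \<open>pr_hol\<close>.\<close>

lemma pr_hol_unique:
  "\<exists>!Y. Y \<in> lie_algebra H \<and> (\<forall>Z\<in>lie_algebra H. lambda2_inner (X - Y) Z = 0)"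
proof -
  have l: "lambda2_inner X Y = (X \<bullet> Y) / 2" for X Y :: "'n mat"
    by (simp add: lambda2_inner_def inner_vec_def)
  obtain y z where "y \<in> span (lie_algebra H)" "\<And>w. w \<in> span (lie_algebra H) \<Longrightarrow> orthogonal z w" "X = y + z"
    using orthogonal_subspace_decomp_exists[of "lie_algebra H" X] by metis
  then have y: "y \<in> lie_algebra H" "\<forall>Z\<in>lie_algebra H. (X - y) \<bullet> Z = 0"
    using subspace_lie_algebra unfolding span_eq_iff[symmetric] by (auto simp: orthogonal_def)
  have uniq: "Y = y" if Y: "Y \<in> lie_algebra H" "\<forall>Z\<in>lie_algebra H. (X - Y) \<bullet> Z = 0" for Y
  proof -
    have m: "Y - y \<in> lie_algebra H" using subspace_diff[OF subspace_lie_algebra] Y y by blast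
    have "(Y - y) \<bullet> (Y - y) = (X - y) \<bullet> (Y - y) - (X - Y) \<bullet> (Y - y)" by (simp add: inner_diff_left)
    also have "\<dots> = 0" using y(2) Y(2) m by simp
    finally show ?thesis by simp
  qed
  have "\<exists>!Y. Y \<in> lie_algebra H \<and> (\<forall>Z\<in>lie_algebra H. (X - Y) \<bullet> Z = 0)"
  proof (rule ex1I)
    show "y \<in> lie_algebra H \<and> (\<forall>Z\<in>lie_algebra H. (X - y) \<bullet> Z = 0)" using y by (rule conjI)
  qed (elim conjE, rule uniq)
  then show ?thesis by (simp add: l)
qed

lemma pr_hol_in: "pr_hol H X \<in> lie_algebra H"
  and pr_hol_inner: "Z \<in> lie_algebra H \<Longrightarrow> (X - pr_hol H X) \<bullet> Z = 0"
  using theI'[OF pr_hol_unique[of X]] unfolding pr_hol_def[symmetric]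
  by (auto simp: lambda2_inner_def inner_vec_def)

lemma pr_hol_eqI: "Y \<in> lie_algebra H \<Longrightarrow> (\<And>Z. Z \<in> lie_algebra H \<Longrightarrow> (X - Y) \<bullet> Z = 0) \<Longrightarrow> pr_hol H X = Y"
  unfolding pr_hol_def by (rule the1_equality[OF pr_hol_unique]) (auto simp: lambda2_inner_def inner_vec_def)

lemma pr_hol_id: "X \<in> lie_algebra H \<Longrightarrow> pr_hol H X = X"
  by (rule pr_hol_eqI) auto

lemma linear_pr_hol: "linear (pr_hol H)"
proof (rule linearI)
  show "pr_hol H (X + Y) = pr_hol H X + pr_hol H Y" for X Y
  proof (rule pr_hol_eqI)
    show "(X + Y - (pr_hol H X + pr_hol H Y)) \<bullet> Z = 0" if "Z \<in> lie_algebra H" for Z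
      using pr_hol_inner[OF that, of X] pr_hol_inner[OF that, of Y] by (simp add: inner_diff_left inner_add_left)
  qed (intro subspace_add[OF subspace_lie_algebra] pr_hol_in)
  show "pr_hol H (a *\<^sub>R X) = a *\<^sub>R pr_hol H X" for a X
  proof (rule pr_hol_eqI)
    show "(a *\<^sub>R X - a *\<^sub>R pr_hol H X) \<bullet> Z = 0" if "Z \<in> lie_algebra H" for Z
      using pr_hol_inner[OF that, of X] by (simp add: inner_diff_left)
  qed (intro subspace_scale[OF subspace_lie_algebra] pr_hol_in)
qed

text \<open>Conjugation by h preserves the Lie algebra and, by adjointness, its orthogonal
  complement.\<close>

lemma pr_hol_conj: assumes h: "h \<in> H" shows "pr_hol H (h ** X ** transpose h) = h ** pr_hol H X ** transpose h"
proof (rule pr_hol_eqI)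
  show "h ** pr_hol H X ** transpose h \<in> lie_algebra H" by (rule lie_algebra_conj[OF pr_hol_in h])
  fix Z assume "Z \<in> lie_algebra H"
  then have Z: "transpose h ** Z ** h \<in> lie_algebra H"
    using lie_algebra_conj[OF _ H_transpose[OF h], of Z] by simp
  have "(h ** X ** transpose h - h ** pr_hol H X ** transpose h) \<bullet> Z
      = (X - pr_hol H X) \<bullet> (transpose h ** Z ** h)"
    by (simp add: inner_diff_left matrix_inner_conj)
  then show "(h ** X ** transpose h - h ** pr_hol H X ** transpose h) \<bullet> Z = 0"
    using pr_hol_inner[OF Z] by simp
qed

section \<open>Infinitesimal representations\<close>

lemma rep_local_extension:
  assumes "lie_representation H \<rho>" "h \<in> H"
  obtains W F where "open W" "h \<in> W" "smooth_on W F" "\<And>k. k \<in> W \<Longrightarrow> k \<in> H \<Longrightarrow> F k = \<rho> k v"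
  using assms unfolding lie_representation_def by (metis IntI)

lemma rep_linear: "lie_representation H \<rho> \<Longrightarrow> h \<in> H \<Longrightarrow> linear (\<rho> h)"
  and rep_one: "lie_representation H \<rho> \<Longrightarrow> \<rho> (mat 1) v = v"
  and rep_mult: "lie_representation H \<rho> \<Longrightarrow> h \<in> H \<Longrightarrow> k \<in> H \<Longrightarrow> \<rho> (h ** k) v = \<rho> h (\<rho> k v)"
  unfolding lie_representation_def by auto

lemma rep_inverse:
  assumes "lie_representation H \<rho>" "h \<in> H"
  shows "\<rho> (transpose h) (\<rho> h v) = v" "\<rho> h (\<rho> (transpose h) v) = v"
  using rep_mult[OF assms(1) H_transpose[OF assms(2)] assms(2), of v]
    rep_mult[OF assms(1) assms(2) H_transpose[OF assms(2)], of v] rep_one[OF assms(1)]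
  by (simp_all add: H_transpose_mult[OF assms(2)])

text \<open>The extension F agrees with the orbit map only on H, but c stays in H. The derivative
  involves c only through its velocity X, which makes the choice of curve in \<open>inf_rep\<close>
  harmless.\<close>

lemma rep_curve_derivative:
  assumes c: "lie_curve H X c" and W: "open W" "mat 1 \<in> W" and F: "smooth_on W F"
    and e: "\<And>k. k \<in> W \<Longrightarrow> k \<in> H \<Longrightarrow> F k = \<rho> k v"
  shows "((\<lambda>t. \<rho> (c t) v) has_vector_derivative frechet_derivative F (at (mat 1)) X) (at 0)"
proof -
  have "F differentiable (at (mat 1))" by (rule smooth_on_differentiable[OF F W(2)])
  then have F1: "(F has_derivative frechet_derivative F (at (mat 1))) (at (c 0))"
    by (simp add: frechet_derivative_works[symmetric] lie_curveD(3)[OF c])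
  have lin: "linear (frechet_derivative F (at (mat 1)))"
    using F1 has_derivative_linear by blast
  have "((\<lambda>t. F (c t)) has_derivative (\<lambda>t. frechet_derivative F (at (mat 1)) (t *\<^sub>R X))) (at 0)"
    by (rule has_derivative_compose[OF lie_curveD(4)[OF c, unfolded has_vector_derivative_def] F1])
  then have d: "((\<lambda>t. F (c t)) has_vector_derivative frechet_derivative F (at (mat 1)) X) (at 0)"
    by (simp add: has_vector_derivative_def linear_cmul[OF lin])
  have "open (c -` W)"
    using smooth_on_continuous_on[OF lie_curveD(1)[OF c]] W(1) by (simp add: open_vimage)
  then show ?thesis
    by (rule has_vector_derivative_transform_within_open[OF d])
      (use W e lie_curveD[OF c] in auto)
qed

lemma inf_rep_curve:
  assumes \<rho>: "lie_representation H \<rho>" and c: "lie_curve H X c"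
  shows "((\<lambda>t. \<rho> (c t) v) has_vector_derivative inf_rep H \<rho> X v) (at 0)"
proof -
  obtain W F where W: "open W" "mat 1 \<in> W" "smooth_on W F" "\<And>k. k \<in> W \<Longrightarrow> k \<in> H \<Longrightarrow> F k = \<rho> k v"
    using rep_local_extension[OF \<rho> H_one] by metis
  have "lie_curve H X (SOME c. lie_curve H X c)" using c by (rule someI[where P="lie_curve H X"])
  then have "inf_rep H \<rho> X v = frechet_derivative F (at (mat 1)) X"
    unfolding inf_rep_def by (intro vector_derivative_at rep_curve_derivative[where \<rho>=\<rho> and v=v, OF _ W])
  then show ?thesis using rep_curve_derivative[where \<rho>=\<rho> and v=v, OF c W] by simp
qed

lemma lie_algebra_curve: assumes "X \<in> lie_algebra H" obtains c where "lie_curve H X c"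
  using assms unfolding lie_algebra_def by blast

lemma inf_rep_unique:
  assumes "lie_representation H \<rho>" "lie_curve H X c" "((\<lambda>t. \<rho> (c t) v) has_vector_derivative w) (at 0)"
  shows "inf_rep H \<rho> X v = w"
  using vector_derivative_unique_at[OF inf_rep_curve[OF assms(1,2)] assms(3)] .

lemma inf_rep_extension:
  assumes \<rho>: "lie_representation H \<rho>" and X: "X \<in> lie_algebra H"
    and W: "open W" "mat 1 \<in> W" "smooth_on W F" "\<And>k. k \<in> W \<Longrightarrow> k \<in> H \<Longrightarrow> F k = \<rho> k v"
  shows "inf_rep H \<rho> X v = frechet_derivative F (at (mat 1)) X"
proof -
  obtain c where c: "lie_curve H X c" using lie_algebra_curve[OF X] .
  show ?thesis by (rule inf_rep_unique[OF \<rho> c rep_curve_derivative[where \<rho>=\<rho> and v=v, OF c W]])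
qed

lemma star_lie: "X \<in> lie_algebra H \<Longrightarrow> star H \<rho> X v = inf_rep H \<rho> X v"
  by (simp add: star_def pr_hol_id)

text \<open>Linearity in v holds along one fixed curve, since each \<rho>(c t) is linear. Linearity
  in X is seen differently: the operation is the differential of a local extension of the orbit map,
  composed with the projection.\<close>

lemma bilinear_star: assumes \<rho>: "lie_representation H \<rho>" shows "bilinear (star H \<rho>)"
  unfolding bilinear_def
proof (intro conjI allI)
  fix X show "linear (star H \<rho> X)"
  proof -
    obtain c where c: "lie_curve H (pr_hol H X) c" using lie_algebra_curve[OF pr_hol_in] .
    note lin = rep_linear[OF \<rho> lie_curveD(2)[OF c]]
    show ?thesis unfolding star_def
    proof (rule linearI)
      show "inf_rep H \<rho> (pr_hol H X) (v + w) = inf_rep H \<rho> (pr_hol H X) v + inf_rep H \<rho> (pr_hol H X) w" for v w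
        using has_vector_derivative_add[OF inf_rep_curve[OF \<rho> c, of v] inf_rep_curve[OF \<rho> c, of w]]
        by (intro inf_rep_unique[OF \<rho> c]) (simp add: linear_add[OF lin])
      show "inf_rep H \<rho> (pr_hol H X) (a *\<^sub>R v) = a *\<^sub>R inf_rep H \<rho> (pr_hol H X) v" for a v
        using has_vector_derivative_bounded_linear[OF bounded_linear_scaleR_right inf_rep_curve[OF \<rho> c, of v]]
        by (intro inf_rep_unique[OF \<rho> c]) (simp add: linear_cmul[OF lin])
    qed
  qed
next
  fix v
  obtain W F where W: "open W" "mat 1 \<in> W" "smooth_on W F" "\<And>k. k \<in> W \<Longrightarrow> k \<in> H \<Longrightarrow> F k = \<rho> k v"
    using rep_local_extension[OF \<rho> H_one] by metis
  have "(\<lambda>X. star H \<rho> X v) = frechet_derivative F (at (mat 1)) \<circ> pr_hol H"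
    by (auto simp: star_def inf_rep_extension[where v=v, OF \<rho> pr_hol_in W])
  moreover have "linear (frechet_derivative F (at (mat 1)))"
    by (rule linear_frechet_derivative[OF smooth_on_differentiable[OF W(3,2)]])
  ultimately show "linear (\<lambda>X. star H \<rho> X v)" using linear_compose[OF linear_pr_hol] by metis
qed

lemma bounded_bilinear_star: "lie_representation H \<rho> \<Longrightarrow> bounded_bilinear (star H \<rho>)"
  using bilinear_star bilinear_conv_bounded_bilinear by blast

lemma star_conj:
  assumes \<rho>: "lie_representation H \<rho>" and h: "h \<in> H"
  shows "star H \<rho> (h ** X ** transpose h) (\<rho> h v) = \<rho> h (star H \<rho> X v)"
proof -
  obtain c where c: "lie_curve H (pr_hol H X) c" using lie_algebra_curve[OF pr_hol_in] .
  have bl: "bounded_linear (\<rho> h)" using rep_linear[OF \<rho> h] by (simp add: linear_conv_bounded_linear)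
  have "((\<lambda>t. \<rho> (h ** c t ** transpose h) (\<rho> h v)) has_vector_derivative \<rho> h (inf_rep H \<rho> (pr_hol H X) v)) (at 0)"
    using has_vector_derivative_bounded_linear[OF bl inf_rep_curve[OF \<rho> c, of v]]
    by (simp add: rep_mult[OF \<rho>] H_mult h H_transpose lie_curveD(2)[OF c] rep_inverse[OF \<rho> h])
  then show ?thesis
    unfolding star_def pr_hol_conj[OF h] by (intro inf_rep_unique[OF \<rho> lie_curve_conj[OF c h]])
qed

text \<open>The linear projection \<open>pr_hol\<close> fixes a curve in the Lie algebra, hence
  fixes its derivative.\<close>

lemma lie_algebra_closed_derivative:
  assumes "(f has_vector_derivative X) F" "\<And>t. f t \<in> lie_algebra H" "F = at (t0 :: real)"
  shows "X \<in> lie_algebra H"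
proof -
  have "((\<lambda>t. pr_hol H (f t)) has_vector_derivative pr_hol H X) F"
    by (rule has_vector_derivative_bounded_linear[OF linear_pr_hol[unfolded linear_conv_bounded_linear] assms(1)])
  then have "(f has_vector_derivative pr_hol H X) (at t0)"
    using assms(3) by (simp add: pr_hol_id[OF assms(2)])
  from vector_derivative_unique_at[OF this] have "pr_hol H X = X" using assms(1,3) by simp
  then show ?thesis using pr_hol_in by metis
qed

lemma conj_curve_derivative:
  assumes c: "lie_curve H X c"
  shows "((\<lambda>t. c t ** Y ** transpose (c t)) has_vector_derivative X ** Y - Y ** X) (at 0)"
proof -
  have "X \<in> lie_algebra H" using c unfolding lie_algebra_def by blast
  note skew = lie_algebra_skew[OF this]
  have "((\<lambda>t. c t ** Y ** transpose (c t)) has_vector_derivative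
      c 0 ** Y ** transpose X + X ** Y ** transpose (c 0)) (at 0)"
    by (rule bounded_bilinear.has_vector_derivative[OF bounded_bilinear_matrix_mult
        has_vector_derivative_bounded_linear[OF bounded_bilinear.bounded_linear_left[OF bounded_bilinear_matrix_mult]
          lie_curveD(4)[OF c]] lie_curve_transpose[OF c]])
  then show ?thesis
    by (simp add: lie_curveD(3)[OF c] skew bounded_bilinear.minus_right[OF bounded_bilinear_matrix_mult])
qed

lemma lie_algebra_bracket:
  assumes X: "X \<in> lie_algebra H" and Y: "Y \<in> lie_algebra H" shows "X ** Y - Y ** X \<in> lie_algebra H"
proof -
  obtain c where c: "lie_curve H X c" using lie_algebra_curve[OF X] .
  show ?thesis
    by (rule lie_algebra_closed_derivative[OF conj_curve_derivative[OF c] _ refl])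
      (rule lie_algebra_conj[OF Y lie_curveD(2)[OF c]])
qed

text \<open>Differentiate \<rho>(c)(Y \<star> v) = (c Y c^T) \<star> \<rho>(c) v at t = 0. Here Y
  ranges over all matrices; below it is also taken to be a basis bivector outside the Lie
  algebra.\<close>

lemma star_bracket:
  assumes \<rho>: "lie_representation H \<rho>" and X: "X \<in> lie_algebra H"
  shows "star H \<rho> (X ** Y - Y ** X) v = star H \<rho> X (star H \<rho> Y v) - star H \<rho> Y (star H \<rho> X v)"
proof -
  obtain c where c: "lie_curve H X c" using lie_algebra_curve[OF X] .
  have "((\<lambda>t. star H \<rho> (c t ** Y ** transpose (c t)) (\<rho> (c t) v)) has_vector_derivative
     star H \<rho> (c 0 ** Y ** transpose (c 0)) (inf_rep H \<rho> X v) + star H \<rho> (X ** Y - Y ** X) (\<rho> (c 0) v)) (at 0)"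
    by (rule bounded_bilinear.has_vector_derivative[OF bounded_bilinear_star[OF \<rho>]
        conj_curve_derivative[OF c] inf_rep_curve[OF \<rho> c]])
  moreover have "((\<lambda>t. star H \<rho> (c t ** Y ** transpose (c t)) (\<rho> (c t) v)) has_vector_derivative
      inf_rep H \<rho> X (star H \<rho> Y v)) (at 0)"
    using inf_rep_curve[OF \<rho> c] by (simp add: star_conj[OF \<rho> lie_curveD(2)[OF c]])
  ultimately have "star H \<rho> (c 0 ** Y ** transpose (c 0)) (inf_rep H \<rho> X v) + star H \<rho> (X ** Y - Y ** X) (\<rho> (c 0) v)
     = inf_rep H \<rho> X (star H \<rho> Y v)" by (rule vector_derivative_unique_at)
  then show ?thesis by (simp add: lie_curveD(3)[OF c] rep_one[OF \<rho>] star_lie[OF X] algebra_simps)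
qed

lemma star_equivariant:
  assumes \<rho>: "lie_representation H \<rho>" and \<rho>': "lie_representation H \<rho>'" and L: "linear L"
    and e: "\<And>h v. h \<in> H \<Longrightarrow> L (\<rho> h v) = \<rho>' h (L v)"
  shows "L (star H \<rho> X v) = star H \<rho>' X (L v)"
proof -
  obtain c where c: "lie_curve H (pr_hol H X) c" using lie_algebra_curve[OF pr_hol_in] .
  have "((\<lambda>t. \<rho>' (c t) (L v)) has_vector_derivative L (inf_rep H \<rho> (pr_hol H X) v)) (at 0)"
    using has_vector_derivative_bounded_linear[OF L[unfolded linear_conv_bounded_linear] inf_rep_curve[OF \<rho> c, of v]]
    by (simp add: e lie_curveD(2)[OF c])
  then show ?thesis unfolding star_def by (rule inf_rep_unique[OF \<rho>' c, symmetric])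
qed

text \<open>With this representation the Ricci identities apply to real functions, as the Bianchi
  identity requires.\<close>

lemma lie_representation_trivial: "lie_representation H (\<lambda>h v. v)"
  unfolding lie_representation_def
proof (intro conjI ballI allI)
  show "\<exists>W F. open W \<and> h \<in> W \<and> smooth_on W F \<and> (\<forall>k\<in>W \<inter> H. F k = v)" for v h
    by (rule exI[of _ UNIV], rule exI[of _ "\<lambda>_. v"]) (simp add: smooth_on_const)
qed (auto intro: linear_ident)

lemma star_trivial: "star H (\<lambda>h v. v) X v = 0"
proof -
  obtain c where c: "lie_curve H (pr_hol H X) c" using lie_algebra_curve[OF pr_hol_in] .
  show ?thesis unfolding star_def
    by (rule inf_rep_unique[OF lie_representation_trivial c has_vector_derivative_const])
qed

section \<open>The representation on T \<otimes> V\<close>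

lemma tens_representation:
  assumes \<rho>: "lie_representation H \<rho>"
  shows "lie_representation H (tens \<rho>)"
  unfolding lie_representation_def
proof (intro conjI ballI allI)
  show "linear (tens \<rho> h)" if h: "h \<in> H" for h
    by (rule linearI) (simp_all add: tens_def vec_eq_iff linear_add[OF rep_linear[OF \<rho> h]]
        linear_cmul[OF rep_linear[OF \<rho> h]] scaleR_add_right sum.distrib scaleR_sum_right mult.commute)
  show "tens \<rho> (mat 1) = id"
    by (auto simp: fun_eq_iff tens_def vec_eq_iff mat_nth rep_one[OF \<rho>] if_distrib if_distribR cong: if_cong)
  show "tens \<rho> (h ** k) = tens \<rho> h \<circ> tens \<rho> k" if h: "h \<in> H" and k: "k \<in> H" for h k
  proof -
    have "(\<Sum>l\<in>UNIV. (\<Sum>m\<in>UNIV. h $ j $ m * k $ m $ l) *\<^sub>R \<rho> (h ** k) (F $ l)) =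
      (\<Sum>m\<in>UNIV. (h $ j $ m) *\<^sub>R \<rho> h (\<Sum>l\<in>UNIV. (k $ m $ l) *\<^sub>R \<rho> k (F $ l)))" for j F
    proof -
      note lin = rep_linear[OF \<rho> h]
      have "(\<Sum>l\<in>UNIV. (\<Sum>m\<in>UNIV. h $ j $ m * k $ m $ l) *\<^sub>R \<rho> (h ** k) (F $ l)) =
        (\<Sum>l\<in>UNIV. \<Sum>m\<in>UNIV. (h $ j $ m * k $ m $ l) *\<^sub>R \<rho> h (\<rho> k (F $ l)))"
        by (simp add: scaleR_sum_left rep_mult[OF \<rho> h k])
      also have "\<dots> = (\<Sum>m\<in>UNIV. \<Sum>l\<in>UNIV. (h $ j $ m * k $ m $ l) *\<^sub>R \<rho> h (\<rho> k (F $ l)))"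
        by (rule sum.swap)
      finally show ?thesis by (simp add: linear_sum[OF lin] linear_cmul[OF lin] scaleR_sum_right)
    qed
    then show ?thesis by (auto simp: fun_eq_iff tens_def vec_eq_iff matrix_mult_nth)
  qed
  fix F :: "'a ^ 'n" and h assume h: "h \<in> H"
  have "\<exists>W G. open W \<and> h \<in> W \<and> smooth_on W G \<and> (\<forall>k\<in>W \<inter> H. G k = \<rho> k (F $ l))" for l
    using \<rho> h unfolding lie_representation_def by blast
  then obtain W G where W: "\<And>l. open (W l)" "\<And>l. h \<in> W l" "\<And>l. smooth_on (W l) (G l)"
    "\<And>l k. k \<in> W l \<inter> H \<Longrightarrow> G l k = \<rho> k (F $ l)" by metis
  \<comment> \<open>Each component of F has its own local extension; there are finitely many, so
    their domains intersect in an open set.\<close>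
  define V where "V = (\<Inter>l. W l)"
  have V: "open V" "h \<in> V" unfolding V_def using W by auto
  have GV: "smooth_on V (G l)" for l by (rule smooth_on_subset[OF W(3)]) (auto simp: V_def)
  have "smooth_on V (\<lambda>k. \<chi> j. \<Sum>l\<in>UNIV. (k $ j $ l) *\<^sub>R G l k)"
  proof (rule smooth_on_componentwise[OF V(1)])
    fix b :: "'a ^ 'n" assume "b \<in> Basis"
    then obtain j c where b: "b = axis j c" unfolding Basis_vec_def by auto
    have "smooth_on V (\<lambda>k. k $ j $ l)" for l
      by (rule smooth_on_bounded_linear[OF V(1)
          bounded_linear_compose[OF bounded_linear_vec_nth[of l] bounded_linear_vec_nth[of j]] smooth_on_ident])
    then have "smooth_on V (\<lambda>k. (\<Sum>l\<in>UNIV. (k $ j $ l) *\<^sub>R G l k) \<bullet> c)"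
      by (intro smooth_on_bounded_linear[OF V(1) bounded_linear_inner_left] smooth_on_sum[OF V(1)]
          smooth_on_bilinear[OF V(1) bounded_bilinear_scaleR] GV)
    then show "smooth_on V (\<lambda>k. (\<chi> j. \<Sum>l\<in>UNIV. (k $ j $ l) *\<^sub>R G l k) \<bullet> b)"
      by (simp add: b inner_axis)
  qed
  moreover have "\<forall>k\<in>V \<inter> H. (\<chi> j. \<Sum>l\<in>UNIV. (k $ j $ l) *\<^sub>R G l k) = tens \<rho> k F"
    using W(4) by (auto simp: tens_def V_def)
  ultimately show "\<exists>W G. open W \<and> h \<in> W \<and> smooth_on W G \<and> (\<forall>k\<in>W \<inter> H. G k = tens \<rho> k F)"
    using V by blast
qed

text \<open>The Leibniz rule: on the factor T the Lie algebra acts by its own matrices, so X enters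
  there through its projection.\<close>

lemma star_tens:
  assumes \<rho>: "lie_representation H \<rho>"
  shows "star H (tens \<rho>) X F $ j = star H \<rho> X (F $ j) + (\<Sum>l\<in>UNIV. (pr_hol H X $ j $ l) *\<^sub>R (F $ l))"
proof -
  obtain c where c: "lie_curve H (pr_hol H X) c" using lie_algebra_curve[OF pr_hol_in] .
  have 1: "((\<lambda>t. tens \<rho> (c t) F $ j) has_vector_derivative inf_rep H (tens \<rho>) (pr_hol H X) F $ j) (at 0)"
    by (rule has_vector_derivative_bounded_linear[OF bounded_linear_vec_nth inf_rep_curve[OF tens_representation[OF \<rho>] c]])
  have "((\<lambda>t. \<Sum>l\<in>UNIV. (c t $ j $ l) *\<^sub>R \<rho> (c t) (F $ l)) has_vector_derivative
      (\<Sum>l\<in>UNIV. (c 0 $ j $ l) *\<^sub>R inf_rep H \<rho> (pr_hol H X) (F $ l) + (pr_hol H X $ j $ l) *\<^sub>R \<rho> (c 0) (F $ l))) (at 0)"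
  proof (rule has_vector_derivative_sum)
    show "((\<lambda>t. (c t $ j $ l) *\<^sub>R \<rho> (c t) (F $ l)) has_vector_derivative
      (c 0 $ j $ l) *\<^sub>R inf_rep H \<rho> (pr_hol H X) (F $ l) + (pr_hol H X $ j $ l) *\<^sub>R \<rho> (c 0) (F $ l)) (at 0)" for l
      by (rule bounded_bilinear.has_vector_derivative[OF bounded_bilinear_scaleR
          has_vector_derivative_bounded_linear[OF bounded_linear_vec_nth
            has_vector_derivative_bounded_linear[OF bounded_linear_vec_nth lie_curveD(4)[OF c]]]
          inf_rep_curve[OF \<rho> c]])
  qed
  then have 2: "((\<lambda>t. tens \<rho> (c t) F $ j) has_vector_derivative
      (\<Sum>l\<in>UNIV. (c 0 $ j $ l) *\<^sub>R inf_rep H \<rho> (pr_hol H X) (F $ l) + (pr_hol H X $ j $ l) *\<^sub>R \<rho> (c 0) (F $ l))) (at 0)"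
    by (simp add: tens_def)
  have "(\<Sum>l\<in>UNIV. (c 0 $ j $ l) *\<^sub>R inf_rep H \<rho> (pr_hol H X) (F $ l)) = inf_rep H \<rho> (pr_hol H X) (F $ j)"
    by (simp add: lie_curveD(3)[OF c] mat_def if_distrib if_distribR cong: if_cong)
  then show ?thesis
    using vector_derivative_unique_at[OF 1 2] unfolding star_def
    by (simp add: sum.distrib lie_curveD(3)[OF c] rep_one[OF \<rho>])
qed

end

context smooth_manifold
begin

text \<open>The product rule for \<rho>(k) f at a point with k = 1. The representation extends
  smoothly off H only for one vector at a time, so f is expanded in the basis and each basis vector
  gets its own extension.\<close>

lemma deriv_along_rep:
  fixes \<rho> :: "'k::finite mat \<Rightarrow> 'v::euclidean_space \<Rightarrow> 'v"
  assumes H: "so_subgroup H" and \<rho>: "lie_representation H \<rho>"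
    and x: "x \<in> tangent_space A p" and p: "p \<in> U"
    and f: "smooth_fun A U f" and k: "smooth_fun A U k" "\<And>q. q \<in> U \<Longrightarrow> k q \<in> H" "k p = mat 1"
    and lie: "deriv_along x k \<in> lie_algebra H" and F: "smooth_fun A U F" "\<And>q. q \<in> U \<Longrightarrow> F q = \<rho> (k q) (f q)"
  shows "deriv_along x F = deriv_along x f + star H \<rho> (deriv_along x k) (f p)"
proof -
  interpret so_subgroup H by (rule H)
  have "\<exists>W G. open W \<and> mat 1 \<in> W \<and> smooth_on W G \<and> (\<forall>k\<in>W \<inter> H. G k = \<rho> k b)" for b
    using \<rho> H_one unfolding lie_representation_def by blast
  then obtain W G where W: "\<And>b. open (W b)" "\<And>b. mat 1 \<in> W b" "\<And>b. smooth_on (W b) (G b)"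
    "\<And>b k. k \<in> W b \<Longrightarrow> k \<in> H \<Longrightarrow> G b k = \<rho> k b" by (metis IntI)
  define V where "V = (\<Inter>b\<in>Basis. W b)"
  have V: "open V" "mat 1 \<in> V" unfolding V_def using W by auto
  have GV: "smooth_on V (G b)" if "b \<in> Basis" for b
    by (rule smooth_on_subset[OF W(3)]) (use that in \<open>auto simp: V_def\<close>)
  obtain U0 \<phi> where c: "(U0, \<phi>) \<in> A" "p \<in> U0" by (rule chart_exists)
  \<comment> \<open>The points at which all extensions for basis vectors are available; openness is
    obtained from continuity of k, read in a chart.\<close>
  define U' where "U' = {q \<in> U \<inter> U0. k q \<in> V}"
  have "continuous_on (U0 \<inter> U) k"
  proof -
    have "continuous_on (\<phi> ` (U0 \<inter> U)) (\<lambda>y. k (inv_into U0 \<phi> y))"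
      by (rule smooth_on_continuous_on[OF smooth_fun_chart[OF k(1) c(1)]])
    moreover have "continuous_on (U0 \<inter> U) \<phi>"
      by (rule continuous_on_subset[OF homeomorphism_cont1[OF chart_homeomorphism[OF c(1)]]]) auto
    ultimately have "continuous_on (U0 \<inter> U) (\<lambda>q. k (inv_into U0 \<phi> (\<phi> q)))"
      by (rule continuous_on_compose2) (rule image_mono, rule subset_refl)
    then show ?thesis by (rule continuous_on_eq) (simp add: chart_inverse[OF c(1)])
  qed
  then have "open (k -` V \<inter> (U0 \<inter> U))"
    using V(1) continuous_on_open_vimage[OF open_Int[OF chart_open(1)[OF c(1)] smooth_fun_open[OF f]], of k] by simp
  moreover have "U' = k -` V \<inter> (U0 \<inter> U)" by (auto simp: U'_def)
  ultimately have U': "open U'" "p \<in> U'" "U' \<subseteq> U" "k ` U' \<subseteq> V"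
    using p c(2) k(3) V by (auto simp: U'_def)
  note fs = smooth_fun_subset[OF f U'(1,3)] and ks = smooth_fun_subset[OF k(1) U'(1,3)]
  have fb: "smooth_fun A U' (\<lambda>q. f q \<bullet> b)" for b
    by (rule smooth_fun_bounded_linear[OF bounded_linear_inner_left fs])
  have gb: "smooth_fun A U' (\<lambda>q. G b (k q))" if "b \<in> Basis" for b
    by (rule smooth_fun_compose[OF ks V(1) U'(4) GV[OF that]])
  have "deriv_along x F = deriv_along x (\<lambda>q. \<Sum>b\<in>Basis. (f q \<bullet> b) *\<^sub>R G b (k q))"
  proof (rule deriv_along_cong[OF x smooth_fun_subset[OF F(1) U'(1,3)] U'(2)])
    fix q assume q: "q \<in> U'"
    have lin: "linear (\<rho> (k q))" using rep_linear[OF \<rho> k(2)] q U'(3) by blast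
    have "F q = \<rho> (k q) (\<Sum>b\<in>Basis. (f q \<bullet> b) *\<^sub>R b)"
      using F(2) q U'(3) by (auto simp: euclidean_representation)
    also have "\<dots> = (\<Sum>b\<in>Basis. (f q \<bullet> b) *\<^sub>R \<rho> (k q) b)" by (simp add: linear_sum[OF lin] linear_cmul[OF lin])
    also have "\<dots> = (\<Sum>b\<in>Basis. (f q \<bullet> b) *\<^sub>R G b (k q))"
      using W(4) k(2) q U'(3,4) by (intro sum.cong refl) (auto simp: V_def image_subset_iff)
    finally show "F q = (\<Sum>b\<in>Basis. (f q \<bullet> b) *\<^sub>R G b (k q))" .
  qed
  also have "\<dots> = (\<Sum>b\<in>Basis. deriv_along x (\<lambda>q. (f q \<bullet> b) *\<^sub>R G b (k q)))"
    by (intro deriv_along_sum[OF x U'(1,2)] smooth_fun_bilinear[OF bounded_bilinear_scaleR] fb gb)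
  also have "\<dots> = (\<Sum>b\<in>Basis. (f p \<bullet> b) *\<^sub>R star H \<rho> (deriv_along x k) b + (deriv_along x f \<bullet> b) *\<^sub>R b)"
  proof (intro sum.cong refl)
    fix b :: 'v assume b: "b \<in> Basis"
    have "deriv_along x (\<lambda>q. G b (k q)) = star H \<rho> (deriv_along x k) b"
      using deriv_along_compose[OF x ks U'(2) V(1) U'(4) GV[OF b]]
        inf_rep_extension[where v=b, OF \<rho> lie W(1)[of b] W(2)[of b] W(3)[of b] W(4)] star_lie[OF lie, of \<rho> b] k(3) by simp
    moreover have "deriv_along x (\<lambda>q. f q \<bullet> b) = deriv_along x f \<bullet> b"
      by (rule deriv_along_bounded_linear[OF x bounded_linear_inner_left fs U'(2)])
    moreover have "G b (k p) = b" using W(4)[OF W(2) H_one, of b] k(3) rep_one[OF \<rho>] by simp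
    ultimately show "deriv_along x (\<lambda>q. (f q \<bullet> b) *\<^sub>R G b (k q)) =
        (f p \<bullet> b) *\<^sub>R star H \<rho> (deriv_along x k) b + (deriv_along x f \<bullet> b) *\<^sub>R b"
      using deriv_along_bilinear[OF x bounded_bilinear_scaleR fb gb[OF b] U'(2)] by simp
  qed
  also have "\<dots> = star H \<rho> (deriv_along x k) (f p) + deriv_along x f"
  proof -
    have lin: "linear (star H \<rho> (deriv_along x k))" using bilinear_star[OF \<rho>] unfolding bilinear_def by blast
    have "star H \<rho> (deriv_along x k) (f p) = star H \<rho> (deriv_along x k) (\<Sum>b\<in>Basis. (f p \<bullet> b) *\<^sub>R b)"
      by (simp add: euclidean_representation)
    also have "\<dots> = (\<Sum>b\<in>Basis. (f p \<bullet> b) *\<^sub>R star H \<rho> (deriv_along x k) b)"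
      by (simp add: linear_sum[OF lin] linear_cmul[OF lin])
    finally show ?thesis by (simp add: sum.distrib euclidean_representation)
  qed
  finally show ?thesis by simp
qed

end


section \<open>Orthonormal frames and change of gauge\<close>

declare transpose_matrix_vector [simp del] vector_transpose_matrix [simp del]

lemma real_vec_expansion: "(\<Sum>i\<in>UNIV. (x $ i) *\<^sub>R axis i 1) = (x :: real ^ 'n::finite)"
  using basis_expansion[of x] by (simp add: scalar_mult_eq_scaleR)

lemma matrix_apply_linear: "linear f \<Longrightarrow> matrix f *v x = f x"
  for f :: "real ^ 'n::finite \<Rightarrow> real ^ 'm::finite"
  using matrix_vector_mul(2)[of f] by (metis)

lemma matrix_mult_axis: "(M *v axis j 1) $ i = (M $ i $ j :: real)"
  by (simp add: matrix_vector_mult_def axis_def if_distrib cong: if_cong)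

locale geometry =
  fixes A :: "('m::{t2_space,second_countable_topology}, 'n::finite) atlas"
    and g :: "'m metric" and nab :: "'m conn" and H :: "'n mat set"
    and P :: "('m \<times> ('m, 'n) frame) set"
  assumes riem: "riemannian_manifold A g"
    and metric_conn: "metric_connection A g nab"
    and par_torsion: "parallel_skew_torsion A g nab"
    and holonomy: "holonomy_reduction A g nab H P"

sublocale geometry \<subseteq> smooth_manifold A
  using riem unfolding riemannian_manifold_def by unfold_locales blast

sublocale geometry \<subseteq> so_subgroup H
  using holonomy unfolding holonomy_reduction_def by unfold_locales blast

context geometry
begin

section \<open>Connection axioms and orthonormal frames\<close>

lemma metric_smooth: "smooth_vf A U X \<Longrightarrow> smooth_vf A U Y \<Longrightarrow> smooth_fun A U (\<lambda>p. g p (X p) (Y p))"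
  using riem unfolding riemannian_manifold_def by blast

lemma nab_connection: "connection A nab"
  using metric_conn unfolding metric_connection_def by (rule conjunct1)

lemmas nab_axioms = conjunct2[OF nab_connection[unfolded connection_def], rule_format]

lemma nab_smooth: "smooth_vf A U X \<Longrightarrow> smooth_vf A U Y \<Longrightarrow> smooth_vf A U (\<lambda>p. nab p (X p) Y)"
  by (rule conjunct1[OF nab_connection[unfolded connection_def], rule_format])

lemma nab_tangent:
  "smooth_vf A U Y \<Longrightarrow> p \<in> U \<Longrightarrow> x \<in> tangent_space A p \<Longrightarrow> nab p x Y \<in> tangent_space A p"
  by (drule (2) nab_axioms) (elim conjE)

lemma nab_comb:
  "smooth_vf A U Y \<Longrightarrow> p \<in> U \<Longrightarrow> x \<in> tangent_space A p \<Longrightarrow> y \<in> tangent_space A p \<Longrightarrow>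
    nab p (\<lambda>f. a * x f + b * y f) Y = (\<lambda>f. a * nab p x Y f + b * nab p y Y f)"
  by (drule (2) nab_axioms) (elim conjE, drule (1) bspec, elim allE)

lemma nab_plus:
  assumes "smooth_vf A U Y" "p \<in> U" "x \<in> tangent_space A p" "smooth_vf A U Z"
  shows "nab p x (\<lambda>q f. Y q f + Z q f) = (\<lambda>f. nab p x Y f + nab p x Z f)"
  by (rule conjunct1[OF conjunct2[OF conjunct2[OF nab_axioms[OF assms(1-3)]]], rule_format, OF assms(4)])

lemma nab_times:
  assumes "smooth_vf A U Y" "p \<in> U" "x \<in> tangent_space A p" "smooth_fun A U h"
  shows "nab p x (\<lambda>q f. h q * Y q f) = (\<lambda>f. x h * Y p f + h p * nab p x Y f)"
  by (rule conjunct1[OF conjunct2[OF conjunct2[OF conjunct2[OF nab_axioms[OF assms(1-3)]]]], rule_format, OF assms(4)])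

lemma nab_local:
  assumes "smooth_vf A U Y" "p \<in> U" "x \<in> tangent_space A p" "\<And>q. q \<in> U \<Longrightarrow> Z q = Y q"
  shows "nab p x Z = nab p x Y"
  by (rule conjunct2[OF conjunct2[OF conjunct2[OF conjunct2[OF nab_axioms[OF assms(1-3)]]]], rule_format, OF assms(4)])

definition frame_at :: "'m \<Rightarrow> ('m, 'n) frame \<Rightarrow> bool" where
  "frame_at p u \<longleftrightarrow> (p, u) \<in> orthonormal_frames A g"

lemma P_frame: "(p, u) \<in> P \<Longrightarrow> frame_at p u"
  using holonomy unfolding holonomy_reduction_def frame_at_def by blast

context
  fixes p u assumes u: "frame_at p u"
begin

lemma frame_comb: "u (a *\<^sub>R x + b *\<^sub>R y) = (\<lambda>f. a * u x f + b * u y f)"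
  and frame_inner: "g p (u x) (u y) = x \<bullet> y"
  and frame_tangent: "u x \<in> tangent_space A p"
  and frame_range: "range u = tangent_space A p"
  using u unfolding frame_at_def orthonormal_frames_def by auto

lemma frame_add: "u (x + y) = (\<lambda>f. u x f + u y f)"
  and frame_scale: "u (a *\<^sub>R x) = (\<lambda>f. a * u x f)"
  and frame_diff: "u (x - y) = (\<lambda>f. u x f - u y f)"
  using frame_comb[of 1 x 1 y] frame_comb[of a x 0 0] frame_comb[of 1 x "-1" y] by simp_all

lemma frame_inj: "inj u"
proof (rule injI)
  fix x y assume "u x = u y"
  then have "u (x - y) = u 0" using frame_diff[of x y] frame_diff[of 0 0] by simp
  then have "(x - y) \<bullet> (x - y) = 0" using frame_inner[of "x - y" "x - y"] frame_inner[of 0 0] by simp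
  then show "x = y" by simp
qed

lemma frame_inv: "inv u (u x) = x"
  by (rule inv_f_f[OF frame_inj])

lemma frame_inv_right: "X \<in> tangent_space A p \<Longrightarrow> u (inv u X) = X"
  using f_inv_into_f[of X u UNIV] frame_range by simp

lemma frame_inv_eq: "X = u x \<Longrightarrow> inv u X = x"
  using frame_inv by simp

lemma frame_inv_comb:
  "X \<in> tangent_space A p \<Longrightarrow> Y \<in> tangent_space A p \<Longrightarrow>
    inv u (\<lambda>f. a * X f + b * Y f) = a *\<^sub>R inv u X + b *\<^sub>R inv u Y"
  by (rule frame_inv_eq) (simp add: frame_comb frame_inv_right)

lemma frame_inv_component: "X \<in> tangent_space A p \<Longrightarrow> inv u X $ i = g p X (u (axis i 1))"
  using frame_inner[of "inv u X" "axis i 1"] by (simp add: frame_inv_right inner_axis)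

lemma frame_expand: "u x f = (\<Sum>i\<in>UNIV. x $ i * u (axis i 1) f)"
proof -
  have s: "u (\<Sum>i\<in>I. c i *\<^sub>R axis i 1) f = (\<Sum>i\<in>I. c i * u (axis i 1) f)" if "finite I" for I c
    using that by (induction I rule: finite_induct)
      (use frame_scale[of 0 0] in \<open>auto simp: frame_add frame_scale fun_eq_iff\<close>)
  show ?thesis using s[of UNIV "\<lambda>i. x $ i"] by (simp add: real_vec_expansion)
qed

lemma tangent_zero: "(\<lambda>f. 0) \<in> tangent_space A p"
  using frame_tangent[of 0] frame_scale[of 0 0] by simp

lemma deriv_along_frame: "deriv_along (u x) F = (\<Sum>i\<in>UNIV. (x $ i) *\<^sub>R deriv_along (u (axis i 1)) F)"
proof -
  have "deriv_along (u x) F = (\<Sum>b\<in>Basis. \<Sum>i\<in>UNIV. (x $ i * u (axis i 1) (\<lambda>q. F q \<bullet> b)) *\<^sub>R b)"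
    unfolding deriv_along_def by (simp add: frame_expand[of x] scaleR_sum_left)
  also have "\<dots> = (\<Sum>i\<in>UNIV. \<Sum>b\<in>Basis. (x $ i * u (axis i 1) (\<lambda>q. F q \<bullet> b)) *\<^sub>R b)" by (rule sum.swap)
  finally show ?thesis by (simp add: deriv_along_def scaleR_sum_right)
qed

end

section \<open>Local sections of the reduction and the connection form\<close>

lemma section_frame: "local_section A P U \<sigma> \<Longrightarrow> q \<in> U \<Longrightarrow> frame_at q (\<sigma> q)"
  unfolding local_section_def using P_frame by blast

lemma section_open: "local_section A P U \<sigma> \<Longrightarrow> open U"
  and section_P: "local_section A P U \<sigma> \<Longrightarrow> q \<in> U \<Longrightarrow> (q, \<sigma> q) \<in> P"
  and section_vf: "local_section A P U \<sigma> \<Longrightarrow> smooth_vf A U (\<lambda>p. \<sigma> p x)"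
  unfolding local_section_def by auto

lemma section_subset: "local_section A P U \<sigma> \<Longrightarrow> open W \<Longrightarrow> W \<subseteq> U \<Longrightarrow> local_section A P W \<sigma>"
  unfolding local_section_def using smooth_vf_subset by blast

lemma section_exists: obtains U \<sigma> where "p \<in> U" "local_section A P U \<sigma>"
  using holonomy unfolding holonomy_reduction_def by blast

lemma P_orbit: "(p, u) \<in> P \<Longrightarrow> (p, u') \<in> P \<longleftrightarrow> (\<exists>h\<in>H. u' = frame_act u h)"
proof -
  assume "(p, u) \<in> P"
  then have "{u'. (p, u') \<in> P} = frame_act u ` H" using holonomy unfolding holonomy_reduction_def by blast
  then show ?thesis by (metis (mono_tags, lifting) imageE imageI mem_Collect_eq)
qed

lemma components_smooth:
  assumes "local_section A P U \<sigma>" "smooth_vf A U X"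
  shows "smooth_fun A U (\<lambda>q. inv (\<sigma> q) (X q))"
proof (rule smooth_fun_vec[OF section_open[OF assms(1)]])
  fix i
  show "smooth_fun A U (\<lambda>q. inv (\<sigma> q) (X q) $ i)"
    by (rule smooth_fun_cong[OF metric_smooth[OF assms(2) section_vf[OF assms(1), of "axis i 1"]]])
      (use frame_inv_component[OF section_frame[OF assms(1)]] smooth_vf_tangent[OF assms(2)] in auto)
qed

lemma section_vf_components:
  assumes \<sigma>: "local_section A P U \<sigma>" and x: "smooth_fun A U x"
  shows "smooth_vf A U (\<lambda>q. \<sigma> q (x q))"
  unfolding smooth_vf_def
proof (intro conjI ballI allI impI)
  show "open U" by (rule section_open[OF \<sigma>])
  show "\<sigma> p (x p) \<in> tangent_space A p" if "p \<in> U" for p by (rule frame_tangent[OF section_frame[OF \<sigma> that]])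
  fix W and f :: "'m \<Rightarrow> real" assume f: "W \<subseteq> U" "smooth_fun A W f"
  note W = smooth_fun_open[OF f(2)]
  have "smooth_fun A W (\<lambda>p. \<Sum>i\<in>UNIV. x p $ i * deriv_along (\<sigma> p (axis i 1)) f)"
    by (intro smooth_fun_sum[OF W] smooth_fun_bilinear[OF bounded_bilinear_mult]
        smooth_fun_bounded_linear[OF bounded_linear_vec_nth] smooth_fun_subset[OF x W f(1)]
        smooth_vf_deriv[OF section_vf[OF \<sigma>] f(2,1)])
  then show "smooth_fun A W (\<lambda>p. \<sigma> p (x p) f)"
    by (rule smooth_fun_cong)
      (use f(1) in \<open>auto simp: deriv_along_real frame_expand[OF section_frame[OF \<sigma>], symmetric]\<close>)
qed

lemma nab_components_add:
  assumes \<sigma>: "local_section A P U \<sigma>" and p: "p \<in> U" and x: "x \<in> tangent_space A p"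
    and z: "smooth_fun A U z" and w: "smooth_fun A U w"
  shows "inv (\<sigma> p) (nab p x (\<lambda>q. \<sigma> q (z q + w q))) =
    inv (\<sigma> p) (nab p x (\<lambda>q. \<sigma> q (z q))) + inv (\<sigma> p) (nab p x (\<lambda>q. \<sigma> q (w q)))"
proof -
  note vz = section_vf_components[OF \<sigma> z] and vw = section_vf_components[OF \<sigma> w]
  have "nab p x (\<lambda>q. \<sigma> q (z q + w q)) = nab p x (\<lambda>q f. \<sigma> q (z q) f + \<sigma> q (w q) f)"
    by (rule nab_local[OF section_vf_components[OF \<sigma> smooth_fun_add[OF z w]] p x, symmetric])
      (simp add: frame_add[OF section_frame[OF \<sigma>]])
  also have "\<dots> = (\<lambda>f. 1 * nab p x (\<lambda>q. \<sigma> q (z q)) f + 1 * nab p x (\<lambda>q. \<sigma> q (w q)) f)"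
    using nab_plus[OF vz p x vw] by simp
  finally show ?thesis
    using frame_inv_comb[OF section_frame[OF \<sigma> p] nab_tangent[OF vz p x] nab_tangent[OF vw p x], of 1 1] by simp
qed

lemma nab_components_scale:
  assumes \<sigma>: "local_section A P U \<sigma>" and p: "p \<in> U" and x: "x \<in> tangent_space A p"
    and z: "smooth_fun A U z" and h: "smooth_fun A U h"
  shows "inv (\<sigma> p) (nab p x (\<lambda>q. \<sigma> q (h q *\<^sub>R z q))) =
    deriv_along x h *\<^sub>R z p + h p *\<^sub>R inv (\<sigma> p) (nab p x (\<lambda>q. \<sigma> q (z q)))"
proof -
  note vz = section_vf_components[OF \<sigma> z]
  have "nab p x (\<lambda>q. \<sigma> q (h q *\<^sub>R z q)) = nab p x (\<lambda>q f. h q * \<sigma> q (z q) f)"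
    by (rule nab_local[OF section_vf_components[OF \<sigma> smooth_fun_bilinear[OF bounded_bilinear_scaleR h z]] p x, symmetric])
      (simp add: frame_scale[OF section_frame[OF \<sigma>]])
  also have "\<dots> = (\<lambda>f. x h * \<sigma> p (z p) f + h p * nab p x (\<lambda>q. \<sigma> q (z q)) f)"
    by (rule nab_times[OF vz p x h])
  finally show ?thesis
    using frame_inv_comb[OF section_frame[OF \<sigma> p] frame_tangent[OF section_frame[OF \<sigma> p]] nab_tangent[OF vz p x]]
    by (simp add: deriv_along_real frame_inv[OF section_frame[OF \<sigma> p]])
qed

lemma connection_form_apply:
  assumes \<sigma>: "local_section A P U \<sigma>" and p: "p \<in> U" and x: "x \<in> tangent_space A p"
  shows "connection_form nab \<sigma> p x *v b = inv (\<sigma> p) (nab p x (\<lambda>q. \<sigma> q b))"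
  unfolding connection_form_def
proof (rule matrix_apply_linear, rule linearI)
  note c = smooth_fun_const[OF section_open[OF \<sigma>]]
  show "inv (\<sigma> p) (nab p x (\<lambda>q. \<sigma> q (b + b'))) =
      inv (\<sigma> p) (nab p x (\<lambda>q. \<sigma> q b)) + inv (\<sigma> p) (nab p x (\<lambda>q. \<sigma> q b'))" for b b'
    by (rule nab_components_add[OF \<sigma> p x c c])
  show "inv (\<sigma> p) (nab p x (\<lambda>q. \<sigma> q (r *\<^sub>R b))) = r *\<^sub>R inv (\<sigma> p) (nab p x (\<lambda>q. \<sigma> q b))" for r b
    using nab_components_scale[OF \<sigma> p x c c, of r b] deriv_along_const[OF x, of r] by simp
qed

text \<open>Expanding z in the standard basis reduces the claim to the Leibniz axiom for one
  function times one frame field.\<close>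

lemma nab_components:
  assumes \<sigma>: "local_section A P U \<sigma>" and p: "p \<in> U" and x: "x \<in> tangent_space A p"
    and z: "smooth_fun A U z"
  shows "nab p x (\<lambda>q. \<sigma> q (z q)) = \<sigma> p (deriv_along x z + connection_form nab \<sigma> p x *v z p)"
proof -
  note U = section_open[OF \<sigma>]
  let ?a = "\<lambda>z. inv (\<sigma> p) (nab p x (\<lambda>q. \<sigma> q (z q)))"
  have zi: "smooth_fun A U (\<lambda>q. z q $ i)" for i
    by (rule smooth_fun_bounded_linear[OF bounded_linear_vec_nth z])
  have ze: "smooth_fun A U (\<lambda>q. (z q $ i) *\<^sub>R axis i 1)" for i
    by (rule smooth_fun_bilinear[OF bounded_bilinear_scaleR zi smooth_fun_const[OF U]])
  have zero: "?a (\<lambda>q. 0) = 0"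
    using nab_components_add[OF \<sigma> p x smooth_fun_const[OF U] smooth_fun_const[OF U], of 0 0] by simp
  have sum: "?a (\<lambda>q. \<Sum>i\<in>I. (z q $ i) *\<^sub>R axis i 1) = (\<Sum>i\<in>I. ?a (\<lambda>q. (z q $ i) *\<^sub>R axis i 1))" if "finite I" for I
    using that
  proof (induction I rule: finite_induct)
    case empty then show ?case using zero by simp
  next
    case (insert i I)
    have "smooth_fun A U (\<lambda>q. \<Sum>i\<in>I. (z q $ i) *\<^sub>R axis i 1)" by (rule smooth_fun_sum[OF U ze])
    from nab_components_add[OF \<sigma> p x ze[of i] this] show ?case using insert by simp
  qed
  have "?a z = (\<Sum>i\<in>UNIV. deriv_along x (\<lambda>q. z q $ i) *\<^sub>R axis i 1 + (z p $ i) *\<^sub>R (connection_form nab \<sigma> p x *v axis i 1))"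
    using sum[of UNIV] nab_components_scale[OF \<sigma> p x smooth_fun_const[OF U] zi]
    by (simp add: real_vec_expansion connection_form_apply[OF \<sigma> p x])
  also have "\<dots> = (\<Sum>i\<in>UNIV. (deriv_along x z $ i) *\<^sub>R axis i 1) + connection_form nab \<sigma> p x *v (\<Sum>i\<in>UNIV. (z p $ i) *\<^sub>R axis i 1)"
    by (simp add: sum.distrib deriv_along_bounded_linear[OF x bounded_linear_vec_nth z p]
        linear_sum[OF matrix_vector_mul_linear] matrix_vector_mult_scaleR)
  finally have "?a z = deriv_along x z + connection_form nab \<sigma> p x *v z p" by (simp add: real_vec_expansion)
  moreover have "nab p x (\<lambda>q. \<sigma> q (z q)) = \<sigma> p (?a z)"
    by (rule frame_inv_right[OF section_frame[OF \<sigma> p], symmetric])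
      (rule nab_tangent[OF section_vf_components[OF \<sigma> z] p x])
  ultimately show ?thesis by simp
qed

lemma connection_form_lie:
  "local_section A P U \<sigma> \<Longrightarrow> p \<in> U \<Longrightarrow> x \<in> tangent_space A p \<Longrightarrow> connection_form nab \<sigma> p x \<in> lie_algebra H"
  using holonomy unfolding holonomy_reduction_def by blast

lemma connection_form_comb:
  assumes \<sigma>: "local_section A P U \<sigma>" and p: "p \<in> U"
  shows "connection_form nab \<sigma> p (\<sigma> p x) = (\<Sum>i\<in>UNIV. (x $ i) *\<^sub>R connection_form nab \<sigma> p (\<sigma> p (axis i 1)))"
proof -
  note u = section_frame[OF \<sigma> p]
  have "linear (\<lambda>x. connection_form nab \<sigma> p (\<sigma> p x))"
  proof -
    have 2: "connection_form nab \<sigma> p (\<sigma> p (a *\<^sub>R x + b *\<^sub>R y)) *v z =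
       (a *\<^sub>R connection_form nab \<sigma> p (\<sigma> p x) + b *\<^sub>R connection_form nab \<sigma> p (\<sigma> p y)) *v z" for a b x y z
      using nab_comb[OF section_vf[OF \<sigma>] p frame_tangent[OF u] frame_tangent[OF u], of a x b y z]
        frame_inv_comb[OF u nab_tangent[OF section_vf[OF \<sigma>] p frame_tangent[OF u]]
          nab_tangent[OF section_vf[OF \<sigma>] p frame_tangent[OF u]], of a x z b y z]
      by (simp add: connection_form_apply[OF \<sigma> p frame_tangent[OF u]] frame_comb[OF u, symmetric]
          matrix_vector_mult_add_rdistrib scaleR_matrix_vector_assoc[symmetric])
    then have 3: "connection_form nab \<sigma> p (\<sigma> p (a *\<^sub>R x + b *\<^sub>R y)) =
       a *\<^sub>R connection_form nab \<sigma> p (\<sigma> p x) + b *\<^sub>R connection_form nab \<sigma> p (\<sigma> p y)" for a b x y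
      unfolding matrix_eq by blast
    show ?thesis
      using 3[of 1 _ 1] 3[of _ _ 0 0] by (intro linearI) simp_all
  qed
  note lin = this
  have "connection_form nab \<sigma> p (\<sigma> p x) = connection_form nab \<sigma> p (\<sigma> p (\<Sum>i\<in>UNIV. (x $ i) *\<^sub>R axis i 1))"
    by (simp add: real_vec_expansion)
  then show ?thesis by (simp only: linear_sum[OF lin] linear_cmul[OF lin])
qed

text \<open>The formula of \<open>cov_deriv\<close> with the gauge as a parameter. In
  \<open>cov_deriv\<close> the gauge is chosen anew at every (p, u), so its dependence on the point
  cannot be differentiated until gauge independence is known.\<close>

definition cov :: "('m \<Rightarrow> ('m, 'n) frame) \<Rightarrow> ('n mat \<Rightarrow> 'v::euclidean_space \<Rightarrow> 'v) \<Rightarrow> 'm tvec \<Rightarrow>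
    ('m, 'n, 'v) sec \<Rightarrow> 'm \<Rightarrow> 'v" where
  "cov \<sigma> \<rho> x s p = deriv_along x (\<lambda>q. s (q, \<sigma> q)) + star H \<rho> (connection_form nab \<sigma> p x) (s (p, \<sigma> p))"

section \<open>Equivariant functions under a change of gauge\<close>

lemma sections_smooth: "s \<in> sections A H P \<rho> \<Longrightarrow> local_section A P U \<sigma> \<Longrightarrow> smooth_fun A U (\<lambda>q. s (q, \<sigma> q))"
  unfolding sections_def by blast

lemma sections_equivariant:
  "s \<in> sections A H P \<rho> \<Longrightarrow> (p, u) \<in> P \<Longrightarrow> h \<in> H \<Longrightarrow> s (p, frame_act u h) = \<rho> (transpose h) (s (p, u))"
  unfolding sections_def using H_inv[of h] by fastforce

text \<open>The columns of h are the components of the frame \<tau> in the frame \<sigma>, hence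
  smooth.\<close>

lemma gauge_change:
  assumes \<sigma>: "local_section A P U \<sigma>" and \<tau>: "local_section A P U \<tau>"
  obtains h where "smooth_fun A U h" "\<And>q. q \<in> U \<Longrightarrow> h q \<in> H" "\<And>q. q \<in> U \<Longrightarrow> \<tau> q = frame_act (\<sigma> q) (h q)"
proof -
  have "\<exists>k. q \<in> U \<longrightarrow> k \<in> H \<and> \<tau> q = frame_act (\<sigma> q) k" for q
    using P_orbit[OF section_P[OF \<sigma>]] section_P[OF \<tau>] by blast
  then obtain h where h: "\<And>q. q \<in> U \<Longrightarrow> h q \<in> H" "\<And>q. q \<in> U \<Longrightarrow> \<tau> q = frame_act (\<sigma> q) (h q)" by metis
  have c: "smooth_fun A U (\<lambda>q. inv (\<sigma> q) (\<tau> q (axis j 1)))" for j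
    by (rule components_smooth[OF \<sigma> section_vf[OF \<tau>]])
  have e: "inv (\<sigma> q) (\<tau> q (axis j 1)) $ i = h q $ i $ j" if "q \<in> U" for q i j
    using frame_inv[OF section_frame[OF \<sigma> that]] h(2)[OF that] by (simp add: frame_act_def matrix_mult_axis)
  have "smooth_fun A U (\<lambda>q. h q $ i $ j)" for i j
    by (rule smooth_fun_cong[OF smooth_fun_bounded_linear[OF bounded_linear_vec_nth[of i] c[of j]]]) (use e in auto)
  then have "smooth_fun A U h" by (intro smooth_fun_vec[OF section_open[OF \<sigma>]])
  then show thesis using that h by blast
qed

text \<open>The transformation law h^{-1} dh + h^{-1} \<omega> h, with the transpose as
  inverse.\<close>

lemma connection_form_gauge:
  assumes \<sigma>: "local_section A P U \<sigma>" and \<tau>: "local_section A P U \<tau>" and p: "p \<in> U" and x: "x \<in> tangent_space A p"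
    and h: "smooth_fun A U h" "\<And>q. q \<in> U \<Longrightarrow> h q \<in> H" "\<And>q. q \<in> U \<Longrightarrow> \<tau> q = frame_act (\<sigma> q) (h q)"
  shows "connection_form nab \<tau> p x = transpose (h p) ** (deriv_along x h + connection_form nab \<sigma> p x ** h p)"
proof -
  have "connection_form nab \<tau> p x *v b =
      (transpose (h p) ** (deriv_along x h + connection_form nab \<sigma> p x ** h p)) *v b" for b
  proof -
    have bl: "bounded_linear (\<lambda>M :: 'n mat. M *v b)"
      by (rule bounded_bilinear.bounded_linear_left[OF bounded_bilinear_matrix_vector])
    have hb: "smooth_fun A U (\<lambda>q. h q *v b)" by (rule smooth_fun_bounded_linear[OF bl h(1)])
    have "nab p x (\<lambda>q. \<tau> q b) = nab p x (\<lambda>q. \<sigma> q (h q *v b))"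
      by (rule nab_local[OF section_vf_components[OF \<sigma> hb] p x]) (simp add: h(3) frame_act_def)
    also have "\<dots> = \<sigma> p (deriv_along x h *v b + connection_form nab \<sigma> p x *v (h p *v b))"
      using nab_components[OF \<sigma> p x hb] deriv_along_bounded_linear[OF x bl h(1) p] by simp
    also have "\<dots> = \<tau> p (transpose (h p) *v (deriv_along x h *v b + connection_form nab \<sigma> p x *v (h p *v b)))"
      using H_transpose_mult[OF h(2)[OF p]] by (simp add: h(3)[OF p] frame_act_def matrix_vector_mul_assoc)
    finally have "connection_form nab \<tau> p x *v b =
        transpose (h p) *v (deriv_along x h *v b + connection_form nab \<sigma> p x *v (h p *v b))"
      unfolding connection_form_apply[OF \<tau> p x] by (rule frame_inv_eq[OF section_frame[OF \<tau> p]])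
    then show ?thesis
      by (simp add: matrix_vector_mul_assoc matrix_vector_mult_add_rdistrib matrix_vector_right_distrib
          matrix_add_ldistrib matrix_mul_assoc)
  qed
  then show ?thesis unfolding matrix_eq by blast
qed

lemma section_right_translate:
  assumes \<sigma>: "local_section A P U \<sigma>" and k: "k \<in> H"
  shows "local_section A P U (\<lambda>q. frame_act (\<sigma> q) k)"
  unfolding local_section_def
proof (intro conjI ballI allI)
  show "(q, frame_act (\<sigma> q) k) \<in> P" if "q \<in> U" for q
    using P_orbit[OF section_P[OF \<sigma> that]] k by blast
  show "smooth_vf A U (\<lambda>q. frame_act (\<sigma> q) k x)" for x
    unfolding frame_act_def by (rule section_vf[OF \<sigma>])
qed (rule section_open[OF \<sigma>])

text \<open>Where h = 1, the transformation law says that dh is the difference of the two connection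
  forms. Both lie in the holonomy algebra by definition of the reduction, so dh does too, without
  producing a curve in H with that velocity.\<close>

lemma deriv_lie_of_connection_forms:
  assumes \<sigma>: "local_section A P U \<sigma>" and \<tau>: "local_section A P U \<tau>" and p: "p \<in> U" and x: "x \<in> tangent_space A p"
    and h: "smooth_fun A U h" "\<And>q. q \<in> U \<Longrightarrow> h q \<in> H" "\<And>q. q \<in> U \<Longrightarrow> \<tau> q = frame_act (\<sigma> q) (h q)"
    and one: "h p = mat 1"
  shows "deriv_along x h = connection_form nab \<tau> p x - connection_form nab \<sigma> p x" "deriv_along x h \<in> lie_algebra H"
proof -
  show 1: "deriv_along x h = connection_form nab \<tau> p x - connection_form nab \<sigma> p x"
    using connection_form_gauge[OF \<sigma> \<tau> p x h] one by simp
  show "deriv_along x h \<in> lie_algebra H"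
    unfolding 1 by (intro subspace_diff[OF subspace_lie_algebra] connection_form_lie[OF \<sigma> p x] connection_form_lie[OF \<tau> p x])
qed

lemma cov_right_translate:
  assumes \<rho>: "lie_representation H \<rho>" and s: "s \<in> sections A H P \<rho>" and \<sigma>: "local_section A P U \<sigma>"
    and p: "p \<in> U" and x: "x \<in> tangent_space A p" and k: "k \<in> H"
  shows "cov (\<lambda>q. frame_act (\<sigma> q) k) \<rho> x s p = \<rho> (transpose k) (cov \<sigma> \<rho> x s p)"
proof -
  let ?\<tau> = "\<lambda>q. frame_act (\<sigma> q) k"
  note \<tau> = section_right_translate[OF \<sigma> k]
  note lin = rep_linear[OF \<rho> H_transpose[OF k]]
  have e: "s (q, ?\<tau> q) = \<rho> (transpose k) (s (q, \<sigma> q))" if "q \<in> U" for q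
    by (rule sections_equivariant[OF s section_P[OF \<sigma> that] k])
  have "deriv_along x (\<lambda>q. s (q, ?\<tau> q)) = deriv_along x (\<lambda>q. \<rho> (transpose k) (s (q, \<sigma> q)))"
    by (rule deriv_along_cong[OF x sections_smooth[OF s \<tau>] p]) (rule e)
  also have "\<dots> = \<rho> (transpose k) (deriv_along x (\<lambda>q. s (q, \<sigma> q)))"
    by (rule deriv_along_linear[OF x lin sections_smooth[OF s \<sigma>] p])
  finally have d: "deriv_along x (\<lambda>q. s (q, ?\<tau> q)) = \<rho> (transpose k) (deriv_along x (\<lambda>q. s (q, \<sigma> q)))" .
  have "connection_form nab ?\<tau> p x = transpose k ** connection_form nab \<sigma> p x ** transpose (transpose k)"
    using connection_form_gauge[OF \<sigma> \<tau> p x smooth_fun_const[OF section_open[OF \<sigma>]] k refl]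
      deriv_along_const[OF x, of k] by (simp add: matrix_mul_assoc)
  then show ?thesis
    unfolding cov_def d e[OF p] by (simp only: star_conj[OF \<rho> H_transpose[OF k]] linear_add[OF lin])
qed

text \<open>With \<tau> = \<sigma> h and h = 1 at p, the derivative of s along \<tau> changes by -
  dh \<star> s while the connection form changes by dh; the two cancel.\<close>

lemma cov_same_frame:
  assumes \<rho>: "lie_representation H \<rho>" and s: "s \<in> sections A H P \<rho>"
    and \<sigma>: "local_section A P U \<sigma>" and \<tau>: "local_section A P U \<tau>"
    and p: "p \<in> U" and x: "x \<in> tangent_space A p" and e: "\<tau> p = \<sigma> p"
  shows "cov \<tau> \<rho> x s p = cov \<sigma> \<rho> x s p"
proof -
  obtain h where h: "smooth_fun A U h" "\<And>q. q \<in> U \<Longrightarrow> h q \<in> H" "\<And>q. q \<in> U \<Longrightarrow> \<tau> q = frame_act (\<sigma> q) (h q)"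
    using gauge_change[OF \<sigma> \<tau>] by blast
  have "h p *v b = b" for b
  proof -
    have "\<sigma> p (h p *v b) = \<sigma> p b" using h(3)[OF p] e by (simp add: frame_act_def fun_eq_iff)
    then show ?thesis using frame_inj[OF section_frame[OF \<sigma> p]] by (simp add: inj_eq)
  qed
  then have one: "h p = mat 1" unfolding matrix_eq by simp
  note dh = deriv_lie_of_connection_forms[OF \<sigma> \<tau> p x h one]
  have d: "deriv_along x (\<lambda>q. transpose (h q)) = - deriv_along x h"
    using deriv_along_linear[OF x linear_transpose h(1) p] lie_algebra_skew[OF dh(2)] by simp
  have "deriv_along x (\<lambda>q. s (q, \<tau> q)) = deriv_along x (\<lambda>q. s (q, \<sigma> q)) +
      star H \<rho> (deriv_along x (\<lambda>q. transpose (h q))) (s (p, \<sigma> p))"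
  proof (rule deriv_along_rep[OF so_subgroup_axioms \<rho> x p sections_smooth[OF s \<sigma>]
        smooth_fun_linear[OF linear_transpose h(1)]])
    show "deriv_along x (\<lambda>q. transpose (h q)) \<in> lie_algebra H"
      unfolding d by (rule subspace_neg[OF subspace_lie_algebra dh(2)])
    show "s (q, \<tau> q) = \<rho> (transpose (h q)) (s (q, \<sigma> q))" if "q \<in> U" for q
      using sections_equivariant[OF s section_P[OF \<sigma> that] h(2)[OF that]] h(3)[OF that] by simp
  qed (use H_transpose h(2) one sections_smooth[OF s \<tau>] in auto)
  moreover have "connection_form nab \<tau> p x = connection_form nab \<sigma> p x + deriv_along x h" using dh(1) by simp
  ultimately show ?thesis
    unfolding cov_def d e
    by (simp add: bounded_bilinear.add_left[OF bounded_bilinear_star[OF \<rho>]]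
        bounded_bilinear.minus_left[OF bounded_bilinear_star[OF \<rho>]])
qed

text \<open>Any local section near p passes through u after translation by a constant group element,
  so the choice in \<open>gauge_at\<close> is justified.\<close>

lemma gauge_at_section:
  assumes "(p, u) \<in> P"
  obtains U where "p \<in> U" "local_section A P U (gauge_at A P p u)" "gauge_at A P p u p = u"
proof -
  obtain U \<sigma> where \<sigma>: "p \<in> U" "local_section A P U \<sigma>" by (rule section_exists)
  obtain k where k: "k \<in> H" "u = frame_act (\<sigma> p) k" using P_orbit[OF section_P[OF \<sigma>(2,1)]] assms by blast
  have "\<exists>\<sigma> U. p \<in> U \<and> local_section A P U \<sigma> \<and> \<sigma> p = u"
    using section_right_translate[OF \<sigma>(2) k(1)] \<sigma>(1) k(2) by blast
  then have "\<exists>U. p \<in> U \<and> local_section A P U (gauge_at A P p u) \<and> gauge_at A P p u p = u"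
    unfolding gauge_at_def by (rule someI_ex)
  then show thesis using that by blast
qed

lemma cov_deriv_eq_cov:
  assumes \<rho>: "lie_representation H \<rho>" and s: "s \<in> sections A H P \<rho>" and \<sigma>: "local_section A P U \<sigma>"
    and p: "p \<in> U" and x: "X p \<in> tangent_space A p"
  shows "cov_deriv A nab H P \<rho> X s (p, \<sigma> p) = cov \<sigma> \<rho> (X p) s p"
proof -
  obtain W where W: "p \<in> W" "local_section A P W (gauge_at A P p (\<sigma> p))" "gauge_at A P p (\<sigma> p) p = \<sigma> p"
    using gauge_at_section[OF section_P[OF \<sigma> p]] by blast
  have o: "open (U \<inter> W)" using section_open[OF \<sigma>] section_open[OF W(2)] by blast
  have "cov (gauge_at A P p (\<sigma> p)) \<rho> (X p) s p = cov \<sigma> \<rho> (X p) s p"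
    by (rule cov_same_frame[OF \<rho> s section_subset[OF \<sigma> o] section_subset[OF W(2) o] _ x W(3)]) (use p W in auto)
  moreover have "cov_deriv A nab H P \<rho> X s (p, \<sigma> p) = cov (gauge_at A P p (\<sigma> p)) \<rho> (X p) s p"
    unfolding cov_deriv_def cov_def Let_def
    using star_lie[OF connection_form_lie[OF W(2,1) x], of \<rho> "s (p, \<sigma> p)"] W(3) by simp
  ultimately show ?thesis by simp
qed

section \<open>The covariant differential as a section of the bundle of T \<otimes> V\<close>

lemma cov_frame:
  assumes \<rho>: "lie_representation H \<rho>" and \<sigma>: "local_section A P U \<sigma>" and p: "p \<in> U"
  shows "cov \<sigma> \<rho> (\<sigma> p x) s p = (\<Sum>i\<in>UNIV. (x $ i) *\<^sub>R cov \<sigma> \<rho> (\<sigma> p (axis i 1)) s p)"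
proof -
  have lin: "linear (\<lambda>X. star H \<rho> X v)" for v using bilinear_star[OF \<rho>] unfolding bilinear_def by blast
  show ?thesis
    unfolding cov_def connection_form_comb[OF \<sigma> p, of x] deriv_along_frame[OF section_frame[OF \<sigma> p], of x]
    by (simp add: linear_sum[OF lin] linear_cmul[OF lin] scaleR_add_right sum.distrib)
qed

text \<open>Since \<open>cov_deriv\<close> at (p, u) uses its vector field only at p, the constant
  assignment of u e_i may serve as the field.\<close>

definition nabla :: "('n mat \<Rightarrow> 'v::euclidean_space \<Rightarrow> 'v) \<Rightarrow> ('m, 'n, 'v) sec \<Rightarrow> ('m, 'n, 'v ^ 'n) sec" where
  "nabla \<rho> s = (\<lambda>(p, u). \<chi> i. cov_deriv A nab H P \<rho> (\<lambda>_. u (axis i 1)) s (p, u))"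

lemma nabla_gauge:
  assumes \<rho>: "lie_representation H \<rho>" and s: "s \<in> sections A H P \<rho>" and \<sigma>: "local_section A P U \<sigma>" and p: "p \<in> U"
  shows "nabla \<rho> s (p, \<sigma> p) $ i = cov \<sigma> \<rho> (\<sigma> p (axis i 1)) s p"
  unfolding nabla_def
  using cov_deriv_eq_cov[OF \<rho> s \<sigma> p, of "\<lambda>_. \<sigma> p (axis i 1)"] frame_tangent[OF section_frame[OF \<sigma> p]] by simp

lemma connection_form_smooth:
  assumes \<sigma>: "local_section A P U \<sigma>"
  shows "smooth_fun A U (\<lambda>q. connection_form nab \<sigma> q (\<sigma> q a))"
proof -
  note U = section_open[OF \<sigma>]
  have "smooth_fun A U (\<lambda>q. connection_form nab \<sigma> q (\<sigma> q a) $ i $ j)" for i j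
  proof (rule smooth_fun_cong)
    show "smooth_fun A U (\<lambda>q. inv (\<sigma> q) (nab q (\<sigma> q a) (\<lambda>r. \<sigma> r (axis j 1))) $ i)"
      by (rule smooth_fun_bounded_linear[OF bounded_linear_vec_nth components_smooth[OF \<sigma>
            nab_smooth[OF section_vf[OF \<sigma>] section_vf[OF \<sigma>]]]])
    show "inv (\<sigma> q) (nab q (\<sigma> q a) (\<lambda>r. \<sigma> r (axis j 1))) $ i = connection_form nab \<sigma> q (\<sigma> q a) $ i $ j"
      if "q \<in> U" for q
      using connection_form_apply[OF \<sigma> that frame_tangent[OF section_frame[OF \<sigma> that]], symmetric]
      by (simp add: matrix_mult_axis)
  qed
  then show ?thesis by (intro smooth_fun_vec[OF U])
qed

lemma cov_smooth:
  assumes \<rho>: "lie_representation H \<rho>" and s: "s \<in> sections A H P \<rho>" and \<sigma>: "local_section A P U \<sigma>"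
  shows "smooth_fun A U (\<lambda>p. cov \<sigma> \<rho> (\<sigma> p a) s p)"
  unfolding cov_def
  by (intro smooth_fun_add smooth_vf_deriv[OF section_vf[OF \<sigma>] sections_smooth[OF s \<sigma>] subset_refl]
      smooth_fun_bilinear[OF bounded_bilinear_star[OF \<rho>] connection_form_smooth[OF \<sigma>] sections_smooth[OF s \<sigma>]])

lemma P_section:
  assumes "(p, u) \<in> P"
  obtains U \<sigma> where "p \<in> U" "local_section A P U \<sigma>" "\<sigma> p = u"
  using gauge_at_section[OF assms] by blast

lemma sectionsI:
  assumes "\<And>p U \<sigma> h. local_section A P U \<sigma> \<Longrightarrow> p \<in> U \<Longrightarrow> h \<in> H \<Longrightarrow>
      s (p, frame_act (\<sigma> p) h) = \<rho> (transpose h) (s (p, \<sigma> p))"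
    and "\<And>U \<sigma>. local_section A P U \<sigma> \<Longrightarrow> smooth_fun A U (\<lambda>q. s (q, \<sigma> q))"
  shows "s \<in> sections A H P \<rho>"
  unfolding sections_def
proof (intro CollectI conjI ballI allI impI)
  fix pu assume "pu \<in> P"
  then obtain p u where pu: "pu = (p, u)" "(p, u) \<in> P" by (cases pu) auto
  obtain U \<sigma> where "p \<in> U" "local_section A P U \<sigma>" "\<sigma> p = u" using P_section[OF pu(2)] .
  then show "case pu of (p, u) \<Rightarrow> \<forall>h\<in>H. s (p, frame_act u h) = \<rho> (matrix_inv h) (s (p, u))"
    using assms(1) pu H_inv by auto
qed (rule assms(2))

text \<open>This permits iterating \<open>nabla\<close>: right translation rotates the index of the
  derivative and acts on its value, which together is \<open>tens \<rho>\<close>.\<close>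

lemma nabla_sections:
  assumes \<rho>: "lie_representation H \<rho>" and s: "s \<in> sections A H P \<rho>"
  shows "nabla \<rho> s \<in> sections A H P (tens \<rho>)"
proof (rule sectionsI)
  fix U \<sigma> assume \<sigma>: "local_section A P U \<sigma>"
  show "smooth_fun A U (\<lambda>q. nabla \<rho> s (q, \<sigma> q))"
  proof (rule smooth_fun_vec[OF section_open[OF \<sigma>]])
    show "smooth_fun A U (\<lambda>q. nabla \<rho> s (q, \<sigma> q) $ i)" for i
      by (rule smooth_fun_cong[OF cov_smooth[OF \<rho> s \<sigma>]]) (rule nabla_gauge[OF \<rho> s \<sigma>, symmetric])
  qed
  fix p h assume p: "p \<in> U" and h: "h \<in> H"
  let ?\<tau> = "\<lambda>q. frame_act (\<sigma> q) h"
  note \<tau> = section_right_translate[OF \<sigma> h] and ht = H_transpose[OF h]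
  note lin = rep_linear[OF \<rho> ht]
  have "nabla \<rho> s (p, ?\<tau> p) $ i = tens \<rho> (transpose h) (nabla \<rho> s (p, \<sigma> p)) $ i" for i
  proof -
    have "nabla \<rho> s (p, ?\<tau> p) $ i = cov ?\<tau> \<rho> (?\<tau> p (axis i 1)) s p" by (rule nabla_gauge[OF \<rho> s \<tau> p])
    also have "\<dots> = \<rho> (transpose h) (cov \<sigma> \<rho> (\<sigma> p (h *v axis i 1)) s p)"
      using cov_right_translate[OF \<rho> s \<sigma> p frame_tangent[OF section_frame[OF \<sigma> p]] h] by (simp add: frame_act_def)
    also have "\<dots> = (\<Sum>l\<in>UNIV. (h $ l $ i) *\<^sub>R \<rho> (transpose h) (nabla \<rho> s (p, \<sigma> p) $ l))"
      unfolding cov_frame[OF \<rho> \<sigma> p, of "h *v axis i 1"]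
      by (simp add: matrix_mult_axis linear_sum[OF lin] linear_cmul[OF lin] nabla_gauge[OF \<rho> s \<sigma> p])
    finally show ?thesis by (simp add: tens_def transpose_nth)
  qed
  then show "nabla \<rho> s (p, ?\<tau> p) = tens \<rho> (transpose h) (nabla \<rho> s (p, \<sigma> p))" by (simp add: vec_eq_iff)
qed

end


section \<open>Curvature and torsion in a gauge\<close>

lemma sum_axis_scaleR:
  fixes F :: "'n::finite \<Rightarrow> 'b::real_vector"
  shows "(\<Sum>i\<in>UNIV. (axis a (1::real) $ i) *\<^sub>R F i) = F a"
  by (simp add: axis_def if_distrib if_distribR cong: if_cong)

lemma sum_axis_double:
  fixes F :: "'n::finite \<Rightarrow> 'k::finite \<Rightarrow> 'b::real_vector"
  shows "(\<Sum>i\<in>UNIV. \<Sum>j\<in>UNIV. (axis a (1::real) $ i * y j) *\<^sub>R F i j) = (\<Sum>j\<in>UNIV. y j *\<^sub>R F a j)"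
proof -
  have "(\<Sum>i\<in>UNIV. \<Sum>j\<in>UNIV. (axis a (1::real) $ i * y j) *\<^sub>R F i j) =
    (\<Sum>i\<in>UNIV. (axis a (1::real) $ i) *\<^sub>R (\<Sum>j\<in>UNIV. y j *\<^sub>R F i j))"
    by (simp add: scaleR_sum_right)
  then show ?thesis by (simp only: sum_axis_scaleR)
qed

lemma sum_axis_double_right:
  fixes F :: "'k::finite \<Rightarrow> 'n::finite \<Rightarrow> 'b::real_vector"
  shows "(\<Sum>i\<in>UNIV. \<Sum>j\<in>UNIV. (x i * axis b (1::real) $ j) *\<^sub>R F i j) = (\<Sum>i\<in>UNIV. x i *\<^sub>R F i b)"
proof -
  have "(\<Sum>j\<in>UNIV. (x i * axis b (1::real) $ j) *\<^sub>R F i j) = x i *\<^sub>R F i b" for i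
  proof -
    have "(\<Sum>j\<in>UNIV. (x i * axis b (1::real) $ j) *\<^sub>R F i j) = x i *\<^sub>R (\<Sum>j\<in>UNIV. (axis b (1::real) $ j) *\<^sub>R F i j)"
      by (simp add: scaleR_sum_right)
    then show ?thesis by (simp only: sum_axis_scaleR)
  qed
  then show ?thesis by simp
qed

context smooth_manifold
begin

lemma lie_bracket_cong:
  assumes X: "smooth_vf A U X" and Y: "smooth_vf A U Y" and p: "p \<in> U"
    and e: "\<And>q. q \<in> U \<Longrightarrow> X' q = X q" "\<And>q. q \<in> U \<Longrightarrow> Y' q = Y q"
  shows "lie_bracket A X' Y' p = lie_bracket A X Y p"
proof (rule ext)
  fix f
  show "lie_bracket A X' Y' p f = lie_bracket A X Y p f"
  proof (cases "smooth_at A p f")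
    case True
    then obtain W where W: "p \<in> W" "smooth_fun A W f" unfolding smooth_at_def by blast
    have o: "open (U \<inter> W)" "p \<in> U \<inter> W" using smooth_vf_open[OF X] smooth_fun_open[OF W(2)] p W by auto
    have f: "smooth_fun A (U \<inter> W) f" by (rule smooth_fun_subset[OF W(2) o(1)]) auto
    have *: "V p (\<lambda>q. Z' q f) = V p (\<lambda>q. Z q f)"
      if "smooth_vf A U V" "smooth_vf A U Z" "\<And>q. q \<in> U \<Longrightarrow> Z' q = Z q" for V Z Z'
      using deriv_along_cong[OF smooth_vf_tangent[OF that(1) p] smooth_vf_deriv[OF that(2) f] o(2), of "\<lambda>q. Z' q f"]
      by (simp add: deriv_along_real that(3))
    show ?thesis using True *[OF X Y e(2)] *[OF Y X e(1)] e[OF p] by (simp add: lie_bracket_def)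
  qed (simp add: lie_bracket_def)
qed

end

locale gauge = geometry A g nab H P
  for A :: "('m::{t2_space,second_countable_topology}, 'n::finite) atlas" and g nab H P +
  fixes U :: "'m set" and \<sigma> :: "'m \<Rightarrow> ('m, 'n) frame"
  assumes gauge: "local_section A P U \<sigma>"
begin

abbreviation sm :: "('m \<Rightarrow> 'b::real_normed_vector) \<Rightarrow> bool" where "sm f \<equiv> smooth_fun A U f"

abbreviation e :: "'n \<Rightarrow> 'm vfield" where "e i \<equiv> (\<lambda>q. \<sigma> q (axis i 1))"

definition d :: "'n \<Rightarrow> ('m \<Rightarrow> 'b::euclidean_space) \<Rightarrow> 'm \<Rightarrow> 'b" where
  "d i F q = deriv_along (\<sigma> q (axis i 1)) F"

definition G :: "'n \<Rightarrow> 'm \<Rightarrow> 'n mat" where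
  "G i q = connection_form nab \<sigma> q (\<sigma> q (axis i 1))"

text \<open>The structure functions of the frame: [e_i, e_j] is the sum of c_{ijk} e_k.\<close>

definition c :: "'n \<Rightarrow> 'n \<Rightarrow> 'n \<Rightarrow> 'm \<Rightarrow> real" where
  "c i j k q = inv (\<sigma> q) (lie_bracket A (e i) (e j) q) $ k"

text \<open>Cartan's structure equation in an anholonomic frame, whence the term with c. Entry (k,
  m) of \<open>R i j q\<close> is g(R_{ij} e_m, e_k), with the vector acted on in the last
  place.\<close>

definition R :: "'n \<Rightarrow> 'n \<Rightarrow> 'm \<Rightarrow> 'n mat" where
  "R i j q = d i (G j) q - d j (G i) q + (G i q ** G j q - G j q ** G i q) - (\<Sum>k\<in>UNIV. c i j k q *\<^sub>R G k q)"

definition T :: "'n \<Rightarrow> 'n \<Rightarrow> 'n \<Rightarrow> 'm \<Rightarrow> real" where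
  "T i j k q = torsion_form A g nab (e i) (e j) (e k) q"

section \<open>Calculus in a fixed gauge\<close>

lemma U: "open U" and frame: "q \<in> U \<Longrightarrow> frame_at q (\<sigma> q)"
  and tan: "q \<in> U \<Longrightarrow> \<sigma> q x \<in> tangent_space A q"
  and vf: "smooth_vf A U (\<lambda>q. \<sigma> q x)"
  using section_open[OF gauge] section_frame[OF gauge] frame_tangent[OF section_frame[OF gauge]] section_vf[OF gauge]
  by auto

text \<open>The calculus here concerns functions smooth on all of U. Statements on tangent vectors
  must be tested on germs, and shrinking the domain of the gauge provides these.\<close>

lemma restrict_gauge: "open W \<Longrightarrow> W \<subseteq> U \<Longrightarrow> gauge A g nab H P W \<sigma>"
  by unfold_locales (rule section_subset[OF gauge])

lemma sm_const: "sm (\<lambda>q. a)" by (rule smooth_fun_const[OF U])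
lemmas sm_add = smooth_fun_add[where W=U] and sm_diff = smooth_fun_diff[where W=U] and sm_minus = smooth_fun_minus[where W=U]
lemma sm_sum: "(\<And>i. i \<in> I \<Longrightarrow> sm (f i)) \<Longrightarrow> sm (\<lambda>q. \<Sum>i\<in>I. f i q)" by (rule smooth_fun_sum[OF U])
lemma sm_nth: "sm F \<Longrightarrow> sm (\<lambda>q. F q $ i)" by (rule smooth_fun_bounded_linear[OF bounded_linear_vec_nth])
lemmas sm_scaleR = smooth_fun_bilinear[OF bounded_bilinear_scaleR, where W=U]
lemmas sm_matrix_mult = smooth_fun_bilinear[OF bounded_bilinear_matrix_mult, where W=U]
lemmas sm_matrix_vector = smooth_fun_bilinear[OF bounded_bilinear_matrix_vector, where W=U]
lemma sm_vec: "(\<And>i. sm (\<lambda>q. F q $ i)) \<Longrightarrow> sm F" for F :: "'m \<Rightarrow> 'b::euclidean_space ^ 'k::finite"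
  by (rule smooth_fun_vec[OF U])

lemma sm_d: "sm F \<Longrightarrow> sm (\<lambda>q. d i F q)" unfolding d_def by (rule smooth_vf_deriv[OF vf _ subset_refl])
lemma sm_G: "sm (G i)" unfolding G_def[abs_def] by (rule connection_form_smooth[OF gauge])
lemma sm_c: "sm (\<lambda>q. c i j k q)"
  unfolding c_def by (rule sm_nth[OF components_smooth[OF gauge smooth_vf_lie_bracket[OF vf vf]]])
lemma sm_R: "sm (\<lambda>q. R i j q)"
  unfolding R_def by (intro sm_add sm_diff sm_matrix_mult sm_sum sm_scaleR sm_d sm_G sm_c)

lemma d_const: "q \<in> U \<Longrightarrow> d i (\<lambda>q. a) q = 0"
  unfolding d_def by (rule deriv_along_const[OF tan])
lemma d_add: "q \<in> U \<Longrightarrow> sm F \<Longrightarrow> sm F' \<Longrightarrow> d i (\<lambda>q. F q + F' q) q = d i F q + d i F' q"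
  unfolding d_def by (rule deriv_along_add[OF tan])
lemma d_diff: "q \<in> U \<Longrightarrow> sm F \<Longrightarrow> sm F' \<Longrightarrow> d i (\<lambda>q. F q - F' q) q = d i F q - d i F' q"
  unfolding d_def by (rule deriv_along_diff[OF tan])
lemma d_sum: "q \<in> U \<Longrightarrow> (\<And>k. k \<in> I \<Longrightarrow> sm (F k)) \<Longrightarrow> d i (\<lambda>q. \<Sum>k\<in>I. F k q) q = (\<Sum>k\<in>I. d i (F k) q)"
  unfolding d_def by (rule deriv_along_sum[OF tan U])
lemma d_bilinear: "q \<in> U \<Longrightarrow> bounded_bilinear B \<Longrightarrow> sm F \<Longrightarrow> sm F' \<Longrightarrow>
    d i (\<lambda>q. B (F q) (F' q)) q = B (F q) (d i F' q) + B (d i F q) (F' q)"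
  unfolding d_def by (rule deriv_along_bilinear[OF tan])
lemma d_linear: "q \<in> U \<Longrightarrow> linear L \<Longrightarrow> sm F \<Longrightarrow> d i (\<lambda>q. L (F q)) q = L (d i F q)"
  unfolding d_def by (rule deriv_along_linear[OF tan])
lemma d_nth: "q \<in> U \<Longrightarrow> sm F \<Longrightarrow> d i (\<lambda>q. F q $ k) q = d i F q $ k"
  unfolding d_def by (rule deriv_along_bounded_linear[OF tan bounded_linear_vec_nth])
lemma d_cong: "q \<in> U \<Longrightarrow> sm F \<Longrightarrow> (\<And>r. r \<in> U \<Longrightarrow> F r = F' r) \<Longrightarrow> d i F q = d i F' q"
  unfolding d_def by (rule deriv_along_cong[OF tan])

lemma deriv_along_d: "q \<in> U \<Longrightarrow> deriv_along (\<sigma> q x) F = (\<Sum>i\<in>UNIV. (x $ i) *\<^sub>R d i F q)"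
  unfolding d_def by (rule deriv_along_frame[OF frame])

lemma d_commutator:
  assumes q: "q \<in> U" and F: "sm F"
  shows "d i (\<lambda>r. d j F r) q - d j (\<lambda>r. d i F r) q = (\<Sum>k\<in>UNIV. c i j k q *\<^sub>R d k F q)"
proof -
  let ?b = "lie_bracket A (e i) (e j) q"
  have "d i (\<lambda>r. d j F r) q - d j (\<lambda>r. d i F r) q = deriv_along ?b F"
    unfolding d_def by (rule lie_bracket_deriv_along[OF vf vf F q subset_refl, symmetric])
  also have "?b = \<sigma> q (inv (\<sigma> q) ?b)"
    by (rule frame_inv_right[OF frame[OF q] lie_bracket_tangent[OF vf vf q], symmetric])
  finally show ?thesis by (simp add: deriv_along_d[OF q] c_def)
qed

text \<open>The covariant derivative along e_i of a function whose values are acted on by B. Keeping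
  B abstract lets the same identity serve for \<open>*v\<close> on tangent vectors and for
  \<open>star H \<rho>\<close>.\<close>

definition nB :: "('n mat \<Rightarrow> 'v \<Rightarrow> 'v) \<Rightarrow> 'n \<Rightarrow> ('m \<Rightarrow> 'v::euclidean_space) \<Rightarrow> 'm \<Rightarrow> 'v" where
  "nB B i f q = d i f q + B (G i q) (f q)"

lemma sm_nB: "bounded_bilinear B \<Longrightarrow> sm f \<Longrightarrow> sm (\<lambda>q. nB B i f q)"
  unfolding nB_def by (rule sm_add[OF sm_d smooth_fun_bilinear[OF _ sm_G]])

lemma G_lie: "q \<in> U \<Longrightarrow> G i q \<in> lie_algebra H"
  unfolding G_def by (rule connection_form_lie[OF gauge _ tan])

text \<open>Derivatives of f cancel because d_i and d_j commute up to c. What survives is the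
  expression \<open>R\<close>, once B respects brackets on the Lie algebra, where G takes its
  values.\<close>

lemma nB_commutator:
  assumes B: "bounded_bilinear B" and q: "q \<in> U" and f: "sm f"
    and br: "\<And>X Y v. X \<in> lie_algebra H \<Longrightarrow> Y \<in> lie_algebra H \<Longrightarrow> B (X ** Y - Y ** X) v = B X (B Y v) - B Y (B X v)"
  shows "nB B i (\<lambda>r. nB B j f r) q - nB B j (\<lambda>r. nB B i f r) q - (\<Sum>k\<in>UNIV. c i j k q *\<^sub>R nB B k f q) = B (R i j q) (f q)"
proof -
  interpret B: bounded_bilinear B by (rule B)
  have 1: "nB B i (\<lambda>r. nB B j f r) q = d i (\<lambda>r. d j f r) q + B (G j q) (d i f q) + B (d i (G j) q) (f q)
     + B (G i q) (d j f q) + B (G i q) (B (G j q) (f q))" for i j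
    unfolding nB_def
    by (simp add: d_add[OF q sm_d[OF f] smooth_fun_bilinear[OF B sm_G f]] d_bilinear[OF q B sm_G f] B.add_right)
  have 2: "(\<Sum>k\<in>UNIV. c i j k q *\<^sub>R nB B k f q) = d i (\<lambda>r. d j f r) q - d j (\<lambda>r. d i f r) q
      + (\<Sum>k\<in>UNIV. c i j k q *\<^sub>R B (G k q) (f q))"
    unfolding d_commutator[OF q f] nB_def by (simp add: scaleR_add_right sum.distrib)
  have 3: "B (R i j q) (f q) = B (d i (G j) q) (f q) - B (d j (G i) q) (f q)
      + (B (G i q) (B (G j q) (f q)) - B (G j q) (B (G i q) (f q))) - (\<Sum>k\<in>UNIV. c i j k q *\<^sub>R B (G k q) (f q))"
    unfolding R_def by (simp add: B.add_left B.diff_left B.sum_left B.scaleR_left br[OF G_lie[OF q] G_lie[OF q], unfolded B.diff_left])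
  show ?thesis unfolding 1 2 3 by (simp add: algebra_simps)
qed

section \<open>Lie bracket and curvature in components\<close>

abbreviation nv :: "'n \<Rightarrow> ('m \<Rightarrow> real ^ 'n) \<Rightarrow> 'm \<Rightarrow> real ^ 'n" where "nv \<equiv> nB (*v)"

lemma sm_nv: "sm z \<Longrightarrow> sm (\<lambda>q. nv i z q)" by (rule sm_nB[OF bounded_bilinear_matrix_vector])

lemma nab_nv:
  assumes q: "q \<in> U" and z: "sm z"
  shows "nab q (\<sigma> q y) (\<lambda>r. \<sigma> r (z r)) = \<sigma> q (\<Sum>j\<in>UNIV. (y $ j) *\<^sub>R nv j z q)"
proof -
  interpret mv: bounded_bilinear "(*v) :: 'n mat \<Rightarrow> real ^ 'n \<Rightarrow> real ^ 'n"
    by (rule bounded_bilinear_matrix_vector)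
  show ?thesis
    unfolding nab_components[OF gauge q tan[OF q] z] deriv_along_d[OF q] connection_form_comb[OF gauge q, of y]
      G_def[symmetric] nB_def
    by (simp add: mv.sum_left mv.scaleR_left scaleR_add_right sum.distrib)
qed

lemma nab_e: "q \<in> U \<Longrightarrow> sm z \<Longrightarrow> nab q (\<sigma> q (axis j 1)) (\<lambda>r. \<sigma> r (z r)) = \<sigma> q (nv j z q)"
  using nab_nv[of q z "axis j 1"] by (simp only: sum_axis_scaleR)

lemma nv_const: "q \<in> U \<Longrightarrow> nv j (\<lambda>r. a) q = G j q *v a"
  by (simp add: nB_def d_const)

text \<open>The components of the bracket of two fields: derivatives of the coefficients, plus the
  contribution of the structure functions.\<close>

definition br :: "('m \<Rightarrow> real ^ 'n) \<Rightarrow> ('m \<Rightarrow> real ^ 'n) \<Rightarrow> 'm \<Rightarrow> real ^ 'n" where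
  "br x y q = (\<Sum>i\<in>UNIV. (x q $ i) *\<^sub>R d i y q - (y q $ i) *\<^sub>R d i x q)
     + (\<Sum>i\<in>UNIV. \<Sum>j\<in>UNIV. (x q $ i * y q $ j) *\<^sub>R (\<chi> k. c i j k q))"

lemma lie_bracket_apply:
  assumes q: "q \<in> U" and x: "sm x" and y: "sm y" and f: "sm f"
  shows "deriv_along (lie_bracket A (\<lambda>r. \<sigma> r (x r)) (\<lambda>r. \<sigma> r (y r)) q) f = deriv_along (\<sigma> q (br x y q)) f"
proof -
  have it: "deriv_along (\<sigma> q (x q)) (\<lambda>r. deriv_along (\<sigma> r (y r)) f) =
    (\<Sum>i\<in>UNIV. \<Sum>j\<in>UNIV. (x q $ i * y q $ j) *\<^sub>R d i (\<lambda>r. d j f r) q) +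
    (\<Sum>i\<in>UNIV. \<Sum>j\<in>UNIV. (x q $ i * d i y q $ j) *\<^sub>R d j f q)" if x: "sm x" and y: "sm y" for x y
  proof -
    have s: "sm (\<lambda>r. (y r $ j) *\<^sub>R d j f r)" for j by (intro sm_scaleR sm_nth y sm_d f)
    have "deriv_along (\<sigma> q (x q)) (\<lambda>r. deriv_along (\<sigma> r (y r)) f) =
        deriv_along (\<sigma> q (x q)) (\<lambda>r. \<Sum>j\<in>UNIV. (y r $ j) *\<^sub>R d j f r)"
      by (rule deriv_along_cong[OF tan[OF q] smooth_vf_deriv[OF section_vf_components[OF gauge y] f subset_refl] q])
        (rule deriv_along_d)
    also have "\<dots> = (\<Sum>i\<in>UNIV. (x q $ i) *\<^sub>R (\<Sum>j\<in>UNIV. (y q $ j) *\<^sub>R d i (\<lambda>r. d j f r) q + (d i y q $ j) *\<^sub>R d j f q))"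
      by (simp add: deriv_along_d[OF q] d_sum[OF q s] d_bilinear[OF q bounded_bilinear_scaleR sm_nth[OF y] sm_d[OF f]]
          d_nth[OF q y])
    finally show ?thesis by (simp add: scaleR_sum_right scaleR_add_right sum.distrib)
  qed
  have sw: "(\<Sum>i\<in>UNIV. \<Sum>j\<in>UNIV. (y q $ i * x q $ j) *\<^sub>R d i (\<lambda>r. d j f r) q) =
    (\<Sum>i\<in>UNIV. \<Sum>j\<in>UNIV. (x q $ i * y q $ j) *\<^sub>R d j (\<lambda>r. d i f r) q)"
    by (subst sum.swap) (simp add: mult.commute)
  have "deriv_along (lie_bracket A (\<lambda>r. \<sigma> r (x r)) (\<lambda>r. \<sigma> r (y r)) q) f =
     (\<Sum>i\<in>UNIV. \<Sum>j\<in>UNIV. (x q $ i * y q $ j) *\<^sub>R (d i (\<lambda>r. d j f r) q - d j (\<lambda>r. d i f r) q)) +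
     (\<Sum>i\<in>UNIV. \<Sum>j\<in>UNIV. (x q $ i * d i y q $ j - y q $ i * d i x q $ j) *\<^sub>R d j f q)"
    unfolding lie_bracket_deriv_along[OF section_vf_components[OF gauge x] section_vf_components[OF gauge y] f q subset_refl]
      it[OF x y] it[OF y x] sw
    by (simp add: scaleR_diff_right scaleR_diff_left sum_subtractf)
  also have "\<dots> = deriv_along (\<sigma> q (br x y q)) f"
  proof -
    have a: "(\<Sum>k\<in>UNIV. \<Sum>i\<in>UNIV. \<Sum>j\<in>UNIV. (x q $ i * y q $ j * c i j k q) *\<^sub>R d k f q)
      = (\<Sum>i\<in>UNIV. \<Sum>j\<in>UNIV. \<Sum>k\<in>UNIV. (x q $ i * y q $ j * c i j k q) *\<^sub>R d k f q)"
      by (subst sum.swap) (intro sum.cong refl sum.swap)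
    have b: "(\<Sum>k\<in>UNIV. \<Sum>i\<in>UNIV. (x q $ i * d i y q $ k - y q $ i * d i x q $ k) *\<^sub>R d k f q)
      = (\<Sum>i\<in>UNIV. \<Sum>j\<in>UNIV. (x q $ i * d i y q $ j - y q $ i * d i x q $ j) *\<^sub>R d j f q)"
      by (rule sum.swap)
    have "deriv_along (\<sigma> q (br x y q)) f =
      (\<Sum>k\<in>UNIV. \<Sum>i\<in>UNIV. (x q $ i * d i y q $ k - y q $ i * d i x q $ k) *\<^sub>R d k f q) +
      (\<Sum>k\<in>UNIV. \<Sum>i\<in>UNIV. \<Sum>j\<in>UNIV. (x q $ i * y q $ j * c i j k q) *\<^sub>R d k f q)"
      unfolding deriv_along_d[OF q] br_def by (simp add: scaleR_add_left sum.distrib scaleR_sum_left)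
    then show ?thesis unfolding a b d_commutator[OF q f] by (simp add: scaleR_sum_right)
  qed
  finally show ?thesis .
qed

lemma lie_bracket_components:
  assumes q: "q \<in> U" and x: "sm x" and y: "sm y"
  shows "lie_bracket A (\<lambda>r. \<sigma> r (x r)) (\<lambda>r. \<sigma> r (y r)) q = \<sigma> q (br x y q)"
proof (rule tangent_eqI[OF lie_bracket_tangent[OF section_vf_components[OF gauge x] section_vf_components[OF gauge y] q] tan[OF q]])
  fix f :: "'m \<Rightarrow> real" assume "smooth_at A q f"
  then obtain W where W: "q \<in> W" "smooth_fun A W f" unfolding smooth_at_def by blast
  have o: "open (U \<inter> W)" using U smooth_fun_open[OF W(2)] by auto
  interpret r: gauge A g nab H P "U \<inter> W" \<sigma> by (rule restrict_gauge[OF o]) auto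
  show "lie_bracket A (\<lambda>r. \<sigma> r (x r)) (\<lambda>r. \<sigma> r (y r)) q f = \<sigma> q (br x y q) f"
    using r.lie_bracket_apply[OF _ smooth_fun_subset[OF x o] smooth_fun_subset[OF y o] smooth_fun_subset[OF W(2) o]]
      q W(1) by (simp add: deriv_along_real)
qed

definition Rb :: "real ^ 'n \<Rightarrow> real ^ 'n \<Rightarrow> 'm \<Rightarrow> 'n mat" where
  "Rb x y q = (\<Sum>i\<in>UNIV. \<Sum>j\<in>UNIV. (x $ i * y $ j) *\<^sub>R R i j q)"

lemma Rb_axis: "Rb (axis i 1) (axis j 1) q = R i j q"
  unfolding Rb_def by (simp only: sum_axis_double sum_axis_scaleR)

lemma nv_commutator:
  assumes q: "q \<in> U" and z: "sm z"
  shows "nv i (\<lambda>r. nv j z r) q - nv j (\<lambda>r. nv i z r) q - (\<Sum>k\<in>UNIV. c i j k q *\<^sub>R nv k z q) = R i j q *v z q"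
  by (rule nB_commutator[OF bounded_bilinear_matrix_vector q z])
    (simp add: matrix_vector_mult_diff_rdistrib matrix_vector_mul_assoc)

lemma nab_nab:
  assumes q: "q \<in> U" and x: "sm x" and y: "sm y" and z: "sm z"
  shows "nab q (\<sigma> q (x q)) (\<lambda>r. nab r (\<sigma> r (y r)) (\<lambda>r. \<sigma> r (z r))) =
    \<sigma> q ((\<Sum>i\<in>UNIV. \<Sum>j\<in>UNIV. (x q $ i * y q $ j) *\<^sub>R nv i (\<lambda>r. nv j z r) q) +
         (\<Sum>i\<in>UNIV. \<Sum>j\<in>UNIV. (x q $ i * d i y q $ j) *\<^sub>R nv j z q))"
proof -
  interpret mv: bounded_bilinear "(*v) :: 'n mat \<Rightarrow> real ^ 'n \<Rightarrow> real ^ 'n"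
    by (rule bounded_bilinear_matrix_vector)
  define w where "w = (\<lambda>r. \<Sum>j\<in>UNIV. (y r $ j) *\<^sub>R nv j z r)"
  have s: "sm (\<lambda>r. (y r $ j) *\<^sub>R nv j z r)" for j by (intro sm_scaleR sm_nth y sm_nv z)
  have w: "sm w" unfolding w_def by (rule sm_sum[OF s])
  have 1: "nab q (\<sigma> q (x q)) (\<lambda>r. nab r (\<sigma> r (y r)) (\<lambda>r. \<sigma> r (z r))) = nab q (\<sigma> q (x q)) (\<lambda>r. \<sigma> r (w r))"
    by (rule nab_local[OF section_vf_components[OF gauge w] q tan[OF q]]) (simp add: w_def nab_nv[OF _ z])
  have 2: "nv i w q = (\<Sum>j\<in>UNIV. (y q $ j) *\<^sub>R nv i (\<lambda>r. nv j z r) q + (d i y q $ j) *\<^sub>R nv j z q)" for i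
  proof -
    have "d i w q = (\<Sum>j\<in>UNIV. (y q $ j) *\<^sub>R d i (\<lambda>r. nv j z r) q + (d i y q $ j) *\<^sub>R nv j z q)"
      unfolding w_def
      by (simp add: d_sum[OF q s] d_bilinear[OF q bounded_bilinear_scaleR sm_nth[OF y] sm_nv[OF z]] d_nth[OF q y])
    moreover have "G i q *v w q = (\<Sum>j\<in>UNIV. (y q $ j) *\<^sub>R (G i q *v nv j z q))"
      unfolding w_def by (simp add: mv.sum_right mv.scaleR_right)
    ultimately show ?thesis unfolding nB_def[of _ i] by (simp add: scaleR_add_right sum.distrib)
  qed
  show ?thesis unfolding 1 nab_nv[OF q w] 2 by (simp add: scaleR_sum_right scaleR_add_right sum.distrib)
qed

text \<open>Tensoriality of the curvature: the derivatives of the coefficients x and y cancel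
  against those in the bracket, so only the values at q remain.\<close>

lemma curvature_components:
  assumes q: "q \<in> U" and x: "sm x" and y: "sm y" and z: "sm z"
  shows "curvature A nab (\<lambda>r. \<sigma> r (x r)) (\<lambda>r. \<sigma> r (y r)) (\<lambda>r. \<sigma> r (z r)) q = \<sigma> q (Rb (x q) (y q) q *v z q)"
proof -
  interpret mv: bounded_bilinear "(*v) :: 'n mat \<Rightarrow> real ^ 'n \<Rightarrow> real ^ 'n"
    by (rule bounded_bilinear_matrix_vector)
  let ?n2 = "\<lambda>i j. nv i (\<lambda>r. nv j z r) q"
  define v where "v = (\<Sum>i\<in>UNIV. \<Sum>j\<in>UNIV. (x q $ i * y q $ j) *\<^sub>R ?n2 i j) +
         (\<Sum>i\<in>UNIV. \<Sum>j\<in>UNIV. (x q $ i * d i y q $ j) *\<^sub>R nv j z q) -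
      ((\<Sum>i\<in>UNIV. \<Sum>j\<in>UNIV. (y q $ i * x q $ j) *\<^sub>R ?n2 i j) +
         (\<Sum>i\<in>UNIV. \<Sum>j\<in>UNIV. (y q $ i * d i x q $ j) *\<^sub>R nv j z q)) -
      (\<Sum>k\<in>UNIV. (br x y q $ k) *\<^sub>R nv k z q)"
  have "curvature A nab (\<lambda>r. \<sigma> r (x r)) (\<lambda>r. \<sigma> r (y r)) (\<lambda>r. \<sigma> r (z r)) q = \<sigma> q v"
    unfolding curvature_def lie_bracket_components[OF q x y] nab_nab[OF q x y z] nab_nab[OF q y x z] nab_nv[OF q z] v_def
    by (simp add: frame_diff[OF frame[OF q]])
  moreover have "v = Rb (x q) (y q) q *v z q"
  proof -
    have sw: "(\<Sum>i\<in>UNIV. \<Sum>j\<in>UNIV. (y q $ i * x q $ j) *\<^sub>R ?n2 i j) = (\<Sum>i\<in>UNIV. \<Sum>j\<in>UNIV. (x q $ i * y q $ j) *\<^sub>R ?n2 j i)"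
      by (subst sum.swap) (simp add: mult.commute)
    have a: "(\<Sum>k\<in>UNIV. \<Sum>i\<in>UNIV. \<Sum>j\<in>UNIV. (x q $ i * y q $ j * c i j k q) *\<^sub>R nv k z q)
      = (\<Sum>i\<in>UNIV. \<Sum>j\<in>UNIV. (x q $ i * y q $ j) *\<^sub>R (\<Sum>k\<in>UNIV. c i j k q *\<^sub>R nv k z q))"
      unfolding scaleR_sum_right scaleR_scaleR by (subst sum.swap) (intro sum.cong refl sum.swap)
    have b: "(\<Sum>k\<in>UNIV. \<Sum>i\<in>UNIV. (x q $ i * d i y q $ k - y q $ i * d i x q $ k) *\<^sub>R nv k z q)
      = (\<Sum>i\<in>UNIV. \<Sum>j\<in>UNIV. (x q $ i * d i y q $ j) *\<^sub>R nv j z q) - (\<Sum>i\<in>UNIV. \<Sum>j\<in>UNIV. (y q $ i * d i x q $ j) *\<^sub>R nv j z q)"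
      by (subst sum.swap) (simp add: scaleR_diff_left sum_subtractf)
    have "(\<Sum>k\<in>UNIV. (br x y q $ k) *\<^sub>R nv k z q) =
      (\<Sum>k\<in>UNIV. \<Sum>i\<in>UNIV. (x q $ i * d i y q $ k - y q $ i * d i x q $ k) *\<^sub>R nv k z q) +
      (\<Sum>k\<in>UNIV. \<Sum>i\<in>UNIV. \<Sum>j\<in>UNIV. (x q $ i * y q $ j * c i j k q) *\<^sub>R nv k z q)"
      unfolding br_def by (simp add: scaleR_add_left sum.distrib scaleR_sum_left)
    then have "v = (\<Sum>i\<in>UNIV. \<Sum>j\<in>UNIV. (x q $ i * y q $ j) *\<^sub>R (?n2 i j - ?n2 j i - (\<Sum>k\<in>UNIV. c i j k q *\<^sub>R nv k z q)))"
      unfolding v_def a b sw by (simp add: scaleR_diff_right sum_subtractf)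
    then show ?thesis
      unfolding nv_commutator[OF q z] Rb_def by (simp add: mv.sum_left mv.scaleR_left)
  qed
  ultimately show ?thesis by simp
qed

text \<open>Vector fields are total functions, whereas frame expressions reproduce them on U only;
  locality of the connection and of the bracket bridges this.\<close>

lemma curvature_cong:
  assumes q: "q \<in> U" and v: "smooth_vf A U X" "smooth_vf A U Y" "smooth_vf A U Z"
    and e: "\<And>q. q \<in> U \<Longrightarrow> X' q = X q" "\<And>q. q \<in> U \<Longrightarrow> Y' q = Y q" "\<And>q. q \<in> U \<Longrightarrow> Z' q = Z q"
  shows "curvature A nab X' Y' Z' q = curvature A nab X Y Z q"
proof -
  have n: "nab r (V' r) Z' = nab r (V r) Z" if "r \<in> U" "smooth_vf A U V" "\<And>q. q \<in> U \<Longrightarrow> V' q = V q" for r V V'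
    using nab_local[OF v(3) that(1) smooth_vf_tangent[OF that(2,1)] e(3)] that by simp
  have nn: "nab q (V q) (\<lambda>r. nab r (W' r) Z') = nab q (V q) (\<lambda>r. nab r (W r) Z)"
    if "smooth_vf A U V" "smooth_vf A U W" "\<And>q. q \<in> U \<Longrightarrow> W' q = W q" for V W W'
    by (rule nab_local[OF nab_smooth[OF that(2) v(3)] q smooth_vf_tangent[OF that(1) q]]) (rule n[OF _ that(2,3)])
  have b: "nab q (lie_bracket A X Y q) Z' = nab q (lie_bracket A X Y q) Z"
    by (rule nab_local[OF v(3) q lie_bracket_tangent[OF v(1,2) q] e(3)])
  have lb: "lie_bracket A X' Y' q = lie_bracket A X Y q" by (rule lie_bracket_cong[OF v(1,2) q e(1,2)])
  have n1: "nab q (X q) (\<lambda>r. nab r (Y' r) Z') = nab q (X q) (\<lambda>r. nab r (Y r) Z)" by (rule nn[OF v(1,2) e(2)])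
  have n2: "nab q (Y q) (\<lambda>r. nab r (X' r) Z') = nab q (Y q) (\<lambda>r. nab r (X r) Z)" by (rule nn[OF v(2,1) e(1)])
  show ?thesis
    unfolding curvature_def lb b e(1)[OF q] e(2)[OF q] n1 n2 by (rule refl)
qed

text \<open>No derivative of h appears. Hence the curvature form depends only on the frame at the
  point, and rotates with it.\<close>

lemma curvature_form_gauge_change:
  assumes \<tau>: "local_section A P U \<tau>" and h: "smooth_fun A U h" "\<And>q. q \<in> U \<Longrightarrow> h q \<in> H"
    "\<And>q. q \<in> U \<Longrightarrow> \<tau> q = frame_act (\<sigma> q) (h q)" and q: "q \<in> U"
  shows "curvature_form A nab \<tau> q a b = transpose (h q) ** Rb (h q *v a) (h q *v b) q ** h q"
proof -
  have s: "sm (\<lambda>r. h r *v a)" for a by (intro sm_matrix_vector h(1) sm_const)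
  have "inv (\<tau> q) (curvature A nab (\<lambda>q. \<tau> q a) (\<lambda>q. \<tau> q b) (\<lambda>q. \<tau> q v) q) =
    (transpose (h q) ** Rb (h q *v a) (h q *v b) q ** h q) *v v" for v
  proof (rule frame_inv_eq[OF section_frame[OF \<tau> q]])
    have "curvature A nab (\<lambda>q. \<tau> q a) (\<lambda>q. \<tau> q b) (\<lambda>q. \<tau> q v) q =
       curvature A nab (\<lambda>r. \<sigma> r (h r *v a)) (\<lambda>r. \<sigma> r (h r *v b)) (\<lambda>r. \<sigma> r (h r *v v)) q"
      by (rule curvature_cong[OF q section_vf_components[OF gauge s] section_vf_components[OF gauge s]
          section_vf_components[OF gauge s]]) (simp_all add: h(3) frame_act_def)
    also have "\<dots> = \<sigma> q (Rb (h q *v a) (h q *v b) q *v (h q *v v))" by (rule curvature_components[OF q s s s])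
    finally show "curvature A nab (\<lambda>q. \<tau> q a) (\<lambda>q. \<tau> q b) (\<lambda>q. \<tau> q v) q =
        \<tau> q ((transpose (h q) ** Rb (h q *v a) (h q *v b) q ** h q) *v v)"
      unfolding h(3)[OF q] frame_act_def
      by (simp add: matrix_vector_mul_assoc matrix_mul_assoc H_transpose_mult[OF h(2)[OF q]])
  qed
  then show ?thesis unfolding curvature_form_def by simp
qed

lemma curvature_form_R: "q \<in> U \<Longrightarrow> curvature_form A nab \<sigma> q a b = Rb a b q"
  using curvature_form_gauge_change[OF gauge sm_const[of "mat 1"]] H_one by (simp add: frame_act_def)

text \<open>The components of (\<nabla>_m R)_{ij}: the derivative, the commutator with the
  connection matrix for the endomorphism part, and one correction for each two-form index.\<close>

definition DR :: "'n \<Rightarrow> 'n \<Rightarrow> 'n \<Rightarrow> 'm \<Rightarrow> 'n mat" where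
  "DR m i j q = d m (R i j) q + G m q ** R i j q - R i j q ** G m q
     - (\<Sum>l\<in>UNIV. (G m q $ l $ i) *\<^sub>R R l j q) - (\<Sum>l\<in>UNIV. (G m q $ l $ j) *\<^sub>R R i l q)"

lemma nabla_curvature_form_DR:
  assumes q: "q \<in> U"
  shows "nabla_curvature_form A nab \<sigma> q (axis m 1) (axis i 1) (axis j 1) = DR m i j q"
proof -
  interpret mv: bounded_bilinear "(*v) :: 'n mat \<Rightarrow> real ^ 'n \<Rightarrow> real ^ 'n"
    by (rule bounded_bilinear_matrix_vector)
  note u = frame[OF q]
  have sG: "sm (\<lambda>r. G m r *v a)" for a by (intro sm_matrix_vector sm_G sm_const)
  have nG: "nab r (e m r) (\<lambda>r. \<sigma> r a) = \<sigma> r (G m r *v a)" if "r \<in> U" for r a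
    using nab_e[OF that sm_const] nv_const[OF that] by simp
  have vfG: "smooth_vf A U (\<lambda>r. \<sigma> r (G m r *v a))" for a by (rule section_vf_components[OF gauge sG])
  have "inv (\<sigma> q) (nabla_curvature A nab (e m) (e i) (e j) (\<lambda>q. \<sigma> q a) q) = DR m i j q *v a" for a
  proof (rule frame_inv_eq[OF u])
    have sR: "sm (\<lambda>r. R i j r *v a)" by (intro sm_matrix_vector sm_R sm_const)
    have cR: "curvature A nab (e i) (e j) (\<lambda>q. \<sigma> q a) r = \<sigma> r (R i j r *v a)" if "r \<in> U" for r
      using curvature_components[OF that sm_const sm_const sm_const] by (simp add: Rb_axis)
    have 1: "nab q (e m q) (curvature A nab (e i) (e j) (\<lambda>q. \<sigma> q a)) = \<sigma> q (nv m (\<lambda>r. R i j r *v a) q)"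
      using nab_local[OF section_vf_components[OF gauge sR] q tan[OF q] cR] nab_e[OF q sR] by simp
    have 2: "curvature A nab (\<lambda>r. nab r (e m r) (e i)) (e j) (\<lambda>q. \<sigma> q a) q =
        \<sigma> q (Rb (G m q *v axis i 1) (axis j 1) q *v a)"
      using curvature_cong[OF q vfG vf vf nG refl refl] curvature_components[OF q sG sm_const sm_const] by simp
    have 3: "curvature A nab (e i) (\<lambda>r. nab r (e m r) (e j)) (\<lambda>q. \<sigma> q a) q =
        \<sigma> q (Rb (axis i 1) (G m q *v axis j 1) q *v a)"
      using curvature_cong[OF q vf vfG vf refl nG refl] curvature_components[OF q sm_const sG sm_const] by simp
    have 4: "curvature A nab (e i) (e j) (\<lambda>r. nab r (e m r) (\<lambda>q. \<sigma> q a)) q = \<sigma> q (R i j q *v (G m q *v a))"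
      using curvature_cong[OF q vf vf vfG refl refl nG] curvature_components[OF q sm_const sm_const sG]
      by (simp add: Rb_axis)
    have 5: "nv m (\<lambda>r. R i j r *v a) q = d m (R i j) q *v a + G m q *v (R i j q *v a)"
      unfolding nB_def using d_bilinear[OF q bounded_bilinear_matrix_vector sm_R sm_const, of m i j a] d_const[OF q, of m a]
      by simp
    have 6: "Rb (G m q *v axis i 1) (axis j 1) q = (\<Sum>l\<in>UNIV. (G m q $ l $ i) *\<^sub>R R l j q)"
      "Rb (axis i 1) (G m q *v axis j 1) q = (\<Sum>l\<in>UNIV. (G m q $ l $ j) *\<^sub>R R i l q)"
      unfolding Rb_def by (simp_all only: sum_axis_double sum_axis_double_right matrix_mult_axis)
    have "nabla_curvature A nab (e m) (e i) (e j) (\<lambda>q. \<sigma> q a) q =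
      \<sigma> q (d m (R i j) q *v a + G m q *v (R i j q *v a) - (\<Sum>l\<in>UNIV. (G m q $ l $ i) *\<^sub>R R l j q) *v a
       - (\<Sum>l\<in>UNIV. (G m q $ l $ j) *\<^sub>R R i l q) *v a - R i j q *v (G m q *v a))"
      unfolding nabla_curvature_def 1 2 3 4 5 6 by (simp add: frame_diff[OF u])
    also have "\<dots> = \<sigma> q (DR m i j q *v a)"
      unfolding DR_def by (simp add: mv.add_left mv.diff_left matrix_vector_mul_assoc algebra_simps)
    finally show "nabla_curvature A nab (e m) (e i) (e j) (\<lambda>q. \<sigma> q a) q = \<sigma> q (DR m i j q *v a)" .
  qed
  then show ?thesis unfolding nabla_curvature_form_def by simp
qed

section \<open>Symmetries of the curvature; parallel torsion in components\<close>

lemma G_skew: "q \<in> U \<Longrightarrow> G i q $ a $ b = - G i q $ b $ a"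
  using lie_algebra_skew[OF G_lie[of q i]] by (metis transpose_nth vector_uminus_component)

lemma d_lie: assumes q: "q \<in> U" and F: "sm F" "\<And>r. r \<in> U \<Longrightarrow> F r \<in> lie_algebra H" shows "d i F q \<in> lie_algebra H"
proof -
  have "d i F q = d i (\<lambda>r. pr_hol H (F r)) q" by (rule d_cong[OF q F(1)]) (simp add: pr_hol_id F(2))
  also have "\<dots> = pr_hol H (d i F q)" by (rule d_linear[OF q linear_pr_hol F(1)])
  finally show ?thesis using pr_hol_in by metis
qed

lemma R_lie: "q \<in> U \<Longrightarrow> R i j q \<in> lie_algebra H"
  unfolding R_def
  by (intro subspace_add[OF subspace_lie_algebra] subspace_diff[OF subspace_lie_algebra] lie_algebra_bracket
      subspace_sum[OF subspace_lie_algebra] subspace_scale[OF subspace_lie_algebra] G_lie d_lie sm_G)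

lemma R_skew: "q \<in> U \<Longrightarrow> R i j q $ a $ b = - R i j q $ b $ a"
  using lie_algebra_skew[OF R_lie[of q i j]] by (metis transpose_nth vector_uminus_component)

lemma c_skew: assumes q: "q \<in> U" shows "c j i k q = - c i j k q"
proof -
  have t: "lie_bracket A (e i) (e j) q \<in> tangent_space A q" by (rule lie_bracket_tangent[OF vf vf q])
  have "lie_bracket A (e j) (e i) q = (\<lambda>f. (-1) * lie_bracket A (e i) (e j) q f + 0 * lie_bracket A (e i) (e j) q f)"
    by (auto simp: lie_bracket_def)
  then have "inv (\<sigma> q) (lie_bracket A (e j) (e i) q) = - inv (\<sigma> q) (lie_bracket A (e i) (e j) q)"
    using frame_inv_comb[OF frame[OF q] t t, of "-1" 0] by simp
  then show ?thesis by (simp add: c_def)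
qed

lemma R_antisym: assumes q: "q \<in> U" shows "R j i q = - R i j q"
proof -
  have "(\<Sum>k\<in>UNIV. c j i k q *\<^sub>R G k q) = - (\<Sum>k\<in>UNIV. c i j k q *\<^sub>R G k q)"
    unfolding c_skew[OF q, of j i] by (simp add: sum_negf)
  then show ?thesis unfolding R_def by (simp add: algebra_simps)
qed

lemma torsion_cong:
  assumes q: "q \<in> U" and v: "smooth_vf A U X" "smooth_vf A U Y"
    and e: "\<And>q. q \<in> U \<Longrightarrow> X' q = X q" "\<And>q. q \<in> U \<Longrightarrow> Y' q = Y q"
  shows "torsion A nab X' Y' q = torsion A nab X Y q"
proof -
  have lb: "lie_bracket A X' Y' q = lie_bracket A X Y q" by (rule lie_bracket_cong[OF v q e])
  have n1: "nab q (X q) Y' = nab q (X q) Y" by (rule nab_local[OF v(2) q smooth_vf_tangent[OF v(1) q] e(2)])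
  have n2: "nab q (Y q) X' = nab q (Y q) X" by (rule nab_local[OF v(1) q smooth_vf_tangent[OF v(2) q] e(1)])
  show ?thesis unfolding torsion_def lb e(1)[OF q] e(2)[OF q] n1 n2 by (rule refl)
qed

lemma torsion_components:
  assumes q: "q \<in> U" and x: "sm x" and y: "sm y"
  shows "torsion A nab (\<lambda>r. \<sigma> r (x r)) (\<lambda>r. \<sigma> r (y r)) q =
    \<sigma> q (\<Sum>i\<in>UNIV. \<Sum>j\<in>UNIV. (x q $ i * y q $ j) *\<^sub>R (\<chi> k. G i q $ k $ j - G j q $ k $ i - c i j k q))"
proof -
  have a: "(\<Sum>i\<in>UNIV. (x q $ i) *\<^sub>R (G i q *v y q)) = (\<Sum>i\<in>UNIV. \<Sum>j\<in>UNIV. (x q $ i * y q $ j) *\<^sub>R (\<chi> k. G i q $ k $ j))" for x y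
    by (simp add: vec_eq_iff matrix_vector_mult_def sum_distrib_left mult_ac)
  have b: "(\<Sum>i\<in>UNIV. \<Sum>j\<in>UNIV. (y q $ i * x q $ j) *\<^sub>R (\<chi> k. G i q $ k $ j)) =
    (\<Sum>i\<in>UNIV. \<Sum>j\<in>UNIV. (x q $ i * y q $ j) *\<^sub>R (\<chi> k. G j q $ k $ i))"
    by (subst sum.swap) (simp add: mult.commute)
  have "(\<Sum>i\<in>UNIV. (x q $ i) *\<^sub>R nv i y q) - (\<Sum>i\<in>UNIV. (y q $ i) *\<^sub>R nv i x q) - br x y q =
    (\<Sum>i\<in>UNIV. \<Sum>j\<in>UNIV. (x q $ i * y q $ j) *\<^sub>R (\<chi> k. G i q $ k $ j)) -
    (\<Sum>i\<in>UNIV. \<Sum>j\<in>UNIV. (x q $ i * y q $ j) *\<^sub>R (\<chi> k. G j q $ k $ i)) -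
    (\<Sum>i\<in>UNIV. \<Sum>j\<in>UNIV. (x q $ i * y q $ j) *\<^sub>R (\<chi> k. c i j k q))"
    unfolding nB_def br_def scaleR_add_right sum.distrib a b by (simp add: sum_subtractf)
  also have "\<dots> = (\<Sum>i\<in>UNIV. \<Sum>j\<in>UNIV. (x q $ i * y q $ j) *\<^sub>R (\<chi> k. G i q $ k $ j - G j q $ k $ i - c i j k q))"
    by (simp add: vec_eq_iff sum_subtractf[symmetric] right_diff_distrib)
  finally have eq: "(\<Sum>i\<in>UNIV. (x q $ i) *\<^sub>R nv i y q) - (\<Sum>i\<in>UNIV. (y q $ i) *\<^sub>R nv i x q) - br x y q =
    (\<Sum>i\<in>UNIV. \<Sum>j\<in>UNIV. (x q $ i * y q $ j) *\<^sub>R (\<chi> k. G i q $ k $ j - G j q $ k $ i - c i j k q))" .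
  show ?thesis
    unfolding torsion_def lie_bracket_components[OF q x y] nab_nv[OF q x] nab_nv[OF q y] eq[symmetric]
      frame_diff[OF frame[OF q]]
    by (rule refl)
qed

lemma T_eq: assumes q: "q \<in> U" shows "T i j k q = G i q $ k $ j - G j q $ k $ i - c i j k q"
  unfolding T_def torsion_form_def torsion_components[OF q sm_const sm_const]
  by (simp only: sum_axis_double sum_axis_scaleR frame_inner[OF frame[OF q]] inner_axis) simp

lemma torsion_T:
  assumes q: "q \<in> U" and x: "sm x" and y: "sm y"
  shows "torsion A nab (\<lambda>r. \<sigma> r (x r)) (\<lambda>r. \<sigma> r (y r)) q =
    \<sigma> q (\<Sum>i\<in>UNIV. \<Sum>j\<in>UNIV. (x q $ i * y q $ j) *\<^sub>R (\<chi> k. T i j k q))"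
  unfolding torsion_components[OF q x y] T_eq[OF q] by (rule refl)

lemma sm_T: "sm (\<lambda>q. T i j k q)"
proof (rule smooth_fun_cong)
  show "sm (\<lambda>q. G i q $ k $ j - G j q $ k $ i - c i j k q)" by (intro sm_diff sm_nth sm_G sm_c)
qed (rule T_eq[symmetric])

lemma T_skew:
  assumes q: "q \<in> U"
  shows "T j i k q = - T i j k q" "T i k j q = - T i j k q"
proof -
  have *: "T i j k q = - T j i k q \<and> T i j k q = - T i k j q" for i j k
    using par_torsion vf q unfolding parallel_skew_torsion_def T_def by blast
  show "T j i k q = - T i j k q" by (rule conjunct1[OF *])
  show "T i k j q = - T i j k q" by (rule conjunct2[OF *])
qed

text \<open>The frame is not parallel, so parallel torsion need not have constant components; this
  gives the derivatives that cancel later, when the Ricci identity is differentiated.\<close>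

lemma T_parallel:
  assumes q: "q \<in> U"
  shows "d m (T i j k) q = (\<Sum>a\<in>UNIV. G m q $ a $ i * T a j k q) + (\<Sum>a\<in>UNIV. G m q $ a $ j * T i a k q)
    + (\<Sum>a\<in>UNIV. G m q $ a $ k * T i j a q)"
proof -
  note u = frame[OF q]
  have sG: "sm (\<lambda>r. G m r *v a)" for a by (intro sm_matrix_vector sm_G sm_const)
  have nG: "nab r (e m r) (\<lambda>r. \<sigma> r a) = \<sigma> r (G m r *v a)" if "r \<in> U" for r a
    using nab_e[OF that sm_const] nv_const[OF that] by simp
  have vfG: "smooth_vf A U (\<lambda>r. \<sigma> r (G m r *v a))" for a by (rule section_vf_components[OF gauge sG])
  have 1: "torsion_form A g nab (\<lambda>q. nab q (e m q) (e i)) (e j) (e k) q = (\<Sum>a\<in>UNIV. G m q $ a $ i * T a j k q)"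
  proof -
    have "torsion A nab (\<lambda>q. nab q (e m q) (e i)) (e j) q = \<sigma> q (\<Sum>a\<in>UNIV. (G m q $ a $ i) *\<^sub>R (\<chi> k. T a j k q))"
      using torsion_cong[OF q vfG vf nG refl] torsion_T[OF q sG sm_const]
      by (simp only: sum_axis_double_right matrix_mult_axis)
    then show ?thesis by (simp add: torsion_form_def frame_inner[OF u] inner_axis)
  qed
  have 2: "torsion_form A g nab (e i) (\<lambda>q. nab q (e m q) (e j)) (e k) q = (\<Sum>a\<in>UNIV. G m q $ a $ j * T i a k q)"
  proof -
    have "torsion A nab (e i) (\<lambda>q. nab q (e m q) (e j)) q = \<sigma> q (\<Sum>a\<in>UNIV. (G m q $ a $ j) *\<^sub>R (\<chi> k. T i a k q))"
      using torsion_cong[OF q vf vfG refl nG] torsion_T[OF q sm_const sG]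
      by (simp only: sum_axis_double matrix_mult_axis)
    then show ?thesis by (simp add: torsion_form_def frame_inner[OF u] inner_axis)
  qed
  have 3: "torsion_form A g nab (e i) (e j) (\<lambda>q. nab q (e m q) (e k)) q = (\<Sum>a\<in>UNIV. G m q $ a $ k * T i j a q)"
  proof -
    have "torsion A nab (e i) (e j) q = \<sigma> q (\<chi> a. T i j a q)"
      using torsion_T[OF q sm_const sm_const] by (simp only: sum_axis_double sum_axis_scaleR)
    then have "torsion_form A g nab (e i) (e j) (\<lambda>q. nab q (e m q) (e k)) q = (\<chi> a. T i j a q) \<bullet> (G m q *v axis k 1)"
      by (simp add: torsion_form_def nG[OF q] frame_inner[OF u])
    then show ?thesis by (simp add: inner_vec_def matrix_mult_axis mult.commute)
  qed
  have "d m (T i j k) q = e m q (torsion_form A g nab (e i) (e j) (e k))"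
    unfolding d_def deriv_along_real T_def[abs_def] by (rule refl)
  also have "\<dots> = torsion_form A g nab (\<lambda>q. nab q (e m q) (e i)) (e j) (e k) q +
      torsion_form A g nab (e i) (\<lambda>q. nab q (e m q) (e j)) (e k) q +
      torsion_form A g nab (e i) (e j) (\<lambda>q. nab q (e m q) (e k)) q"
    using par_torsion vf q unfolding parallel_skew_torsion_def by blast
  finally show ?thesis unfolding 1 2 3 .
qed

end


section \<open>Ricci and Bianchi identities\<close>

text \<open>The sum r + D is skew in each pair and has vanishing cyclic sum, so the classical
  argument with four cyclic identities makes it pair symmetric. Since D is pair symmetric, so is
  r.\<close>

lemma curvature_pair_symmetry:
  fixes r D :: "'n \<Rightarrow> 'n \<Rightarrow> 'n \<Rightarrow> 'n \<Rightarrow> real"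
  assumes r12: "\<And>i j k m. r i j k m = - r j i k m" and r34: "\<And>i j k m. r i j k m = - r i j m k"
    and D12: "\<And>i j k m. D i j k m = - D j i k m" and D34: "\<And>i j k m. D i j k m = - D i j m k"
    and Dsym: "\<And>i j k m. D i j k m = D k m i j"
    and b: "\<And>i j k m. r i j k m + r j k i m + r k i j m = - (D i j k m + D j k i m + D k i j m)"
  shows "r i j k m = r k m i j"
proof -
  have 1: "r j k m i = - r j k i m" "r k m j i = - r k m i j" "D j k m i = - D j k i m" "D k m j i = - D k m i j"
    "r i j m k = - r i j k m" "D i j m k = - D i j k m"
    using r34[of j k m i] r34[of k m j i] D34[of j k m i] D34[of k m j i] r34[of i j m k] D34[of i j m k] by simp_all
  have 2: "r i k m j = r k i j m" "D i k m j = D k i j m"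
    using r12[of i k m j] r34[of k i m j] D12[of i k m j] D34[of k i m j] by simp_all
  have 3: "r m j k i = r j m i k" "D m j k i = D j m i k"
    using r12[of m j k i] r34[of j m k i] D12[of m j k i] D34[of j m k i] by simp_all
  have 4: "r m i k j = - r m i j k" "D m i k j = - D m i j k"
    using r34[of m i k j] D34[of m i k j] by simp_all
  have 5: "D k m i j = D i j k m" "D m i j k = D j k m i" "D j m i k = D i k j m" "D i k j m = - D k i j m"
    using Dsym[of k m i j] Dsym[of m i j k] Dsym[of j m i k] D12[of i k j m] by simp_all
  show ?thesis
    using b[of i j k m] b[of j k m i] b[of k m i j] b[of m i j k] 1 2 3 4 5 by linarith
qed

section \<open>Bivectors of the standard basis\<close>

definition E :: "'n::finite \<Rightarrow> 'n \<Rightarrow> 'n mat" where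
  "E \<mu> \<nu> = wedge (axis \<mu> 1) (axis \<nu> 1)"

lemma axis_nth: "axis m (1::real) $ a = (if a = m then 1 else 0)"
  by (simp only: axis_def vec_lambda_beta)

lemma axis_inner_axis: "axis m (1::real) \<bullet> axis b 1 = (if b = m then 1 else 0)"
  unfolding inner_axis_axis by (cases "m = b") simp_all

lemma E_nth: "E \<mu> \<nu> $ a $ b = (if b = \<mu> \<and> a = \<nu> then 1 else 0) - (if b = \<nu> \<and> a = \<mu> then 1 else 0)"
proof -
  have "E \<mu> \<nu> $ a $ b = (axis \<mu> 1 \<bullet> axis b (1::real)) * axis \<nu> 1 $ a - (axis \<nu> 1 \<bullet> axis b (1::real)) * axis \<mu> 1 $ a"
    unfolding E_def wedge_def matrix_def by simp
  then show ?thesis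
    unfolding axis_nth axis_inner_axis
    by (cases "b = \<mu>"; cases "a = \<nu>"; cases "b = \<nu>"; cases "a = \<mu>") simp_all
qed

lemma sum_if_and:
  fixes x :: "'n::finite \<Rightarrow> 'k::finite \<Rightarrow> 'b::real_vector"
  shows "(\<Sum>i\<in>UNIV. \<Sum>j\<in>UNIV. (if a = i \<and> b = j then 1 else 0 :: real) *\<^sub>R x i j) = x a b"
    "(\<Sum>i\<in>UNIV. \<Sum>j\<in>UNIV. (if a = j \<and> b = i then 1 else 0 :: real) *\<^sub>R y i j) = (y b a :: 'b)"
proof -
  have "(if a = i \<and> b = j then 1 else 0 :: real) *\<^sub>R x i j = (if j = b then (if i = a then x i j else 0) else 0)" for i j
    by auto
  then show "(\<Sum>i\<in>UNIV. \<Sum>j\<in>UNIV. (if a = i \<and> b = j then 1 else 0 :: real) *\<^sub>R x i j) = x a b" by simp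
  have "(if a = j \<and> b = i then 1 else 0 :: real) *\<^sub>R y i j = (if j = a then (if i = b then y i j else 0) else 0)" for i j
    by auto
  then show "(\<Sum>i\<in>UNIV. \<Sum>j\<in>UNIV. (if a = j \<and> b = i then 1 else 0 :: real) *\<^sub>R y i j) = y b a" by simp
qed

lemma sum_E:
  fixes X :: "'n::finite \<Rightarrow> 'n \<Rightarrow> 'b::real_vector"
  shows "(\<Sum>\<mu>\<in>UNIV. \<Sum>\<nu>\<in>UNIV. (E \<mu> \<nu> $ k $ l) *\<^sub>R X \<mu> \<nu>) = X l k - X k l"
  unfolding E_nth scaleR_diff_left sum_subtractf sum_if_and by (rule refl)

text \<open>The minus sign reflects the convention for the wedge: for a \<noteq> b,
  \<open>E a b\<close> has entry -1 at (a, b) and +1 at (b, a). The factor 1/2 compensates for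
  counting every pair twice.\<close>

lemma skew_expand:
  fixes X :: "'n::finite mat"
  assumes "\<And>a b. X $ a $ b = - X $ b $ a"
  shows "X = (\<Sum>a\<in>UNIV. \<Sum>b\<in>UNIV. (- (X $ a $ b) / 2) *\<^sub>R E a b)"
proof -
  have "(\<Sum>a\<in>UNIV. \<Sum>b\<in>UNIV. (- (X $ a $ b) / 2) *\<^sub>R E a b) $ r $ s = X $ r $ s" for r s
  proof -
    have "(\<Sum>a\<in>UNIV. \<Sum>b\<in>UNIV. (- (X $ a $ b) / 2) *\<^sub>R E a b) $ r $ s =
      (\<Sum>a\<in>UNIV. \<Sum>b\<in>UNIV. (E a b $ r $ s) *\<^sub>R (- (X $ a $ b) / 2))" by (simp add: mult.commute)
    also have "\<dots> = - (X $ s $ r) / 2 - (- (X $ r $ s) / 2)" by (rule sum_E)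
    finally show ?thesis using assms[of r s] by simp
  qed
  then show ?thesis by (simp add: vec_eq_iff)
qed

text \<open>A pair symmetric S is a symmetric operator on bivectors, so the tensor sum of S(E)
  \<otimes> E equals the sum of E \<otimes> S(E).\<close>

lemma sum_pair_symmetric_swap:
  fixes S :: "'n::finite \<Rightarrow> 'n \<Rightarrow> 'n mat"
  assumes B: "bilinear B" and skew: "\<And>i j a b. S i j $ a $ b = - S i j $ b $ a"
    and pair: "\<And>i j k l. S i j $ k $ l = S k l $ i $ j"
  shows "(\<Sum>\<mu>\<in>UNIV. \<Sum>\<nu>\<in>UNIV. B (S \<mu> \<nu>) (E \<mu> \<nu>)) = (\<Sum>\<mu>\<in>UNIV. \<Sum>\<nu>\<in>UNIV. B (E \<mu> \<nu>) (S \<mu> \<nu>))"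
proof -
  have Bl: "linear (\<lambda>X. B X Y)" "linear (B X)" for X Y using B unfolding bilinear_def by auto
  let ?t = "\<lambda>\<mu> \<nu> a b. (- (S \<mu> \<nu> $ a $ b) / 2) *\<^sub>R B (E a b) (E \<mu> \<nu>)"
  have ex: "S i j = (\<Sum>a\<in>UNIV. \<Sum>b\<in>UNIV. (- (S i j $ a $ b) / 2) *\<^sub>R E a b)" for i j
    by (rule skew_expand) (rule skew)
  have 1: "B (S \<mu> \<nu>) (E \<mu> \<nu>) = (\<Sum>a\<in>UNIV. \<Sum>b\<in>UNIV. ?t \<mu> \<nu> a b)" for \<mu> \<nu>
    by (rule trans[OF arg_cong[OF ex, of "\<lambda>X. B X (E \<mu> \<nu>)"]])
      (simp only: linear_sum[OF Bl(1)] linear_cmul[OF Bl(1)])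
  have 2: "B (E a b) (S a b) = (\<Sum>\<mu>\<in>UNIV. \<Sum>\<nu>\<in>UNIV. ?t \<mu> \<nu> a b)" for a b
  proof -
    have p: "S a b $ i $ j = S i j $ a $ b" for i j by (rule pair)
    show ?thesis
      by (rule trans[OF arg_cong[OF ex, of "B (E a b)"]])
        (simp only: linear_sum[OF Bl(2)] linear_cmul[OF Bl(2)] p)
  qed
  have "(\<Sum>\<mu>\<in>UNIV. \<Sum>\<nu>\<in>UNIV. B (S \<mu> \<nu>) (E \<mu> \<nu>)) = (\<Sum>\<mu>\<in>UNIV. \<Sum>\<nu>\<in>UNIV. \<Sum>a\<in>UNIV. \<Sum>b\<in>UNIV. ?t \<mu> \<nu> a b)"
    by (simp only: 1)
  also have "\<dots> = (\<Sum>\<mu>\<in>UNIV. \<Sum>a\<in>UNIV. \<Sum>\<nu>\<in>UNIV. \<Sum>b\<in>UNIV. ?t \<mu> \<nu> a b)" by (intro sum.cong refl sum.swap)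
  also have "\<dots> = (\<Sum>a\<in>UNIV. \<Sum>\<mu>\<in>UNIV. \<Sum>\<nu>\<in>UNIV. \<Sum>b\<in>UNIV. ?t \<mu> \<nu> a b)" by (rule sum.swap)
  also have "\<dots> = (\<Sum>a\<in>UNIV. \<Sum>\<mu>\<in>UNIV. \<Sum>b\<in>UNIV. \<Sum>\<nu>\<in>UNIV. ?t \<mu> \<nu> a b)" by (intro sum.cong refl sum.swap)
  also have "\<dots> = (\<Sum>a\<in>UNIV. \<Sum>b\<in>UNIV. \<Sum>\<mu>\<in>UNIV. \<Sum>\<nu>\<in>UNIV. ?t \<mu> \<nu> a b)" by (intro sum.cong refl sum.swap)
  finally show ?thesis by (simp only: 2)
qed

text \<open>A skew endomorphism acts on bivectors as a derivation: [X, e_\<mu> \<and> e_\<nu>] = X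
  e_\<mu> \<and> e_\<nu> + e_\<mu> \<and> X e_\<nu>.\<close>

lemma skew_E_commutator:
  fixes X :: "'n::finite mat"
  assumes skew: "\<And>a b. X $ a $ b = - X $ b $ a"
  shows "X ** E \<mu> \<nu> - E \<mu> \<nu> ** X = (\<Sum>l\<in>UNIV. (X $ l $ \<mu>) *\<^sub>R E l \<nu>) + (\<Sum>l\<in>UNIV. (X $ l $ \<nu>) *\<^sub>R E \<mu> l)"
proof -
  have i: "(\<Sum>r\<in>UNIV. f r * (if P \<and> r = s then 1 else 0)) = (if P then f s else (0::real))"
    "(\<Sum>r\<in>UNIV. f r * (if r = s \<and> P then 1 else 0)) = (if P then f s else (0::real))"
    "(\<Sum>r\<in>UNIV. (if P \<and> r = s then 1 else 0) * f r) = (if P then f s else (0::real))"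
    "(\<Sum>r\<in>UNIV. (if r = s \<and> P then 1 else 0) * f r) = (if P then f s else (0::real))"
    "(\<Sum>r\<in>UNIV. f r * (if P \<and> s = r then 1 else 0)) = (if P then f s else (0::real))"
    "(\<Sum>r\<in>UNIV. f r * (if s = r \<and> P then 1 else 0)) = (if P then f s else (0::real))"
    for P and s :: 'n and f :: "'n \<Rightarrow> real"
    by (cases P; simp add: if_distrib if_distribR cong: if_cong)+
  have "(X ** E \<mu> \<nu> - E \<mu> \<nu> ** X) $ a $ b =
     ((\<Sum>l\<in>UNIV. (X $ l $ \<mu>) *\<^sub>R E l \<nu>) + (\<Sum>l\<in>UNIV. (X $ l $ \<nu>) *\<^sub>R E \<mu> l)) $ a $ b" for a b
    using skew[of \<mu> b] skew[of \<nu> b]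
    by (simp add: matrix_mult_nth E_nth right_diff_distrib left_diff_distrib sum_subtractf i)
  then show ?thesis by (simp add: vec_eq_iff)
qed

context gauge
begin

definition N :: "('n mat \<Rightarrow> 'v::euclidean_space \<Rightarrow> 'v) \<Rightarrow> ('m \<Rightarrow> 'v) \<Rightarrow> 'm \<Rightarrow> 'v ^ 'n" where
  "N \<rho> f q = (\<chi> i. nB (star H \<rho>) i f q)"

lemma N_nth: "N \<rho> f q $ i = nB (star H \<rho>) i f q" by (simp add: N_def)

section \<open>Second covariant derivatives and the Ricci identity\<close>

lemma nB_cong: "q \<in> U \<Longrightarrow> sm f \<Longrightarrow> (\<And>r. r \<in> U \<Longrightarrow> f r = f' r) \<Longrightarrow> nB B i f q = nB B i f' q"
  unfolding nB_def using d_cong[of q f f'] by simp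

lemma nB_diff: "bounded_bilinear B \<Longrightarrow> q \<in> U \<Longrightarrow> sm f \<Longrightarrow> sm f' \<Longrightarrow>
    nB B i (\<lambda>r. f r - f' r) q = nB B i f q - nB B i f' q"
  unfolding nB_def by (simp add: d_diff bounded_bilinear.diff_right)

lemma nB_add: "bounded_bilinear B \<Longrightarrow> q \<in> U \<Longrightarrow> sm f \<Longrightarrow> sm f' \<Longrightarrow>
    nB B i (\<lambda>r. f r + f' r) q = nB B i f q + nB B i f' q"
  unfolding nB_def by (simp add: d_add bounded_bilinear.add_right)

lemma nB_sum: "bounded_bilinear B \<Longrightarrow> q \<in> U \<Longrightarrow> (\<And>k. k \<in> I \<Longrightarrow> sm (f k)) \<Longrightarrow>
    nB B i (\<lambda>r. \<Sum>k\<in>I. f k r) q = (\<Sum>k\<in>I. nB B i (f k) q)"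
  unfolding nB_def by (simp add: d_sum bounded_bilinear.sum_right sum.distrib)

lemma nB_scaleR: "bounded_bilinear B \<Longrightarrow> q \<in> U \<Longrightarrow> sm h \<Longrightarrow> sm f \<Longrightarrow>
    nB B i (\<lambda>r. h r *\<^sub>R f r) q = d i h q *\<^sub>R f q + h q *\<^sub>R nB B i f q"
  unfolding nB_def
  by (simp add: d_bilinear[OF _ bounded_bilinear_scaleR] bounded_bilinear.scaleR_right scaleR_add_right)

lemma nB_equivariant:
  assumes "lie_representation H \<rho>" "lie_representation H \<rho>'" "linear L"
    "\<And>h v. h \<in> H \<Longrightarrow> L (\<rho> h v) = \<rho>' h (L v)" and q: "q \<in> U" and f: "sm f"
  shows "nB (star H \<rho>') i (\<lambda>r. L (f r)) q = L (nB (star H \<rho>) i f q)"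
proof -
  have "L (star H \<rho> (G i q) (f q)) = star H \<rho>' (G i q) (L (f q))"
    by (rule star_equivariant[OF assms(1-3)]) (rule assms(4))
  then show ?thesis
    using d_linear[OF q assms(3) f, of i] by (simp only: nB_def linear_add[OF assms(3)])
qed

context
  fixes \<rho> :: "'n mat \<Rightarrow> 'v::euclidean_space \<Rightarrow> 'v"
  assumes \<rho>: "lie_representation H \<rho>"
begin

abbreviation nr where "nr \<equiv> nB (star H \<rho>)"

lemma bbs: "bounded_bilinear (star H \<rho>)" by (rule bounded_bilinear_star[OF \<rho>])

lemma sm_nr: "sm f \<Longrightarrow> sm (\<lambda>q. nr i f q)" by (rule sm_nB[OF bbs])

lemma sm_N: "sm f \<Longrightarrow> sm (N \<rho> f)"
  by (rule sm_vec) (simp add: N_nth sm_nr)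

lemma nr_commutator:
  "q \<in> U \<Longrightarrow> sm f \<Longrightarrow> nr i (\<lambda>r. nr j f r) q - nr j (\<lambda>r. nr i f r) q - (\<Sum>k\<in>UNIV. c i j k q *\<^sub>R nr k f q)
    = star H \<rho> (R i j q) (f q)"
  by (rule nB_commutator[OF bbs]) (simp_all add: star_bracket[OF \<rho>])

lemma nr_tens:
  assumes q: "q \<in> U" and F: "sm F"
  shows "nB (star H (tens \<rho>)) i F q $ j = nr i (\<lambda>r. F r $ j) q + (\<Sum>l\<in>UNIV. (G i q $ j $ l) *\<^sub>R (F q $ l))"
  unfolding nB_def by (simp add: star_tens[OF \<rho>] pr_hol_id[OF G_lie[OF q]] d_nth[OF q F])

text \<open>The first index is the outer derivative. By skewness of G, the last sum is minus the
  derivative along \<nabla>_i e_j.\<close>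

lemma hessian:
  assumes q: "q \<in> U" and f: "sm f"
  shows "N (tens \<rho>) (N \<rho> f) q $ i $ j = nr i (\<lambda>r. nr j f r) q + (\<Sum>l\<in>UNIV. (G i q $ j $ l) *\<^sub>R nr l f q)"
  using nr_tens[OF q sm_N[OF f], of i j] by (simp add: N_nth)

text \<open>Antisymmetrising the Hessian leaves a first derivative along [e_i, e_j] - \<nabla>_i e_j
  + \<nabla>_j e_i, which is minus the torsion.\<close>

lemma ricci_identity:
  assumes q: "q \<in> U" and f: "sm f"
  shows "N (tens \<rho>) (N \<rho> f) q $ i $ j - N (tens \<rho>) (N \<rho> f) q $ j $ i =
    star H \<rho> (R i j q) (f q) - (\<Sum>l\<in>UNIV. T i j l q *\<^sub>R nr l f q)"
proof -
  have "T i j l q = - (G i q $ j $ l) + G j q $ i $ l - c i j l q" for l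
    using T_eq[OF q, of i j l] G_skew[OF q, of i l j] G_skew[OF q, of j l i] by simp
  then have "(\<Sum>l\<in>UNIV. T i j l q *\<^sub>R nr l f q) = - (\<Sum>l\<in>UNIV. (G i q $ j $ l) *\<^sub>R nr l f q)
     + (\<Sum>l\<in>UNIV. (G j q $ i $ l) *\<^sub>R nr l f q) - (\<Sum>l\<in>UNIV. c i j l q *\<^sub>R nr l f q)"
    by (simp add: scaleR_diff_left scaleR_add_left sum_subtractf sum.distrib sum_negf)
  then show ?thesis
    unfolding hessian[OF q f] nr_commutator[OF q f, symmetric] by (simp add: algebra_simps)
qed

lemma sm_hess: "sm f \<Longrightarrow> sm (N (tens \<rho>) (N \<rho> f))"
  by (rule sm_vec) (simp add: N_nth sm_nB[OF bounded_bilinear_star[OF tens_representation[OF \<rho>]] sm_N])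

text \<open>The Leibniz rule for an endomorphism field X acting on f. It is used with X the
  curvature and with X a constant bivector, for which only the commutator with G remains.\<close>

lemma nr_curvature:
  assumes q: "q \<in> U" and f: "sm f" and X: "sm X"
  shows "nr m (\<lambda>r. star H \<rho> (X r) (f r)) q =
    star H \<rho> (d m X q + G m q ** X q - X q ** G m q) (f q) + star H \<rho> (X q) (nr m f q)"
proof -
  interpret s: bounded_bilinear "star H \<rho>" by (rule bbs)
  have "star H \<rho> (d m X q + G m q ** X q - X q ** G m q) (f q) =
    star H \<rho> (d m X q) (f q) + star H \<rho> (G m q ** X q - X q ** G m q) (f q)"
    by (simp add: s.add_left s.diff_left)
  then show ?thesis
    unfolding nB_def star_bracket[OF \<rho> G_lie[OF q]]
    by (simp add: d_bilinear[OF q bbs X f] s.add_right)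
qed

end

context
  fixes \<rho> :: "'n mat \<Rightarrow> 'v::euclidean_space \<Rightarrow> 'v"
  assumes \<rho>: "lie_representation H \<rho>"
begin

abbreviation N3 where "N3 f q \<equiv> N (tens (tens \<rho>)) (N (tens \<rho>) (N \<rho> f)) q"
abbreviation N2 where "N2 f q \<equiv> N (tens \<rho>) (N \<rho> f) q"
abbreviation nr' where "nr' \<equiv> nB (star H \<rho>)"

section \<open>Third covariant derivatives\<close>

lemma third_derivative:
  assumes q: "q \<in> U" and f: "sm f"
  shows "N3 f q $ m $ i $ j = nr' m (\<lambda>r. N2 f r $ i $ j) q
     + (\<Sum>l\<in>UNIV. (G m q $ j $ l) *\<^sub>R (N2 f q $ i $ l)) + (\<Sum>l\<in>UNIV. (G m q $ i $ l) *\<^sub>R (N2 f q $ l $ j))"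
proof -
  have "N3 f q $ m $ i = nB (star H (tens \<rho>)) m (\<lambda>r. N2 f r $ i) q + (\<Sum>l\<in>UNIV. (G m q $ i $ l) *\<^sub>R (N2 f q $ l))"
    unfolding N_nth[of "tens (tens \<rho>)"] by (rule nr_tens[OF tens_representation[OF \<rho>] q sm_hess[OF \<rho> f]])
  then show ?thesis
    using nr_tens[OF \<rho> q sm_nth[OF sm_hess[OF \<rho> f]], of m i j] by simp
qed

text \<open>The Ricci identity for the T \<otimes> V-valued function \<open>N \<rho> f\<close>, so
  the curvature acts both on the value and on the index k.\<close>

lemma ricci_outer:
  assumes q: "q \<in> U" and f: "sm f"
  shows "N3 f q $ i $ j $ k - N3 f q $ j $ i $ k = star H \<rho> (R i j q) (N \<rho> f q $ k)
     + (\<Sum>l\<in>UNIV. (R i j q $ k $ l) *\<^sub>R (N \<rho> f q $ l)) - (\<Sum>l\<in>UNIV. T i j l q *\<^sub>R (N2 f q $ l $ k))"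
proof -
  have "(N3 f q $ i $ j - N3 f q $ j $ i) $ k =
    (star H (tens \<rho>) (R i j q) (N \<rho> f q) - (\<Sum>l\<in>UNIV. T i j l q *\<^sub>R nB (star H (tens \<rho>)) l (N \<rho> f) q)) $ k"
    unfolding ricci_identity[OF tens_representation[OF \<rho>] q sm_N[OF \<rho> f]] by (rule refl)
  then show ?thesis
    by (simp add: star_tens[OF \<rho>] pr_hol_id[OF R_lie[OF q]] N_nth[of "tens \<rho>"])
qed

text \<open>Here the Ricci identity itself is differentiated covariantly. Differentiating R produces
  \<nabla>R; differentiating T produces nothing, as the torsion is parallel.\<close>

lemma ricci_inner:
  assumes q: "q \<in> U" and f: "sm f"
  shows "N3 f q $ m $ i $ j - N3 f q $ m $ j $ i = star H \<rho> (DR m i j q) (f q)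
     + star H \<rho> (R i j q) (N \<rho> f q $ m) - (\<Sum>l\<in>UNIV. T i j l q *\<^sub>R (N2 f q $ m $ l))"
proof -
  interpret s: bounded_bilinear "star H \<rho>" by (rule bounded_bilinear_star[OF \<rho>])
  note bbs = bounded_bilinear_star[OF \<rho>]
  define Rf where "Rf i j r = star H \<rho> (R i j r) (f r)" for i j r
  define Tf where "Tf i j r = (\<Sum>l\<in>UNIV. T i j l r *\<^sub>R nr' l f r)" for i j r
  have sRf: "sm (\<lambda>r. Rf i j r)" for i j unfolding Rf_def by (rule smooth_fun_bilinear[OF bbs sm_R f])
  have sTl: "sm (\<lambda>r. T i j l r *\<^sub>R nr' l f r)" for i j l by (rule sm_scaleR[OF sm_T sm_nr[OF \<rho> f]])
  have sTf: "sm (\<lambda>r. Tf i j r)" for i j unfolding Tf_def by (rule sm_sum[OF sTl])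
  have A: "N2 f r $ i $ j - N2 f r $ j $ i = Rf i j r - Tf i j r" if "r \<in> U" for i j r
    unfolding Rf_def Tf_def by (rule ricci_identity[OF \<rho> that f])
  have s2: "sm (\<lambda>r. N2 f r $ i $ j)" for i j by (intro sm_nth sm_hess[OF \<rho> f])
  have "nr' m (\<lambda>r. N2 f r $ i $ j) q - nr' m (\<lambda>r. N2 f r $ j $ i) q = nr' m (\<lambda>r. N2 f r $ i $ j - N2 f r $ j $ i) q"
    by (rule nB_diff[OF bbs q s2 s2, symmetric])
  also have "\<dots> = nr' m (\<lambda>r. Rf i j r - Tf i j r) q" by (rule nB_cong[OF q sm_diff[OF s2 s2] A])
  also have "\<dots> = nr' m (\<lambda>r. Rf i j r) q - nr' m (\<lambda>r. Tf i j r) q" by (rule nB_diff[OF bbs q sRf sTf])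
  finally have 1: "nr' m (\<lambda>r. N2 f r $ i $ j) q - nr' m (\<lambda>r. N2 f r $ j $ i) q =
     nr' m (\<lambda>r. Rf i j r) q - nr' m (\<lambda>r. Tf i j r) q" .
  have 2: "(\<Sum>l\<in>UNIV. (G m q $ j $ l) *\<^sub>R (N2 f q $ i $ l)) - (\<Sum>l\<in>UNIV. (G m q $ j $ l) *\<^sub>R (N2 f q $ l $ i)) =
     (\<Sum>l\<in>UNIV. (G m q $ j $ l) *\<^sub>R Rf i l q) - (\<Sum>l\<in>UNIV. (G m q $ j $ l) *\<^sub>R Tf i l q)"
    by (simp only: sum_subtractf[symmetric] scaleR_diff_right[symmetric] A[OF q])
  have 3: "(\<Sum>l\<in>UNIV. (G m q $ i $ l) *\<^sub>R (N2 f q $ l $ j)) - (\<Sum>l\<in>UNIV. (G m q $ i $ l) *\<^sub>R (N2 f q $ j $ l)) =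
     (\<Sum>l\<in>UNIV. (G m q $ i $ l) *\<^sub>R Rf l j q) - (\<Sum>l\<in>UNIV. (G m q $ i $ l) *\<^sub>R Tf l j q)"
    by (simp only: sum_subtractf[symmetric] scaleR_diff_right[symmetric] A[OF q])
  \<comment> \<open>The corrections for the indices i and j are exactly the two-form corrections
    contained in \<open>DR\<close>.\<close>
  have Rpart: "nr' m (\<lambda>r. Rf i j r) q + (\<Sum>l\<in>UNIV. (G m q $ j $ l) *\<^sub>R Rf i l q) + (\<Sum>l\<in>UNIV. (G m q $ i $ l) *\<^sub>R Rf l j q)
     = star H \<rho> (DR m i j q) (f q) + star H \<rho> (R i j q) (nr' m f q)"
  proof -
    have "(\<Sum>l\<in>UNIV. (G m q $ j $ l) *\<^sub>R Rf i l q) = - star H \<rho> (\<Sum>l\<in>UNIV. (G m q $ l $ j) *\<^sub>R R i l q) (f q)"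
      unfolding G_skew[OF q, of m j] Rf_def by (simp add: s.sum_left s.scaleR_left sum_negf)
    moreover have "(\<Sum>l\<in>UNIV. (G m q $ i $ l) *\<^sub>R Rf l j q) = - star H \<rho> (\<Sum>l\<in>UNIV. (G m q $ l $ i) *\<^sub>R R l j q) (f q)"
      unfolding G_skew[OF q, of m i] Rf_def by (simp add: s.sum_left s.scaleR_left sum_negf)
    ultimately show ?thesis
      unfolding DR_def Rf_def nr_curvature[OF \<rho> q f sm_R] by (simp add: s.diff_left s.add_left)
  qed
  \<comment> \<open>By parallelism, two of the three sums in the derivative of T cancel against the
    index corrections; the third completes the second derivative of f to the Hessian.\<close>
  have Tpart: "nr' m (\<lambda>r. Tf i j r) q + (\<Sum>l\<in>UNIV. (G m q $ j $ l) *\<^sub>R Tf i l q) + (\<Sum>l\<in>UNIV. (G m q $ i $ l) *\<^sub>R Tf l j q)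
     = (\<Sum>l\<in>UNIV. T i j l q *\<^sub>R (N2 f q $ m $ l))"
  proof -
    let ?x = "\<lambda>l. nr' l f q"
    have a: "nr' m (\<lambda>r. Tf i j r) q = (\<Sum>l\<in>UNIV. d m (T i j l) q *\<^sub>R ?x l) + (\<Sum>l\<in>UNIV. T i j l q *\<^sub>R nr' m (\<lambda>r. nr' l f r) q)"
      unfolding Tf_def nB_sum[OF bbs q sTl] nB_scaleR[OF bbs q sm_T sm_nr[OF \<rho> f]] by (rule sum.distrib)
    have b: "(\<Sum>l\<in>UNIV. d m (T i j l) q *\<^sub>R ?x l) =
       (\<Sum>l\<in>UNIV. \<Sum>a\<in>UNIV. (G m q $ a $ i * T a j l q) *\<^sub>R ?x l) +
       (\<Sum>l\<in>UNIV. \<Sum>a\<in>UNIV. (G m q $ a $ j * T i a l q) *\<^sub>R ?x l) +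
       (\<Sum>l\<in>UNIV. \<Sum>a\<in>UNIV. (G m q $ a $ l * T i j a q) *\<^sub>R ?x l)"
      unfolding T_parallel[OF q] by (simp add: scaleR_add_left scaleR_sum_left sum.distrib)
    have c1: "(\<Sum>l\<in>UNIV. (G m q $ j $ l) *\<^sub>R Tf i l q) = - (\<Sum>l\<in>UNIV. \<Sum>a\<in>UNIV. (G m q $ a $ j * T i a l q) *\<^sub>R ?x l)"
      unfolding G_skew[OF q, of m j] Tf_def
      by (subst sum.swap) (simp add: scaleR_sum_right sum_negf)
    have c2: "(\<Sum>l\<in>UNIV. (G m q $ i $ l) *\<^sub>R Tf l j q) = - (\<Sum>l\<in>UNIV. \<Sum>a\<in>UNIV. (G m q $ a $ i * T a j l q) *\<^sub>R ?x l)"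
      unfolding G_skew[OF q, of m i] Tf_def
      by (subst sum.swap) (simp add: scaleR_sum_right sum_negf)
    have c3: "(\<Sum>l\<in>UNIV. \<Sum>a\<in>UNIV. (G m q $ a $ l * T i j a q) *\<^sub>R ?x l) =
        (\<Sum>a\<in>UNIV. T i j a q *\<^sub>R (\<Sum>l\<in>UNIV. (G m q $ a $ l) *\<^sub>R ?x l))"
      by (subst sum.swap) (simp add: scaleR_sum_right mult.commute)
    show ?thesis
      unfolding a b c1 c2 c3 hessian[OF \<rho> q f] scaleR_add_right sum.distrib by simp
  qed
  have "N3 f q $ m $ i $ j - N3 f q $ m $ j $ i =
     (nr' m (\<lambda>r. N2 f r $ i $ j) q - nr' m (\<lambda>r. N2 f r $ j $ i) q) +
     ((\<Sum>l\<in>UNIV. (G m q $ j $ l) *\<^sub>R (N2 f q $ i $ l)) - (\<Sum>l\<in>UNIV. (G m q $ j $ l) *\<^sub>R (N2 f q $ l $ i))) +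
     ((\<Sum>l\<in>UNIV. (G m q $ i $ l) *\<^sub>R (N2 f q $ l $ j)) - (\<Sum>l\<in>UNIV. (G m q $ i $ l) *\<^sub>R (N2 f q $ j $ l)))"
    unfolding third_derivative[OF q f] by (simp add: algebra_simps)
  also have "\<dots> = (nr' m (\<lambda>r. Rf i j r) q + (\<Sum>l\<in>UNIV. (G m q $ j $ l) *\<^sub>R Rf i l q) + (\<Sum>l\<in>UNIV. (G m q $ i $ l) *\<^sub>R Rf l j q))
     - (nr' m (\<lambda>r. Tf i j r) q + (\<Sum>l\<in>UNIV. (G m q $ j $ l) *\<^sub>R Tf i l q) + (\<Sum>l\<in>UNIV. (G m q $ i $ l) *\<^sub>R Tf l j q))"
    unfolding 1 2 3 by (simp add: algebra_simps)
  finally show ?thesis unfolding Rpart Tpart by (simp add: N_nth)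
qed

end

text \<open>Its vanishing says that the cyclic sum of R_{ij} e_k equals that of T(T(e_i, e_j), e_k).
  R enters with a plus sign because \<open>R i j q $ k $ m\<close> is minus the m-th component of
  R_{ij} e_k.\<close>

definition bianchi_defect :: "'n \<Rightarrow> 'n \<Rightarrow> 'n \<Rightarrow> 'm \<Rightarrow> real ^ 'n" where
  "bianchi_defect i j k q = (\<chi> m. R i j q $ k $ m + R j k q $ i $ m + R k i q $ j $ m +
     (\<Sum>l\<in>UNIV. T i j l q * T l k m q + T j k l q * T l i m q + T k i l q * T l j m q))"

text \<open>Comparing the two ways to reorder the third derivatives of a function yields the first Bianchi
  identity.\<close>

lemma bianchi_apply:
  fixes f :: "'m \<Rightarrow> real"
  assumes q: "q \<in> U" and f: "sm f"
  shows "deriv_along (\<sigma> q (bianchi_defect i j k q)) f = 0"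
proof -
  \<comment> \<open>For functions the curvature acts only on the index of the derivative, which
    isolates R on T.\<close>
  define \<rho>0 where "\<rho>0 = (\<lambda>(h :: 'n mat) (v :: real). v)"
  have \<rho>0: "lie_representation H \<rho>0" unfolding \<rho>0_def by (rule lie_representation_trivial)
  have st: "star H \<rho>0 X v = 0" for X v unfolding \<rho>0_def by (rule star_trivial)
  define x where "x i j k = N (tens (tens \<rho>0)) (N (tens \<rho>0) (N \<rho>0 f)) q $ i $ j $ k" for i j k
  define y where "y i j = N (tens \<rho>0) (N \<rho>0 f) q $ i $ j" for i j
  define z where "z i = d i f q" for i
  have z: "nB (star H \<rho>0) i f q = z i" for i by (simp add: nB_def st z_def)
  have 1: "x i j k - x j i k = (\<Sum>l\<in>UNIV. R i j q $ k $ l * z l) - (\<Sum>l\<in>UNIV. T i j l q * y l k)" for i j k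
    using ricci_outer[OF \<rho>0 q f, of i j k] by (simp add: x_def y_def N_nth z st)
  have 2: "x m i j - x m j i = - (\<Sum>l\<in>UNIV. T i j l q * y m l)" for m i j
    using ricci_inner[OF \<rho>0 q f, of m i j] by (simp add: x_def y_def st)
  have 3: "y l k - y k l = - (\<Sum>m\<in>UNIV. T l k m q * z m)" for l k
    using ricci_identity[OF \<rho>0 q f, of l k] by (simp add: y_def z st)
  have 4: "(\<Sum>l\<in>UNIV. T i j l q * y l k) - (\<Sum>l\<in>UNIV. T i j l q * y k l) = - (\<Sum>m\<in>UNIV. (\<Sum>l\<in>UNIV. T i j l q * T l k m q) * z m)" for i j k
  proof -
    have "(\<Sum>l\<in>UNIV. T i j l q * y l k) - (\<Sum>l\<in>UNIV. T i j l q * y k l) = (\<Sum>l\<in>UNIV. T i j l q * (y l k - y k l))"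
      by (simp add: sum_subtractf right_diff_distrib)
    also have "\<dots> = - (\<Sum>l\<in>UNIV. \<Sum>m\<in>UNIV. T i j l q * T l k m q * z m)"
      unfolding 3 by (simp add: sum_distrib_left sum_negf mult.assoc)
    also have "\<dots> = - (\<Sum>m\<in>UNIV. \<Sum>l\<in>UNIV. T i j l q * T l k m q * z m)" by (subst sum.swap) (rule refl)
    finally show ?thesis by (simp add: sum_distrib_right)
  qed
  \<comment> \<open>Three exchanges of the outer pair and three of the inner pair lead once around
    the six orderings of i, j, k, so all third derivatives cancel.\<close>
  have "(\<Sum>l\<in>UNIV. R i j q $ k $ l * z l) + (\<Sum>l\<in>UNIV. R j k q $ i $ l * z l) + (\<Sum>l\<in>UNIV. R k i q $ j $ l * z l) +
     ((\<Sum>m\<in>UNIV. (\<Sum>l\<in>UNIV. T i j l q * T l k m q) * z m) + (\<Sum>m\<in>UNIV. (\<Sum>l\<in>UNIV. T j k l q * T l i m q) * z m) +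
      (\<Sum>m\<in>UNIV. (\<Sum>l\<in>UNIV. T k i l q * T l j m q) * z m)) = 0"
    using 1[of i j k] 1[of j k i] 1[of k i j] 2[of i j k] 2[of j k i] 2[of k i j] 4[of i j k] 4[of j k i] 4[of k i j]
    by linarith
  then have "(\<Sum>m\<in>UNIV. bianchi_defect i j k q $ m * z m) = 0"
    by (simp add: bianchi_defect_def distrib_right sum.distrib)
  then show ?thesis by (simp add: deriv_along_d[OF q] z_def)
qed

text \<open>The defect is a tangent vector annihilating every smooth germ, hence zero.\<close>

lemma bianchi:
  assumes q: "q \<in> U" shows "bianchi_defect i j k q = 0"
proof -
  have z: "\<sigma> q 0 = (\<lambda>f. 0)" using frame_scale[OF frame[OF q], of 0 0] by simp
  have "\<sigma> q (bianchi_defect i j k q) = (\<lambda>f. 0)"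
  proof (rule tangent_eqI[OF tan[OF q] tangent_zero[OF frame[OF q]]])
    fix f :: "'m \<Rightarrow> real" assume "smooth_at A q f"
    then obtain W where W: "q \<in> W" "smooth_fun A W f" unfolding smooth_at_def by blast
    have o: "open (U \<inter> W)" using U smooth_fun_open[OF W(2)] by auto
    interpret r: gauge A g nab H P "U \<inter> W" \<sigma> by (rule restrict_gauge[OF o]) auto
    show "\<sigma> q (bianchi_defect i j k q) f = 0"
      using r.bianchi_apply[OF _ smooth_fun_subset[OF W(2) o]] q W(1) by (simp add: deriv_along_real)
  qed
  then have "\<sigma> q (bianchi_defect i j k q) = \<sigma> q 0" using z by simp
  then show ?thesis using frame_inj[OF frame[OF q]] by (simp add: inj_eq)
qed

text \<open>The comparison tensor D is g(T(e_i, e_j), T(e_k, e_m)), visibly pair symmetric. Total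
  skewness of the torsion rewrites the quadratic terms of the Bianchi identity as its cyclic
  sum.\<close>

lemma R_pair_symmetry:
  assumes q: "q \<in> U" shows "R i j q $ k $ m = R k m q $ i $ j"
proof (rule curvature_pair_symmetry[where r="\<lambda>i j k m. R i j q $ k $ m" and D="\<lambda>i j k m. \<Sum>l\<in>UNIV. T i j l q * T k m l q"])
  have t: "T l k m q = T k m l q" for l k m
    using T_skew(1)[OF q, of k l m] T_skew(2)[OF q, of k l m] by simp
  show "R i j q $ k $ m = - R j i q $ k $ m" for i j k m using R_antisym[OF q, of i j] by simp
  show "R i j q $ k $ m = - R i j q $ m $ k" for i j k m by (rule R_skew[OF q])
  show "(\<Sum>l\<in>UNIV. T i j l q * T k m l q) = - (\<Sum>l\<in>UNIV. T j i l q * T k m l q)" for i j k m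
    unfolding T_skew(1)[OF q, of i j] by (simp add: sum_negf)
  show "(\<Sum>l\<in>UNIV. T i j l q * T k m l q) = - (\<Sum>l\<in>UNIV. T i j l q * T m k l q)" for i j k m
    unfolding T_skew(1)[OF q, of k m] by (simp add: sum_negf)
  show "(\<Sum>l\<in>UNIV. T i j l q * T k m l q) = (\<Sum>l\<in>UNIV. T k m l q * T i j l q)" for i j k m
    by (simp add: mult.commute)
  show "R i j q $ k $ m + R j k q $ i $ m + R k i q $ j $ m =
     - ((\<Sum>l\<in>UNIV. T i j l q * T k m l q) + (\<Sum>l\<in>UNIV. T j k l q * T i m l q) + (\<Sum>l\<in>UNIV. T k i l q * T j m l q))" for i j k m
  proof -
    have "bianchi_defect i j k q $ m = 0" using bianchi[OF q] by simp
    then show ?thesis by (simp add: bianchi_defect_def sum.distrib t[of _ k m] t[of _ i m] t[of _ j m])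
  qed
qed

section \<open>The curvature endomorphism q(R)\<close>

lemma sum_R_E:
  assumes q: "q \<in> U" and B: "bilinear B"
  shows "(\<Sum>\<mu>\<in>UNIV. \<Sum>\<nu>\<in>UNIV. B (R \<mu> \<nu> q) (E \<mu> \<nu>)) = (\<Sum>\<mu>\<in>UNIV. \<Sum>\<nu>\<in>UNIV. B (E \<mu> \<nu>) (R \<mu> \<nu> q))"
  by (rule sum_pair_symmetric_swap[OF B R_skew[OF q] R_pair_symmetry[OF q]])

text \<open>As \<open>R\<close> is a symmetric operator on bivectors with values in \<open>hol\<close>, it vanishes on the
  orthogonal complement of \<open>hol\<close>, so the projection can be dropped.\<close>

lemma sum_pr_E_R:
  assumes q: "q \<in> U" and B: "bilinear B"
  shows "(\<Sum>\<mu>\<in>UNIV. \<Sum>\<nu>\<in>UNIV. B (pr_hol H (E \<mu> \<nu>)) (R \<mu> \<nu> q)) = (\<Sum>\<mu>\<in>UNIV. \<Sum>\<nu>\<in>UNIV. B (E \<mu> \<nu>) (R \<mu> \<nu> q))"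
proof -
  have B': "bilinear (\<lambda>X. B (pr_hol H X))"
    using B linear_compose[OF linear_pr_hol] unfolding bilinear_def by (auto simp: comp_def)
  have "(\<Sum>\<mu>\<in>UNIV. \<Sum>\<nu>\<in>UNIV. B (pr_hol H (E \<mu> \<nu>)) (R \<mu> \<nu> q)) = (\<Sum>\<mu>\<in>UNIV. \<Sum>\<nu>\<in>UNIV. B (pr_hol H (R \<mu> \<nu> q)) (E \<mu> \<nu>))"
    by (rule sum_R_E[OF q B', symmetric])
  then show ?thesis by (simp add: pr_hol_id[OF R_lie[OF q]] sum_R_E[OF q B])
qed

text \<open>This is q(R) read in the gauge; the projection to the holonomy algebra is hidden in
  \<open>star\<close>.\<close>

definition Q :: "('n mat \<Rightarrow> 'v::euclidean_space \<Rightarrow> 'v) \<Rightarrow> 'v \<Rightarrow> 'm \<Rightarrow> 'v" where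
  "Q \<rho> v q = (1/2) *\<^sub>R (\<Sum>\<mu>\<in>UNIV. \<Sum>\<nu>\<in>UNIV. star H \<rho> (E \<mu> \<nu>) (star H \<rho> (R \<mu> \<nu> q) v))"

text \<open>Both E and R act by the Leibniz rule on T \<otimes> V. The two cross terms coincide by
  pair symmetry, whence the factor 2; the last sum, where both act on T, is a Ricci
  contraction.\<close>

lemma Q_tens:
  assumes \<rho>: "lie_representation H \<rho>" and q: "q \<in> U"
  shows "Q (tens \<rho>) F q $ k = Q \<rho> (F $ k) q + 2 *\<^sub>R (\<Sum>i\<in>UNIV. star H \<rho> (R i k q) (F $ i))
    + (\<Sum>i\<in>UNIV. \<Sum>m\<in>UNIV. (R i k q $ i $ m) *\<^sub>R (F $ m))"
proof -
  interpret s: bounded_bilinear "star H \<rho>" by (rule bounded_bilinear_star[OF \<rho>])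
  let ?S = "\<lambda>x. \<Sum>\<mu>\<in>UNIV. \<Sum>\<nu>\<in>UNIV. x \<mu> \<nu>"
  let ?Y = "\<Sum>i\<in>UNIV. star H \<rho> (R i k q) (F $ i)"
  \<comment> \<open>\<open>B\<close> records a cross term and \<open>B2\<close> the term with both
    actions on T, as bilinear maps to which the symmetry of R and the removal of the projection
    apply.\<close>
  define B where "B l X Y = (X $ k $ l) *\<^sub>R star H \<rho> Y (F $ l)" for l X Y
  have B: "bilinear (B l)" for l
    unfolding B_def bilinear_def by (auto intro!: linearI simp: s.add_left s.scaleR_left scaleR_add_left scaleR_add_right)
  define B2 where "B2 X Y = (\<Sum>l\<in>UNIV. \<Sum>m\<in>UNIV. (X $ k $ l) *\<^sub>R (Y $ l $ m) *\<^sub>R (F $ m))" for X Y :: "'n mat"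
  have B2: "bilinear B2"
    unfolding B2_def bilinear_def
    by (auto intro!: linearI simp: scaleR_add_left scaleR_add_right sum.distrib scaleR_sum_right distrib_left mult_ac)
  have tm: "star H (tens \<rho>) (E \<mu> \<nu>) (star H (tens \<rho>) (R \<mu> \<nu> q) F) $ k =
      star H \<rho> (E \<mu> \<nu>) (star H \<rho> (R \<mu> \<nu> q) (F $ k)) + (\<Sum>l\<in>UNIV. B l (R \<mu> \<nu> q) (E \<mu> \<nu>)) +
      (\<Sum>l\<in>UNIV. B l (pr_hol H (E \<mu> \<nu>)) (R \<mu> \<nu> q)) + B2 (pr_hol H (E \<mu> \<nu>)) (R \<mu> \<nu> q)" for \<mu> \<nu>
    by (simp add: star_tens[OF \<rho>] pr_hol_id[OF R_lie[OF q]] s.add_right s.sum_right s.scaleR_right B_def B2_def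
        scaleR_add_right sum.distrib scaleR_sum_right)
  have swap: "?S (\<lambda>\<mu> \<nu>. \<Sum>l\<in>UNIV. x l \<mu> \<nu>) = (\<Sum>l\<in>UNIV. ?S (x l))" for x :: "'n \<Rightarrow> 'n \<Rightarrow> 'n \<Rightarrow> 'a"
    by (subst sum.swap[of _ _ "UNIV :: 'n set", symmetric]) (intro sum.cong refl sum.swap)
  have e1: "?S (\<lambda>\<mu> \<nu>. B l (E \<mu> \<nu>) (R \<mu> \<nu> q)) = 2 *\<^sub>R star H \<rho> (R l k q) (F $ l)" for l
    unfolding B_def sum_E R_antisym[OF q, of l k] s.minus_left by (simp add: scaleR_2)
  have b: "?S (\<lambda>\<mu> \<nu>. \<Sum>l\<in>UNIV. B l (R \<mu> \<nu> q) (E \<mu> \<nu>)) = (\<Sum>l\<in>UNIV. 2 *\<^sub>R star H \<rho> (R l k q) (F $ l))"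
    "?S (\<lambda>\<mu> \<nu>. \<Sum>l\<in>UNIV. B l (pr_hol H (E \<mu> \<nu>)) (R \<mu> \<nu> q)) = (\<Sum>l\<in>UNIV. 2 *\<^sub>R star H \<rho> (R l k q) (F $ l))"
    by (rule trans[OF swap], simp only: sum_R_E[OF q B] sum_pr_E_R[OF q B] e1)+
  have c: "?S (\<lambda>\<mu> \<nu>. B2 (pr_hol H (E \<mu> \<nu>)) (R \<mu> \<nu> q)) = 2 *\<^sub>R (\<Sum>l\<in>UNIV. \<Sum>m\<in>UNIV. (R l k q $ l $ m) *\<^sub>R (F $ m))"
  proof -
    have "?S (\<lambda>\<mu> \<nu>. B2 (pr_hol H (E \<mu> \<nu>)) (R \<mu> \<nu> q)) = ?S (\<lambda>\<mu> \<nu>. B2 (E \<mu> \<nu>) (R \<mu> \<nu> q))"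
      by (rule sum_pr_E_R[OF q B2])
    also have "\<dots> = (\<Sum>l\<in>UNIV. ?S (\<lambda>\<mu> \<nu>. (E \<mu> \<nu> $ k $ l) *\<^sub>R (\<Sum>m\<in>UNIV. (R \<mu> \<nu> q $ l $ m) *\<^sub>R (F $ m))))"
      unfolding B2_def scaleR_sum_right by (rule swap)
    also have "\<dots> = (\<Sum>l\<in>UNIV. (\<Sum>m\<in>UNIV. (R l k q $ l $ m) *\<^sub>R (F $ m)) - (\<Sum>m\<in>UNIV. (R k l q $ l $ m) *\<^sub>R (F $ m)))"
      unfolding sum_E by (rule refl)
    also have "\<dots> = (\<Sum>l\<in>UNIV. 2 *\<^sub>R (\<Sum>m\<in>UNIV. (R l k q $ l $ m) *\<^sub>R (F $ m)))"
    proof (intro sum.cong refl)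
      fix l
      show "(\<Sum>m\<in>UNIV. (R l k q $ l $ m) *\<^sub>R (F $ m)) - (\<Sum>m\<in>UNIV. (R k l q $ l $ m) *\<^sub>R (F $ m)) =
        2 *\<^sub>R (\<Sum>m\<in>UNIV. (R l k q $ l $ m) *\<^sub>R (F $ m))"
        unfolding R_antisym[OF q, of l k] by (simp add: sum_negf scaleR_2)
    qed
    finally show ?thesis by (simp add: scaleR_sum_right)
  qed
  have "Q (tens \<rho>) F q $ k = (1/2) *\<^sub>R ?S (\<lambda>\<mu> \<nu>. star H (tens \<rho>) (E \<mu> \<nu>) (star H (tens \<rho>) (R \<mu> \<nu> q) F) $ k)"
    by (simp add: Q_def)
  also have "\<dots> = (1/2) *\<^sub>R ?S (\<lambda>\<mu> \<nu>. star H \<rho> (E \<mu> \<nu>) (star H \<rho> (R \<mu> \<nu> q) (F $ k))) +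
     (1/2) *\<^sub>R ?S (\<lambda>\<mu> \<nu>. \<Sum>l\<in>UNIV. B l (R \<mu> \<nu> q) (E \<mu> \<nu>)) +
     (1/2) *\<^sub>R ?S (\<lambda>\<mu> \<nu>. \<Sum>l\<in>UNIV. B l (pr_hol H (E \<mu> \<nu>)) (R \<mu> \<nu> q)) +
     (1/2) *\<^sub>R ?S (\<lambda>\<mu> \<nu>. B2 (pr_hol H (E \<mu> \<nu>)) (R \<mu> \<nu> q))"
    unfolding tm sum.distrib scaleR_add_right by (rule refl)
  finally have "Q (tens \<rho>) F q $ k = Q \<rho> (F $ k) q + ?Y + ?Y + (\<Sum>l\<in>UNIV. \<Sum>m\<in>UNIV. (R l k q $ l $ m) *\<^sub>R (F $ m))"
    unfolding b c Q_def scaleR_sum_right[symmetric] by simp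
  then show ?thesis by (simp add: scaleR_2)
qed

lemma sm_Q:
  assumes \<rho>: "lie_representation H \<rho>" and f: "sm f"
  shows "sm (\<lambda>r. Q \<rho> (f r) r)"
  unfolding Q_def
  by (intro smooth_fun_bounded_linear[OF bounded_linear_scaleR_right] sm_sum
      smooth_fun_bilinear[OF bounded_bilinear_star[OF \<rho>] sm_const]
      smooth_fun_bilinear[OF bounded_bilinear_star[OF \<rho>] sm_R f])

text \<open>The E are constant in the gauge but not parallel. Their commutators with G, moved onto
  the indices of R, are exactly the terms missing from \<nabla>R, so q(R) is differentiated as if
  only R varied.\<close>

lemma Q_derivative:
  assumes \<rho>: "lie_representation H \<rho>" and q: "q \<in> U" and f: "sm f"
  shows "nB (star H \<rho>) k (\<lambda>r. Q \<rho> (f r) r) q =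
    (1/2) *\<^sub>R (\<Sum>\<mu>\<in>UNIV. \<Sum>\<nu>\<in>UNIV. star H \<rho> (E \<mu> \<nu>) (star H \<rho> (DR k \<mu> \<nu> q) (f q))) + Q \<rho> (nB (star H \<rho>) k f q) q"
proof -
  interpret s: bounded_bilinear "star H \<rho>" by (rule bounded_bilinear_star[OF \<rho>])
  note bbs = bounded_bilinear_star[OF \<rho>]
  let ?S = "\<lambda>x. \<Sum>\<mu>\<in>UNIV. \<Sum>\<nu>\<in>UNIV. x \<mu> \<nu>"
  let ?s = "star H \<rho>"
  have sR: "sm (\<lambda>r. ?s (R \<mu> \<nu> r) (f r))" for \<mu> \<nu> by (rule smooth_fun_bilinear[OF bbs sm_R f])
  have sE: "sm (\<lambda>r. ?s (E \<mu> \<nu>) (?s (R \<mu> \<nu> r) (f r)))" for \<mu> \<nu> by (rule smooth_fun_bilinear[OF bbs sm_const sR])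
  have sES: "sm (\<lambda>r. ?S (\<lambda>\<mu> \<nu>. ?s (E \<mu> \<nu>) (?s (R \<mu> \<nu> r) (f r))))" by (intro sm_sum sE)
  let ?D = "\<lambda>\<mu> \<nu>. d k (R \<mu> \<nu>) q + G k q ** R \<mu> \<nu> q - R \<mu> \<nu> q ** G k q"
  let ?C = "\<lambda>\<mu> \<nu>. G k q ** E \<mu> \<nu> - E \<mu> \<nu> ** G k q"
  let ?n = "nB (star H \<rho>) k f q"
  have one: "nB (star H \<rho>) k (\<lambda>r. ?s (E \<mu> \<nu>) (?s (R \<mu> \<nu> r) (f r))) q =
     ?s (?C \<mu> \<nu>) (?s (R \<mu> \<nu> q) (f q)) + ?s (E \<mu> \<nu>) (?s (?D \<mu> \<nu>) (f q)) + ?s (E \<mu> \<nu>) (?s (R \<mu> \<nu> q) ?n)" for \<mu> \<nu>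
    unfolding nr_curvature[OF \<rho> q sR sm_const] nr_curvature[OF \<rho> q f sm_R] d_const[OF q] s.add_right by simp
  \<comment> \<open>The derivation property of bivectors, relabelling of the summation indices and
    skewness of G move the correction from E to R.\<close>
  have C: "?S (\<lambda>\<mu> \<nu>. ?s (?C \<mu> \<nu>) (?s (R \<mu> \<nu> q) (f q))) =
     - ?S (\<lambda>\<mu> \<nu>. ?s (E \<mu> \<nu>) (?s (\<Sum>l\<in>UNIV. (G k q $ l $ \<mu>) *\<^sub>R R l \<nu> q) (f q)))
     - ?S (\<lambda>\<mu> \<nu>. ?s (E \<mu> \<nu>) (?s (\<Sum>l\<in>UNIV. (G k q $ l $ \<nu>) *\<^sub>R R \<mu> l q) (f q)))"
  proof -
    let ?e = "\<lambda>\<mu> \<nu> a b. ?s (E \<mu> \<nu>) (?s (R a b q) (f q))"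
    have "?S (\<lambda>\<mu> \<nu>. ?s (?C \<mu> \<nu>) (?s (R \<mu> \<nu> q) (f q))) =
       ?S (\<lambda>\<mu> \<nu>. \<Sum>l\<in>UNIV. (G k q $ l $ \<mu>) *\<^sub>R ?e l \<nu> \<mu> \<nu>) + ?S (\<lambda>\<mu> \<nu>. \<Sum>l\<in>UNIV. (G k q $ l $ \<nu>) *\<^sub>R ?e \<mu> l \<mu> \<nu>)"
      unfolding skew_E_commutator[OF G_skew[OF q]] s.add_left s.sum_left s.scaleR_left sum.distrib by (rule refl)
    moreover have "?S (\<lambda>\<mu> \<nu>. \<Sum>l\<in>UNIV. (G k q $ l $ \<mu>) *\<^sub>R ?e l \<nu> \<mu> \<nu>) =
       - ?S (\<lambda>\<mu> \<nu>. \<Sum>l\<in>UNIV. (G k q $ l $ \<mu>) *\<^sub>R ?e \<mu> \<nu> l \<nu>)"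
    proof -
      have "?S (\<lambda>\<mu> \<nu>. \<Sum>l\<in>UNIV. (G k q $ l $ \<mu>) *\<^sub>R ?e l \<nu> \<mu> \<nu>) = (\<Sum>\<mu>\<in>UNIV. \<Sum>l\<in>UNIV. \<Sum>\<nu>\<in>UNIV. (G k q $ l $ \<mu>) *\<^sub>R ?e l \<nu> \<mu> \<nu>)"
        by (intro sum.cong refl sum.swap)
      also have "\<dots> = (\<Sum>l\<in>UNIV. \<Sum>\<mu>\<in>UNIV. \<Sum>\<nu>\<in>UNIV. (G k q $ l $ \<mu>) *\<^sub>R ?e l \<nu> \<mu> \<nu>)" by (rule sum.swap)
      also have "\<dots> = (\<Sum>l\<in>UNIV. \<Sum>\<nu>\<in>UNIV. \<Sum>\<mu>\<in>UNIV. (G k q $ l $ \<mu>) *\<^sub>R ?e l \<nu> \<mu> \<nu>)" by (intro sum.cong refl sum.swap)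
      also have "\<dots> = (\<Sum>l\<in>UNIV. \<Sum>\<nu>\<in>UNIV. \<Sum>\<mu>\<in>UNIV. - ((G k q $ \<mu> $ l) *\<^sub>R ?e l \<nu> \<mu> \<nu>))"
      proof (intro sum.cong refl)
        fix l \<nu> \<mu> show "(G k q $ l $ \<mu>) *\<^sub>R ?e l \<nu> \<mu> \<nu> = - ((G k q $ \<mu> $ l) *\<^sub>R ?e l \<nu> \<mu> \<nu>)"
          by (subst G_skew[OF q]) simp
      qed
      finally show ?thesis by (simp add: sum_negf)
    qed
    moreover have "?S (\<lambda>\<mu> \<nu>. \<Sum>l\<in>UNIV. (G k q $ l $ \<nu>) *\<^sub>R ?e \<mu> l \<mu> \<nu>) =
       - ?S (\<lambda>\<mu> \<nu>. \<Sum>l\<in>UNIV. (G k q $ l $ \<nu>) *\<^sub>R ?e \<mu> \<nu> \<mu> l)"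
    proof -
      have "?S (\<lambda>\<mu> \<nu>. \<Sum>l\<in>UNIV. (G k q $ l $ \<nu>) *\<^sub>R ?e \<mu> l \<mu> \<nu>) = (\<Sum>\<mu>\<in>UNIV. \<Sum>l\<in>UNIV. \<Sum>\<nu>\<in>UNIV. (G k q $ l $ \<nu>) *\<^sub>R ?e \<mu> l \<mu> \<nu>)"
        by (intro sum.cong refl sum.swap)
      also have "\<dots> = (\<Sum>\<mu>\<in>UNIV. \<Sum>l\<in>UNIV. \<Sum>\<nu>\<in>UNIV. - ((G k q $ \<nu> $ l) *\<^sub>R ?e \<mu> l \<mu> \<nu>))"
      proof (intro sum.cong refl)
        fix l \<nu> \<mu> show "(G k q $ l $ \<nu>) *\<^sub>R ?e \<mu> l \<mu> \<nu> = - ((G k q $ \<nu> $ l) *\<^sub>R ?e \<mu> l \<mu> \<nu>)"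
          by (subst G_skew[OF q]) simp
      qed
      finally show ?thesis by (simp add: sum_negf)
    qed
    ultimately show ?thesis by (simp add: s.sum_left s.scaleR_left s.sum_right s.scaleR_right)
  qed
  have "nB (star H \<rho>) k (\<lambda>r. Q \<rho> (f r) r) q = (1/2) *\<^sub>R nB (star H \<rho>) k (\<lambda>r. ?S (\<lambda>\<mu> \<nu>. ?s (E \<mu> \<nu>) (?s (R \<mu> \<nu> r) (f r)))) q"
    unfolding Q_def using nB_scaleR[OF bbs q sm_const sES, of k "1/2"] d_const[OF q, of k "1/2 :: real"] by simp
  also have "\<dots> = (1/2) *\<^sub>R ?S (\<lambda>\<mu> \<nu>. nB (star H \<rho>) k (\<lambda>r. ?s (E \<mu> \<nu>) (?s (R \<mu> \<nu> r) (f r))) q)"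
    by (simp add: nB_sum[OF bbs q] sm_sum sE)
  also have "\<dots> = (1/2) *\<^sub>R (?S (\<lambda>\<mu> \<nu>. ?s (?C \<mu> \<nu>) (?s (R \<mu> \<nu> q) (f q))) + ?S (\<lambda>\<mu> \<nu>. ?s (E \<mu> \<nu>) (?s (?D \<mu> \<nu>) (f q)))) + Q \<rho> ?n q"
    unfolding one sum.distrib scaleR_add_right Q_def by (rule refl)
  also have "?S (\<lambda>\<mu> \<nu>. ?s (?C \<mu> \<nu>) (?s (R \<mu> \<nu> q) (f q))) + ?S (\<lambda>\<mu> \<nu>. ?s (E \<mu> \<nu>) (?s (?D \<mu> \<nu>) (f q))) =
      ?S (\<lambda>\<mu> \<nu>. ?s (E \<mu> \<nu>) (?s (DR k \<mu> \<nu> q) (f q)))"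
    unfolding C DR_def s.diff_left[of _ "\<Sum>l\<in>UNIV. F l" for F] s.diff_right sum_subtractf by simp
  finally show ?thesis .
qed

section \<open>The commutator of the Laplacian with the covariant differential\<close>

definition Lap :: "('n mat \<Rightarrow> 'v::euclidean_space \<Rightarrow> 'v) \<Rightarrow> ('m \<Rightarrow> 'v) \<Rightarrow> 'm \<Rightarrow> 'v" where
  "Lap \<rho> f q = - (\<Sum>i\<in>UNIV. N (tens \<rho>) (N \<rho> f) q $ i $ i) + Q \<rho> (f q) q"

lemma sm_Lap:
  assumes \<rho>: "lie_representation H \<rho>" and f: "sm f" shows "sm (Lap \<rho> f)"
  unfolding Lap_def[abs_def] by (intro sm_add sm_minus sm_sum sm_nth sm_hess[OF \<rho> f] sm_Q[OF \<rho> f])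

text \<open>In the third derivative the free index k is moved from the innermost to the outermost
  place. The curvature terms so created are those by which q(R) on T \<otimes> V exceeds q(R) on V,
  and only terms with \<nabla>R survive.\<close>

lemma Lap_nabla_commutator:
  assumes \<rho>: "lie_representation H \<rho>" and q: "q \<in> U" and f: "sm f"
  shows "Lap (tens \<rho>) (N \<rho> f) q $ k - nB (star H \<rho>) k (Lap \<rho> f) q =
    - (\<Sum>i\<in>UNIV. star H \<rho> (DR i i k q) (f q))
    - (1/2) *\<^sub>R (\<Sum>\<mu>\<in>UNIV. \<Sum>\<nu>\<in>UNIV. star H \<rho> (E \<mu> \<nu>) (star H \<rho> (DR k \<mu> \<nu> q) (f q)))"
proof -
  note bbs = bounded_bilinear_star[OF \<rho>]
  let ?n = "nB (star H \<rho>)"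
  let ?N2 = "\<lambda>r. N (tens \<rho>) (N \<rho> f) r" and ?N3 = "N (tens (tens \<rho>)) (N (tens \<rho>) (N \<rho> f)) q"
  have s2: "sm (\<lambda>r. ?N2 r $ i $ i)" for i by (intro sm_nth sm_hess[OF \<rho> f])
  \<comment> \<open>The trace commutes with covariant differentiation because G is skew, that is,
    because the connection is metric.\<close>
  have trace: "(\<Sum>i\<in>UNIV. ?n k (\<lambda>r. ?N2 r $ i $ i) q) = (\<Sum>i\<in>UNIV. ?N3 $ k $ i $ i)"
  proof -
    have "(\<Sum>i\<in>UNIV. \<Sum>l\<in>UNIV. (G k q $ i $ l) *\<^sub>R (?N2 q $ l $ i)) = (\<Sum>i\<in>UNIV. \<Sum>l\<in>UNIV. (G k q $ l $ i) *\<^sub>R (?N2 q $ i $ l))"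
      by (rule sum.swap)
    also have "\<dots> = (\<Sum>i\<in>UNIV. \<Sum>l\<in>UNIV. - ((G k q $ i $ l) *\<^sub>R (?N2 q $ i $ l)))"
    proof (intro sum.cong refl)
      fix i l show "(G k q $ l $ i) *\<^sub>R (?N2 q $ i $ l) = - ((G k q $ i $ l) *\<^sub>R (?N2 q $ i $ l))"
        by (subst G_skew[OF q]) simp
    qed
    finally show ?thesis unfolding third_derivative[OF \<rho> q f] by (simp add: sum.distrib sum_negf)
  qed
  have "?n k (Lap \<rho> f) q = - (\<Sum>i\<in>UNIV. ?N3 $ k $ i $ i) + ?n k (\<lambda>r. Q \<rho> (f r) r) q"
  proof -
    have "?n k (Lap \<rho> f) q = ?n k (\<lambda>r. Q \<rho> (f r) r - (\<Sum>i\<in>UNIV. ?N2 r $ i $ i)) q"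
      unfolding Lap_def[abs_def] by (simp add: algebra_simps)
    also have "\<dots> = ?n k (\<lambda>r. Q \<rho> (f r) r) q - (\<Sum>i\<in>UNIV. ?n k (\<lambda>r. ?N2 r $ i $ i) q)"
      unfolding nB_diff[OF bbs q sm_Q[OF \<rho> f] sm_sum[OF s2]] nB_sum[OF bbs q s2] by (rule refl)
    finally show ?thesis unfolding trace by simp
  qed
  moreover have "Lap (tens \<rho>) (N \<rho> f) q $ k = - (\<Sum>i\<in>UNIV. ?N3 $ i $ i $ k) + Q (tens \<rho>) (N \<rho> f q) q $ k"
    by (simp add: Lap_def)
  moreover have "(\<Sum>i\<in>UNIV. ?N3 $ i $ i $ k) = (\<Sum>i\<in>UNIV. ?N3 $ k $ i $ i) + (\<Sum>i\<in>UNIV. star H \<rho> (DR i i k q) (f q))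
     + 2 *\<^sub>R (\<Sum>i\<in>UNIV. star H \<rho> (R i k q) (N \<rho> f q $ i)) + (\<Sum>i\<in>UNIV. \<Sum>l\<in>UNIV. (R i k q $ i $ l) *\<^sub>R (N \<rho> f q $ l))"
  proof -
    \<comment> \<open>The torsion is skew in i and l, so the terms from the inner and the outer
      exchange sum to a contraction with a symmetric tensor.\<close>
    have T: "(\<Sum>i\<in>UNIV. \<Sum>l\<in>UNIV. T i k l q *\<^sub>R (?N2 q $ l $ i)) = - (\<Sum>i\<in>UNIV. \<Sum>l\<in>UNIV. T i k l q *\<^sub>R (?N2 q $ i $ l))"
    proof -
      have t: "T l k i q = - T i k l q" for i l
        using T_skew(2)[OF q, of l i k] T_skew(1)[OF q, of i l k] T_skew(2)[OF q, of i k l] by simp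
      have "(\<Sum>i\<in>UNIV. \<Sum>l\<in>UNIV. T i k l q *\<^sub>R (?N2 q $ l $ i)) = (\<Sum>i\<in>UNIV. \<Sum>l\<in>UNIV. T l k i q *\<^sub>R (?N2 q $ i $ l))"
        by (rule sum.swap)
      also have "\<dots> = (\<Sum>i\<in>UNIV. \<Sum>l\<in>UNIV. - (T i k l q *\<^sub>R (?N2 q $ i $ l)))"
      proof (intro sum.cong refl)
        fix i l show "T l k i q *\<^sub>R (?N2 q $ i $ l) = - (T i k l q *\<^sub>R (?N2 q $ i $ l))" by (subst t) simp
      qed
      finally show ?thesis by (simp add: sum_negf)
    qed
    have "?N3 $ i $ i $ k = ?N3 $ k $ i $ i + star H \<rho> (DR i i k q) (f q) + 2 *\<^sub>R star H \<rho> (R i k q) (N \<rho> f q $ i)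
       + (\<Sum>l\<in>UNIV. (R i k q $ i $ l) *\<^sub>R (N \<rho> f q $ l)) - (\<Sum>l\<in>UNIV. T i k l q *\<^sub>R (?N2 q $ i $ l))
       - (\<Sum>l\<in>UNIV. T i k l q *\<^sub>R (?N2 q $ l $ i))" for i
    proof -
      \<comment> \<open>One inner exchange, then one outer exchange; each contributes one R_{ik}
        \<star> \<nabla>_i f, the outer one also the Ricci contraction.\<close>
      have "?N3 $ i $ i $ k = ?N3 $ k $ i $ i + (?N3 $ i $ i $ k - ?N3 $ i $ k $ i) + (?N3 $ i $ k $ i - ?N3 $ k $ i $ i)"
        by simp
      then show ?thesis unfolding ricci_inner[OF \<rho> q f] ricci_outer[OF \<rho> q f] by (simp add: scaleR_2)
    qed
    then show ?thesis by (simp add: sum.distrib sum_subtractf T scaleR_sum_right)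
  qed
  ultimately show ?thesis
    unfolding Q_tens[OF \<rho> q] Q_derivative[OF \<rho> q f] N_nth[of \<rho> f q, symmetric] by simp
qed

end


section \<open>Commutator with the standard Laplace operator\<close>

lemma wedge_add: "wedge (x + x') y = wedge x y + wedge x' y" "wedge x (y + y') = wedge x y + wedge x y'"
  and wedge_scale: "wedge (a *\<^sub>R x) y = a *\<^sub>R wedge x y" "wedge x (a *\<^sub>R y) = a *\<^sub>R wedge x y"
  by (simp_all add: wedge_def matrix_def vec_eq_iff inner_add_left algebra_simps)

lemma wedge_conj:
  fixes h :: "'n::finite mat"
  shows "wedge (h *v x) (h *v y) = h ** wedge x y ** transpose h"
proof -
  have lin: "linear (\<lambda>z. (x \<bullet> z) *\<^sub>R y - (y \<bullet> z) *\<^sub>R x)" for x y :: "real ^ 'n"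
    by (rule linearI) (simp_all add: inner_add_right algebra_simps)
  have w: "wedge x y *v z = (x \<bullet> z) *\<^sub>R y - (y \<bullet> z) *\<^sub>R x" for x y z :: "real ^ 'n"
    unfolding wedge_def by (rule matrix_apply_linear[OF lin])
  have t: "(h *v x) \<bullet> z = x \<bullet> (transpose h *v z)" for x z
    by (metis dot_lmul_matrix transpose_matrix_vector inner_commute)
  have "wedge (h *v x) (h *v y) *v z = (h ** wedge x y ** transpose h) *v z" for z
    by (simp add: w t matrix_vector_mul_assoc[symmetric] matrix_vector_mult_diff_distrib matrix_vector_mult_scaleR)
  then show ?thesis unfolding matrix_eq by blast
qed

context so_subgroup
begin

text \<open>The contraction of a bilinear map is the same in every orthonormal basis; all
  equivariance statements below reduce to this.\<close>

lemma sum_basis_invariant: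
  fixes B :: "real ^ 'n \<Rightarrow> real ^ 'n \<Rightarrow> 'b::real_vector"
  assumes h: "h \<in> H" and l: "\<And>y. linear (\<lambda>x. B x y)" "\<And>x. linear (B x)"
  shows "(\<Sum>i\<in>UNIV. B (h *v axis i 1) (h *v axis i 1)) = (\<Sum>i\<in>UNIV. B (axis i 1) (axis i 1))"
proof -
  have he: "h *v axis i 1 = (\<Sum>a\<in>UNIV. (h $ a $ i) *\<^sub>R axis a 1)" for i
    using real_vec_expansion[of "h *v axis i 1"] by (simp add: matrix_mult_axis)
  have "(\<Sum>i\<in>UNIV. B (h *v axis i 1) (h *v axis i 1)) =
      (\<Sum>i\<in>UNIV. \<Sum>a\<in>UNIV. \<Sum>b\<in>UNIV. (h $ a $ i * h $ b $ i) *\<^sub>R B (axis b 1) (axis a 1))"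
    unfolding he linear_sum[OF l(1)] linear_sum[OF l(2)] linear_cmul[OF l(1)] linear_cmul[OF l(2)]
    by (simp add: scaleR_sum_right)
  also have "\<dots> = (\<Sum>a\<in>UNIV. \<Sum>i\<in>UNIV. \<Sum>b\<in>UNIV. (h $ a $ i * h $ b $ i) *\<^sub>R B (axis b 1) (axis a 1))"
    by (rule sum.swap)
  also have "\<dots> = (\<Sum>a\<in>UNIV. \<Sum>b\<in>UNIV. \<Sum>i\<in>UNIV. (h $ a $ i * h $ b $ i) *\<^sub>R B (axis b 1) (axis a 1))"
    by (intro sum.cong refl sum.swap)
  also have "\<dots> = (\<Sum>a\<in>UNIV. \<Sum>b\<in>UNIV. (mat 1 $ a $ b) *\<^sub>R B (axis b 1) (axis a 1))"
    unfolding H_transpose_mult(1)[OF h, symmetric] matrix_mult_nth transpose_nth by (simp add: scaleR_sum_left)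
  also have "\<dots> = (\<Sum>a\<in>UNIV. B (axis a 1) (axis a 1))"
    by (simp add: mat_nth if_distrib if_distribR cong: if_cong)
  finally show ?thesis .
qed

lemma sum_basis_invariant2:
  fixes \<Psi> :: "real ^ 'n \<Rightarrow> real ^ 'n \<Rightarrow> real ^ 'n \<Rightarrow> real ^ 'n \<Rightarrow> 'b::real_vector"
  assumes h: "h \<in> H" and l: "\<And>y z w. linear (\<lambda>x. \<Psi> x y z w)" "\<And>x z w. linear (\<lambda>y. \<Psi> x y z w)"
    "\<And>x y w. linear (\<lambda>z. \<Psi> x y z w)" "\<And>x y z. linear (\<lambda>w. \<Psi> x y z w)"
  shows "(\<Sum>i\<in>UNIV. \<Sum>j\<in>UNIV. \<Psi> (h *v axis i 1) (h *v axis i 1) (h *v axis j 1) (h *v axis j 1)) =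
    (\<Sum>i\<in>UNIV. \<Sum>j\<in>UNIV. \<Psi> (axis i 1) (axis i 1) (axis j 1) (axis j 1))"
proof -
  have "(\<Sum>j\<in>UNIV. \<Psi> x y (h *v axis j 1) (h *v axis j 1)) = (\<Sum>j\<in>UNIV. \<Psi> x y (axis j 1) (axis j 1))" for x y
    by (rule sum_basis_invariant[OF h l(3,4)])
  moreover have "(\<Sum>i\<in>UNIV. (\<lambda>x y. \<Sum>j\<in>UNIV. \<Psi> x y (axis j 1) (axis j 1)) (h *v axis i 1) (h *v axis i 1)) =
     (\<Sum>i\<in>UNIV. (\<lambda>x y. \<Sum>j\<in>UNIV. \<Psi> x y (axis j 1) (axis j 1)) (axis i 1) (axis i 1))"
    by (rule sum_basis_invariant[OF h]) (intro linear_compose_sum ballI l)+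
  ultimately show ?thesis by simp
qed

lemma tens_trace:
  assumes \<rho>: "lie_representation H \<rho>" and h: "h \<in> H"
  shows "(\<Sum>i\<in>UNIV. tens (tens \<rho>) h M $ i $ i) = \<rho> h (\<Sum>i\<in>UNIV. M $ i $ i)"
proof -
  note lin = rep_linear[OF \<rho> h]
  have "(\<Sum>i\<in>UNIV. tens (tens \<rho>) h M $ i $ i) =
     (\<Sum>i\<in>UNIV. \<Sum>l\<in>UNIV. \<Sum>m\<in>UNIV. (h $ i $ l * h $ i $ m) *\<^sub>R \<rho> h (M $ l $ m))"
    by (simp add: tens_def scaleR_sum_right)
  also have "\<dots> = (\<Sum>l\<in>UNIV. \<Sum>i\<in>UNIV. \<Sum>m\<in>UNIV. (h $ i $ l * h $ i $ m) *\<^sub>R \<rho> h (M $ l $ m))"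
    by (rule sum.swap)
  also have "\<dots> = (\<Sum>l\<in>UNIV. \<Sum>m\<in>UNIV. \<Sum>i\<in>UNIV. (h $ i $ l * h $ i $ m) *\<^sub>R \<rho> h (M $ l $ m))"
    by (intro sum.cong refl sum.swap)
  also have "\<dots> = (\<Sum>l\<in>UNIV. \<Sum>m\<in>UNIV. (mat 1 $ l $ m) *\<^sub>R \<rho> h (M $ l $ m))"
    unfolding H_transpose_mult(2)[OF h, symmetric] matrix_mult_nth transpose_nth by (simp add: scaleR_sum_left)
  also have "\<dots> = (\<Sum>l\<in>UNIV. \<rho> h (M $ l $ l))"
    by (simp add: mat_nth if_distrib if_distribR cong: if_cong)
  finally show ?thesis by (simp add: linear_sum[OF lin])
qed

lemma star_conj_inverse:
  assumes "lie_representation H \<rho>" "h \<in> H"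
  shows "star H \<rho> (h ** X ** transpose h) v = \<rho> h (star H \<rho> X (\<rho> (transpose h) v))"
  using star_conj[OF assms, of X "\<rho> (transpose h) v"] by (simp add: rep_inverse[OF assms])

text \<open>Here S is the curvature as a bilinear map of two vectors. Writing E through the rotated
  basis lets the group element be pulled out of both actions, and the remaining double contraction
  ignores the rotation.\<close>

lemma curvature_endomorphism_invariant:
  assumes \<rho>: "lie_representation H \<rho>" and h: "h \<in> H"
    and S: "\<And>y. linear (\<lambda>x. S x y)" "\<And>x. linear (S x)"
  shows "(\<Sum>\<mu>\<in>UNIV. \<Sum>\<nu>\<in>UNIV. star H \<rho> (E \<mu> \<nu>) (star H \<rho>
      (transpose h ** S (h *v axis \<mu> 1) (h *v axis \<nu> 1) ** h) (\<rho> (transpose h) v))) =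
    \<rho> (transpose h) (\<Sum>\<mu>\<in>UNIV. \<Sum>\<nu>\<in>UNIV. star H \<rho> (E \<mu> \<nu>) (star H \<rho> (S (axis \<mu> 1) (axis \<nu> 1)) v))"
proof -
  interpret s: bounded_bilinear "star H \<rho>" by (rule bounded_bilinear_star[OF \<rho>])
  note ht = H_transpose[OF h]
  note lin = rep_linear[OF \<rho> ht]
  have c: "star H \<rho> (transpose h ** X ** h) (\<rho> (transpose h) w) = \<rho> (transpose h) (star H \<rho> X w)" for X w
    using star_conj[OF \<rho> ht, of X w] by simp
  have e: "E \<mu> \<nu> = transpose h ** wedge (h *v axis \<mu> 1) (h *v axis \<nu> 1) ** h" for \<mu> \<nu>
    using wedge_conj[of "transpose h" "h *v axis \<mu> 1" "h *v axis \<nu> 1"]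
    by (simp add: E_def matrix_vector_mul_assoc H_transpose_mult[OF h])
  have "(\<Sum>\<mu>\<in>UNIV. \<Sum>\<nu>\<in>UNIV. star H \<rho> (E \<mu> \<nu>) (star H \<rho>
      (transpose h ** S (h *v axis \<mu> 1) (h *v axis \<nu> 1) ** h) (\<rho> (transpose h) v))) =
    \<rho> (transpose h) (\<Sum>\<mu>\<in>UNIV. \<Sum>\<nu>\<in>UNIV. star H \<rho> (wedge (h *v axis \<mu> 1) (h *v axis \<nu> 1))
      (star H \<rho> (S (h *v axis \<mu> 1) (h *v axis \<nu> 1)) v))"
    unfolding c e linear_sum[OF lin] by (rule refl)
  also have "(\<Sum>\<mu>\<in>UNIV. \<Sum>\<nu>\<in>UNIV. star H \<rho> (wedge (h *v axis \<mu> 1) (h *v axis \<nu> 1))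
      (star H \<rho> (S (h *v axis \<mu> 1) (h *v axis \<nu> 1)) v)) =
     (\<Sum>\<mu>\<in>UNIV. \<Sum>\<nu>\<in>UNIV. star H \<rho> (wedge (axis \<mu> 1) (axis \<nu> 1)) (star H \<rho> (S (axis \<mu> 1) (axis \<nu> 1)) v))"
    by (rule sum_basis_invariant2[OF h, of "\<lambda>x y z w. star H \<rho> (wedge x z) (star H \<rho> (S y w) v)"])
      (rule linearI; simp add: wedge_add wedge_scale s.add_left s.add_right s.scaleR_left s.scaleR_right
        linear_add[OF S(1)] linear_add[OF S(2)] linear_cmul[OF S(1)] linear_cmul[OF S(2)])+
  finally show ?thesis by (simp only: E_def)
qed

text \<open>The part of \<open>[\<Delta>, D]\<close> which is linear in \<open>\<nabla>R\<close>, up to sign.\<close>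

definition commutator_map ::
  "('n mat \<Rightarrow> 'v::euclidean_space \<Rightarrow> 'v) \<Rightarrow> (real ^ 'n \<Rightarrow> 'v \<Rightarrow> 'w::euclidean_space) \<Rightarrow> 'n dcurv \<Rightarrow> 'v \<Rightarrow> 'w" where
  "commutator_map \<rho> dia \<kappa> v = (\<Sum>k\<in>UNIV. \<Sum>i\<in>UNIV. dia (axis k 1) (star H \<rho> (\<kappa> (axis i 1) (axis i 1) (axis k 1)) v)) +
     (1/2) *\<^sub>R (\<Sum>k\<in>UNIV. \<Sum>\<mu>\<in>UNIV. \<Sum>\<nu>\<in>UNIV.
       dia (axis k 1) (star H \<rho> (E \<mu> \<nu>) (star H \<rho> (\<kappa> (axis k 1) (axis \<mu> 1) (axis \<nu> 1)) v)))"

lemma commutator_map_linear: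
  assumes \<rho>: "lie_representation H \<rho>" and dia: "bilinear dia"
  shows "linear (commutator_map \<rho> dia \<kappa>)"
proof -
  interpret s: bounded_bilinear "star H \<rho>" by (rule bounded_bilinear_star[OF \<rho>])
  interpret b: bounded_bilinear dia using dia by (simp add: bilinear_conv_bounded_bilinear)
  show ?thesis
    by (rule linearI) (simp_all add: commutator_map_def s.add_right s.scaleR_right b.add_right b.scaleR_right
        sum.distrib scaleR_sum_right scaleR_add_right)
qed

lemma commutator_map_comb:
  assumes \<rho>: "lie_representation H \<rho>" and dia: "bilinear dia"
  shows "commutator_map \<rho> dia (\<lambda>x y z. a *\<^sub>R \<kappa> x y z + b *\<^sub>R \<mu> x y z) v =
    a *\<^sub>R commutator_map \<rho> dia \<kappa> v + b *\<^sub>R commutator_map \<rho> dia \<mu> v"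
proof -
  interpret s: bounded_bilinear "star H \<rho>" by (rule bounded_bilinear_star[OF \<rho>])
  interpret b: bounded_bilinear dia using dia by (simp add: bilinear_conv_bounded_bilinear)
  show ?thesis
    by (simp add: commutator_map_def s.add_left s.scaleR_left s.add_right s.scaleR_right b.add_right b.scaleR_right
        sum.distrib scaleR_sum_right scaleR_add_right)
qed

text \<open>Every standard basis vector is written as h applied to the basis vector \<epsilon>
  rotated by h^{-1}. Then h factors out of the whole expression, and a contraction over another
  orthonormal basis is left.\<close>

lemma commutator_map_equivariant:
  assumes \<rho>: "lie_representation H \<rho>" and \<rho>': "lie_representation H \<rho>'" and dia: "bilinear dia"
    and eq: "\<And>h x v. h \<in> H \<Longrightarrow> dia (h *v x) (\<rho> h v) = \<rho>' h (dia x v)"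
    and h: "h \<in> H" and \<kappa>: "\<kappa> \<in> dcurv_space H"
  shows "commutator_map \<rho> dia (dcurv_act h \<kappa>) v = \<rho>' h (commutator_map \<rho> dia \<kappa> (\<rho> (transpose h) v))"
proof -
  interpret s: bounded_bilinear "star H \<rho>" by (rule bounded_bilinear_star[OF \<rho>])
  interpret b: bounded_bilinear dia using dia by (simp add: bilinear_conv_bounded_bilinear)
  have k: "linear (\<lambda>x. \<kappa> x y z)" "linear (\<lambda>y. \<kappa> x y z)" "linear (\<lambda>z. \<kappa> x y z)" for x y z
    using \<kappa> unfolding dcurv_space_def mem_Collect_eq by blast+
  note ks = linear_add[OF k(1)] linear_add[OF k(2)] linear_add[OF k(3)]
    linear_cmul[OF k(1)] linear_cmul[OF k(2)] linear_cmul[OF k(3)]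
  note ht = H_transpose[OF h]
  note lin' = rep_linear[OF \<rho>' h]
  define w where "w = \<rho> (transpose h) v"
  define \<epsilon> where "\<epsilon> i = transpose h *v axis i 1" for i :: 'n
  have ax: "axis i 1 = h *v \<epsilon> i" for i :: 'n
    by (simp add: \<epsilon>_def matrix_vector_mul_assoc H_transpose_mult[OF h])
  have act: "dcurv_act h \<kappa> (axis i 1) (axis j 1) (axis l 1) = h ** \<kappa> (\<epsilon> i) (\<epsilon> j) (\<epsilon> l) ** transpose h" for i j l
    by (simp add: dcurv_act_def H_inv[OF h] \<epsilon>_def)
  have wE: "E \<mu> \<nu> = h ** wedge (\<epsilon> \<mu>) (\<epsilon> \<nu>) ** transpose h" for \<mu> \<nu>
    unfolding E_def ax[of \<mu>] ax[of \<nu>] by (rule wedge_conj)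
  have d: "dia (axis i 1) (\<rho> h x) = \<rho>' h (dia (\<epsilon> i) x)" for i x
    unfolding ax[of i] by (rule eq[OF h])
  have st: "star H \<rho> (h ** X ** transpose h) v = \<rho> h (star H \<rho> X w)" for X
    unfolding w_def by (rule star_conj_inverse[OF \<rho> h])
  have 1: "(\<Sum>k\<in>UNIV. \<Sum>i\<in>UNIV. dia (\<epsilon> k) (star H \<rho> (\<kappa> (\<epsilon> i) (\<epsilon> i) (\<epsilon> k)) w)) =
    (\<Sum>k\<in>UNIV. \<Sum>i\<in>UNIV. dia (axis k 1) (star H \<rho> (\<kappa> (axis i 1) (axis i 1) (axis k 1)) w))"
    unfolding \<epsilon>_def
    by (rule sum_basis_invariant2[OF ht, of "\<lambda>x y z t. dia x (star H \<rho> (\<kappa> z t y) w)"])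
      (rule linearI; simp add: b.add_left b.add_right b.scaleR_left b.scaleR_right s.add_left s.scaleR_left ks)+
  have 2: "(\<Sum>k\<in>UNIV. \<Sum>\<mu>\<in>UNIV. \<Sum>\<nu>\<in>UNIV. dia (\<epsilon> k) (star H \<rho> (wedge (\<epsilon> \<mu>) (\<epsilon> \<nu>)) (star H \<rho> (\<kappa> (\<epsilon> k) (\<epsilon> \<mu>) (\<epsilon> \<nu>)) w))) =
    (\<Sum>k\<in>UNIV. \<Sum>\<mu>\<in>UNIV. \<Sum>\<nu>\<in>UNIV. dia (axis k 1) (star H \<rho> (E \<mu> \<nu>) (star H \<rho> (\<kappa> (axis k 1) (axis \<mu> 1) (axis \<nu> 1)) w)))"
  proof -
    have i: "(\<Sum>\<mu>\<in>UNIV. \<Sum>\<nu>\<in>UNIV. dia x (star H \<rho> (wedge (\<epsilon> \<mu>) (\<epsilon> \<nu>)) (star H \<rho> (\<kappa> y (\<epsilon> \<mu>) (\<epsilon> \<nu>)) w))) =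
      (\<Sum>\<mu>\<in>UNIV. \<Sum>\<nu>\<in>UNIV. dia x (star H \<rho> (E \<mu> \<nu>) (star H \<rho> (\<kappa> y (axis \<mu> 1) (axis \<nu> 1)) w)))" for x y
      unfolding \<epsilon>_def E_def
      by (rule sum_basis_invariant2[OF ht, of "\<lambda>a b c d. dia x (star H \<rho> (wedge a c) (star H \<rho> (\<kappa> y b d) w))"])
        (rule linearI; simp add: b.add_right b.scaleR_right s.add_left s.scaleR_left s.add_right s.scaleR_right ks
          wedge_add wedge_scale)+
    show ?thesis
      unfolding i unfolding \<epsilon>_def
      by (rule sum_basis_invariant[OF ht, of "\<lambda>x y. \<Sum>\<mu>\<in>UNIV. \<Sum>\<nu>\<in>UNIV. dia x (star H \<rho> (E \<mu> \<nu>)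
           (star H \<rho> (\<kappa> y (axis \<mu> 1) (axis \<nu> 1)) w))"])
        (rule linearI; simp add: b.add_left b.scaleR_left b.add_right b.scaleR_right s.add_left s.scaleR_left
          s.add_right s.scaleR_right ks sum.distrib scaleR_sum_right)+
  qed
  have "commutator_map \<rho> dia (dcurv_act h \<kappa>) v = \<rho>' h
     ((\<Sum>k\<in>UNIV. \<Sum>i\<in>UNIV. dia (\<epsilon> k) (star H \<rho> (\<kappa> (\<epsilon> i) (\<epsilon> i) (\<epsilon> k)) w)) +
      (1/2) *\<^sub>R (\<Sum>k\<in>UNIV. \<Sum>\<mu>\<in>UNIV. \<Sum>\<nu>\<in>UNIV. dia (\<epsilon> k) (star H \<rho> (wedge (\<epsilon> \<mu>) (\<epsilon> \<nu>)) (star H \<rho> (\<kappa> (\<epsilon> k) (\<epsilon> \<mu>) (\<epsilon> \<nu>)) w))))"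
    unfolding commutator_map_def act st wE star_conj[OF \<rho> h] d
    by (simp only: linear_add[OF lin'] linear_cmul[OF lin'] linear_sum[OF lin'])
  also have "\<dots> = \<rho>' h (commutator_map \<rho> dia \<kappa> w)"
    unfolding 1 2 commutator_map_def by (rule refl)
  finally show ?thesis unfolding w_def .
qed

text \<open>Elements of \<open>Hom_rep\<close> vanish outside C by convention, hence the extension
  by zero.\<close>

lemma commutator_map_in_Hom:
  assumes \<rho>: "lie_representation H \<rho>" and \<rho>': "lie_representation H \<rho>'" and dia: "bilinear dia"
    and eq: "\<And>h x v. h \<in> H \<Longrightarrow> dia (h *v x) (\<rho> h v) = \<rho>' h (dia x v)" and C: "dcurv_subrep H C"
  shows "(\<lambda>\<kappa>. if \<kappa> \<in> C then commutator_map \<rho> dia \<kappa> else (\<lambda>v. 0)) \<in> Hom_rep H C \<rho> \<rho>'"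
  unfolding Hom_rep_def
proof (intro CollectI conjI ballI allI impI)
  have CC: "(\<lambda>x y z. a *\<^sub>R \<kappa> x y z + b *\<^sub>R \<mu> x y z) \<in> C" if "\<kappa> \<in> C" "\<mu> \<in> C" for \<kappa> \<mu> a b
    using C that unfolding dcurv_subrep_def by blast
  have CH: "dcurv_act h \<kappa> \<in> C" if "\<kappa> \<in> C" "h \<in> H" for \<kappa> h
    using C that unfolding dcurv_subrep_def by blast
  have CS: "\<kappa> \<in> dcurv_space H" if "\<kappa> \<in> C" for \<kappa>
    using C that unfolding dcurv_subrep_def by blast
  show "(if \<kappa> \<in> C then commutator_map \<rho> dia \<kappa> else (\<lambda>v. 0)) = (\<lambda>v. 0)" if "\<kappa> \<notin> C" for \<kappa>
    using that by simp
  show "linear (if \<kappa> \<in> C then commutator_map \<rho> dia \<kappa> else (\<lambda>v. 0))" if "\<kappa> \<in> C" for \<kappa>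
    using that commutator_map_linear[OF \<rho> dia] by simp
  show "(if (\<lambda>x y z. a *\<^sub>R \<kappa> x y z + b *\<^sub>R \<mu> x y z) \<in> C
      then commutator_map \<rho> dia (\<lambda>x y z. a *\<^sub>R \<kappa> x y z + b *\<^sub>R \<mu> x y z) else (\<lambda>v. 0)) v =
    a *\<^sub>R (if \<kappa> \<in> C then commutator_map \<rho> dia \<kappa> else (\<lambda>v. 0)) v +
    b *\<^sub>R (if \<mu> \<in> C then commutator_map \<rho> dia \<mu> else (\<lambda>v. 0)) v" if "\<kappa> \<in> C" "\<mu> \<in> C" for \<kappa> \<mu> a b v
    using that CC[OF that] commutator_map_comb[OF \<rho> dia] by simp
  show "(if dcurv_act h \<kappa> \<in> C then commutator_map \<rho> dia (dcurv_act h \<kappa>) else (\<lambda>v. 0)) =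
    \<rho>' h \<circ> (if \<kappa> \<in> C then commutator_map \<rho> dia \<kappa> else (\<lambda>v. 0)) \<circ> \<rho> (matrix_inv h)" if "h \<in> H" "\<kappa> \<in> C" for h \<kappa>
  proof -
    have "commutator_map \<rho> dia (dcurv_act h \<kappa>) v = \<rho>' h (commutator_map \<rho> dia \<kappa> (\<rho> (transpose h) v))" for v
      by (rule commutator_map_equivariant[OF \<rho> \<rho>' dia _ that(1) CS[OF that(2)]]) (rule eq)
    then show ?thesis by (simp add: fun_eq_iff CH[OF that(2,1)] that(2) H_inv[OF that(1)])
  qed
qed

end

context gauge
begin

section \<open>The global operators computed in a gauge\<close>

lemma N_cong: "q \<in> U \<Longrightarrow> sm f \<Longrightarrow> (\<And>r. r \<in> U \<Longrightarrow> f r = f' r) \<Longrightarrow> N \<rho> f q = N \<rho> f' q"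
  unfolding N_def using nB_cong[of q f f'] by presburger

lemma cov_nB: "cov \<sigma> \<rho> (\<sigma> q (axis i 1)) s q = nB (star H \<rho>) i (\<lambda>r. s (r, \<sigma> r)) q"
  by (simp add: cov_def nB_def d_def G_def)

lemma nabla_N:
  assumes "lie_representation H \<rho>" "s \<in> sections A H P \<rho>" "q \<in> U"
  shows "nabla \<rho> s (q, \<sigma> q) = N \<rho> (\<lambda>r. s (r, \<sigma> r)) q"
  unfolding vec_eq_iff N_nth using nabla_gauge[OF assms(1,2) gauge assms(3)] cov_nB by metis

lemma nabla_nabla_N:
  assumes \<rho>: "lie_representation H \<rho>" and s: "s \<in> sections A H P \<rho>" and q: "q \<in> U"
  shows "nabla (tens \<rho>) (nabla \<rho> s) (q, \<sigma> q) = N (tens \<rho>) (N \<rho> (\<lambda>r. s (r, \<sigma> r))) q"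
  unfolding nabla_N[OF tens_representation[OF \<rho>] nabla_sections[OF \<rho> s] q]
  by (rule N_cong[OF q sections_smooth[OF nabla_sections[OF \<rho> s] gauge] nabla_N[OF \<rho> s]])

text \<open>q(R) is defined through a chosen gauge; tensoriality shows that only the frame at the
  point counts.\<close>

lemma curvature_form_same_frame:
  assumes \<tau>: "local_section A P W \<tau>" and q: "q \<in> U" "q \<in> W" and e: "\<tau> q = \<sigma> q"
  shows "curvature_form A nab \<tau> q a b = Rb a b q"
proof -
  have o: "open (U \<inter> W)" using U section_open[OF \<tau>] by blast
  interpret r: gauge A g nab H P "U \<inter> W" \<sigma> by (rule restrict_gauge[OF o]) auto
  have \<tau>': "local_section A P (U \<inter> W) \<tau>" by (rule section_subset[OF \<tau> o]) auto
  obtain h where h: "smooth_fun A (U \<inter> W) h" "\<And>q. q \<in> U \<inter> W \<Longrightarrow> h q \<in> H"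
    "\<And>q. q \<in> U \<inter> W \<Longrightarrow> \<tau> q = frame_act (\<sigma> q) (h q)"
    using gauge_change[OF r.gauge \<tau>'] by blast
  have q': "q \<in> U \<inter> W" using q by blast
  have "h q *v v = v" for v
  proof -
    have "\<sigma> q (h q *v v) = \<sigma> q v" using h(3)[OF q'] e by (simp add: frame_act_def fun_eq_iff)
    then show ?thesis using frame_inj[OF frame[OF q(1)]] by (simp add: inj_eq)
  qed
  then have "h q = mat 1" unfolding matrix_eq by simp
  then show ?thesis using r.curvature_form_gauge_change[OF \<tau>' h q'] by simp
qed

lemma q_curvature_Q:
  assumes q: "q \<in> U"
  shows "q_curvature A nab H P \<rho> s (q, \<sigma> q) = Q \<rho> (s (q, \<sigma> q)) q"
proof -
  obtain W where W: "q \<in> W" "local_section A P W (gauge_at A P q (\<sigma> q))" "gauge_at A P q (\<sigma> q) q = \<sigma> q"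
    using gauge_at_section[OF section_P[OF gauge q]] by blast
  have 1: "curvature_form A nab (gauge_at A P q (\<sigma> q)) q (axis \<mu> 1) (axis \<nu> 1) = R \<mu> \<nu> q" for \<mu> \<nu>
    using curvature_form_same_frame[OF W(2) q W(1,3)] Rb_axis by simp
  have 2: "inf_rep H \<rho> (R \<mu> \<nu> q) v = star H \<rho> (R \<mu> \<nu> q) v" for \<mu> \<nu> v
    by (rule star_lie[OF R_lie[OF q], symmetric])
  show ?thesis unfolding q_curvature_def Q_def E_def by (simp add: 1 2 star_def[of H \<rho> "wedge _ _"])
qed

lemma rough_laplace_own_gauge:
  assumes \<rho>: "lie_representation H \<rho>" and s: "s \<in> sections A H P \<rho>" and q: "q \<in> U"
    and own: "gauge_at A P q (\<sigma> q) = \<sigma>"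
  shows "rough_laplace A nab H P \<rho> s (q, \<sigma> q) = - (\<Sum>\<mu>\<in>UNIV. N (tens \<rho>) (N \<rho> (\<lambda>r. s (r, \<sigma> r))) q $ \<mu> $ \<mu>)"
proof -
  let ?f = "\<lambda>r. s (r, \<sigma> r)"
  let ?n = "nB (star H \<rho>)"
  have f: "sm ?f" by (rule sections_smooth[OF s gauge])
  have ge: "gauge_field A P q (\<sigma> q) \<mu> = e \<mu>" for \<mu> by (simp add: gauge_field_def own)
  have in1: "cov_deriv A nab H P \<rho> (e \<mu>) s (r, \<sigma> r) = ?n \<mu> ?f r" if "r \<in> U" for r \<mu>
    unfolding cov_nB[symmetric] by (rule cov_deriv_eq_cov[where X="e \<mu>", OF \<rho> s gauge that tan[OF that]])
  have 1: "cov_deriv A nab H P \<rho> (e \<mu>) (cov_deriv A nab H P \<rho> (e \<mu>) s) (q, \<sigma> q) = ?n \<mu> (\<lambda>r. ?n \<mu> ?f r) q" for \<mu>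
  proof -
    have "deriv_along (\<sigma> q (axis \<mu> 1)) (\<lambda>r. cov_deriv A nab H P \<rho> (e \<mu>) s (r, \<sigma> r)) = d \<mu> (\<lambda>r. ?n \<mu> ?f r) q"
      unfolding d_def
      by (rule deriv_along_cong[OF tan[OF q] sm_nr[OF \<rho> f] q, symmetric]) (rule in1[symmetric])
    then have "cov_deriv A nab H P \<rho> (e \<mu>) (cov_deriv A nab H P \<rho> (e \<mu>) s) (q, \<sigma> q) =
      d \<mu> (\<lambda>r. ?n \<mu> ?f r) q + inf_rep H \<rho> (G \<mu> q) (?n \<mu> ?f q)"
      unfolding cov_deriv_def[of _ _ _ _ _ _ "cov_deriv A nab H P \<rho> (e \<mu>) s"] own Let_def split_conv
      by (simp only: in1[OF q] G_def)
    then show ?thesis unfolding nB_def[of _ _ "\<lambda>r. ?n \<mu> ?f r"] star_lie[OF G_lie[OF q]] .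
  qed
  have 2: "cov_deriv A nab H P \<rho> (\<lambda>r. nab r (e \<mu> r) (e \<mu>)) s (q, \<sigma> q) = - (\<Sum>l\<in>UNIV. (G \<mu> q $ \<mu> $ l) *\<^sub>R ?n l ?f q)" for \<mu>
  proof -
    have ne: "nab q (e \<mu> q) (e \<mu>) = \<sigma> q (G \<mu> q *v axis \<mu> 1)"
      using nab_e[OF q sm_const] nv_const[OF q] by simp
    have t: "(\<lambda>r. nab r (e \<mu> r) (e \<mu>)) q \<in> tangent_space A q" using tan[OF q] ne by simp
    have "cov_deriv A nab H P \<rho> (\<lambda>r. nab r (e \<mu> r) (e \<mu>)) s (q, \<sigma> q) = cov \<sigma> \<rho> (\<sigma> q (G \<mu> q *v axis \<mu> 1)) s q"
      using cov_deriv_eq_cov[where X="\<lambda>r. nab r (e \<mu> r) (e \<mu>)", OF \<rho> s gauge q t] unfolding ne .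
    also have "\<dots> = (\<Sum>l\<in>UNIV. (G \<mu> q $ l $ \<mu>) *\<^sub>R ?n l ?f q)"
      unfolding cov_frame[OF \<rho> gauge q, of "G \<mu> q *v axis \<mu> 1"] cov_nB matrix_mult_axis by (rule refl)
    also have "\<dots> = (\<Sum>l\<in>UNIV. - ((G \<mu> q $ \<mu> $ l) *\<^sub>R ?n l ?f q))"
    proof (intro sum.cong refl)
      fix l show "(G \<mu> q $ l $ \<mu>) *\<^sub>R ?n l ?f q = - ((G \<mu> q $ \<mu> $ l) *\<^sub>R ?n l ?f q)"
        by (subst G_skew[OF q]) simp
    qed
    finally show ?thesis by (simp add: sum_negf)
  qed
  show ?thesis
    unfolding rough_laplace_def split_conv Let_def ge 1 2 hessian[OF \<rho> q f] by simp
qed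

end

context geometry
begin

text \<open>The left side is computed in the gauge chosen at (p, u); the right side mentions none,
  which frees the Laplacian from the choice.\<close>

lemma rough_laplace_trace:
  assumes \<rho>: "lie_representation H \<rho>" and s: "s \<in> sections A H P \<rho>" and pu: "(p, u) \<in> P"
  shows "rough_laplace A nab H P \<rho> s (p, u) = - (\<Sum>i\<in>UNIV. nabla (tens \<rho>) (nabla \<rho> s) (p, u) $ i $ i)"
proof -
  obtain W where W: "p \<in> W" "local_section A P W (gauge_at A P p u)" "gauge_at A P p u p = u"
    using gauge_at_section[OF pu] by blast
  interpret w: gauge A g nab H P W "gauge_at A P p u" by unfold_locales (rule W(2))
  show ?thesis
    using w.rough_laplace_own_gauge[OF \<rho> s W(1)] w.nabla_nabla_N[OF \<rho> s W(1)] unfolding W(3) by simp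
qed

end

context gauge
begin

lemma standard_laplace_Lap:
  assumes \<rho>: "lie_representation H \<rho>" and s: "s \<in> sections A H P \<rho>" and q: "q \<in> U"
  shows "standard_laplace A nab H P \<rho> s (q, \<sigma> q) = Lap \<rho> (\<lambda>r. s (r, \<sigma> r)) q"
  unfolding standard_laplace_def Lap_def rough_laplace_trace[OF \<rho> s section_P[OF gauge q]]
    nabla_nabla_N[OF \<rho> s q] q_curvature_Q[OF q] by (rule refl)

lemma Rb_linear: "linear (\<lambda>x. Rb x y q)" "linear (\<lambda>y. Rb x y q)"
  by (rule linearI; simp add: Rb_def distrib_left distrib_right scaleR_add_left sum.distrib scaleR_sum_right mult_ac)+

lemma q_curvature_translate:
  assumes \<rho>: "lie_representation H \<rho>" and s: "s \<in> sections A H P \<rho>" and q: "q \<in> U" and h: "h \<in> H"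
  shows "q_curvature A nab H P \<rho> s (q, frame_act (\<sigma> q) h) = \<rho> (transpose h) (q_curvature A nab H P \<rho> s (q, \<sigma> q))"
proof -
  note \<tau> = section_right_translate[OF gauge h]
  interpret t: gauge A g nab H P U "\<lambda>q. frame_act (\<sigma> q) h" by unfold_locales (rule \<tau>)
  note lin = rep_linear[OF \<rho> H_transpose[OF h]]
  have R': "t.R \<mu> \<nu> q = transpose h ** Rb (h *v axis \<mu> 1) (h *v axis \<nu> 1) q ** h" for \<mu> \<nu>
    using t.curvature_form_R[OF q, of "axis \<mu> 1" "axis \<nu> 1"] curvature_form_gauge_change[OF \<tau> sm_const[of h] h refl q]
    unfolding t.Rb_axis by simp
  show ?thesis
    unfolding q_curvature_Q[OF q] t.q_curvature_Q[OF q] Q_def t.Q_def R'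
      sections_equivariant[OF s section_P[OF gauge q] h]
      curvature_endomorphism_invariant[where S="\<lambda>x y. Rb x y q", OF \<rho> h Rb_linear] Rb_axis linear_cmul[OF lin]
    by (rule refl)
qed

end

context geometry
begin

text \<open>The formula for D is guaranteed on \<open>sections\<close> only, so this is needed
  before D can be applied to \<Delta> s.\<close>

lemma standard_laplace_sections:
  assumes \<rho>: "lie_representation H \<rho>" and s: "s \<in> sections A H P \<rho>"
  shows "standard_laplace A nab H P \<rho> s \<in> sections A H P \<rho>"
proof (rule sectionsI)
  fix U \<sigma> assume \<sigma>: "local_section A P U \<sigma>"
  interpret g: gauge A g nab H P U \<sigma> by unfold_locales (rule \<sigma>)
  show "smooth_fun A U (\<lambda>q. standard_laplace A nab H P \<rho> s (q, \<sigma> q))"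
    by (rule smooth_fun_cong[OF g.sm_Lap[OF \<rho> sections_smooth[OF s \<sigma>]]])
      (rule g.standard_laplace_Lap[OF \<rho> s, symmetric])
  fix p h assume p: "p \<in> U" and h: "h \<in> H"
  note ht = H_transpose[OF h]
  note lin = rep_linear[OF \<rho> ht]
  note pP = section_P[OF \<sigma> p] and tP = section_P[OF section_right_translate[OF \<sigma> h] p]
  have "nabla (tens \<rho>) (nabla \<rho> s) (p, frame_act (\<sigma> p) h) =
     tens (tens \<rho>) (transpose h) (nabla (tens \<rho>) (nabla \<rho> s) (p, \<sigma> p))"
    by (rule sections_equivariant[OF nabla_sections[OF tens_representation[OF \<rho>] nabla_sections[OF \<rho> s]] pP h])
  then have "(\<Sum>i\<in>UNIV. nabla (tens \<rho>) (nabla \<rho> s) (p, frame_act (\<sigma> p) h) $ i $ i) =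
      \<rho> (transpose h) (\<Sum>i\<in>UNIV. nabla (tens \<rho>) (nabla \<rho> s) (p, \<sigma> p) $ i $ i)"
    using tens_trace[OF \<rho> ht] by simp
  then show "standard_laplace A nab H P \<rho> s (p, frame_act (\<sigma> p) h) =
      \<rho> (transpose h) (standard_laplace A nab H P \<rho> s (p, \<sigma> p))"
    unfolding standard_laplace_def rough_laplace_trace[OF \<rho> s pP] rough_laplace_trace[OF \<rho> s tP]
      g.q_curvature_translate[OF \<rho> s p h] by (simp add: linear_add[OF lin] linear_diff[OF lin] linear_neg[OF lin])
qed

end

context gauge
begin

section \<open>Naturality of the Laplacian\<close>

lemma Lap_cong:
  assumes \<rho>: "lie_representation H \<rho>" and q: "q \<in> U" and f: "sm f" and e: "\<And>r. r \<in> U \<Longrightarrow> f r = f' r"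
  shows "Lap \<rho> f q = Lap \<rho> f' q"
  unfolding Lap_def N_cong[where \<rho>="tens \<rho>", OF q sm_N[OF \<rho> f] N_cong[OF _ f e], simplified] e[OF q] by (rule refl)

lemma Lap_add:
  assumes \<rho>: "lie_representation H \<rho>" and q: "q \<in> U" and f: "sm f" and f': "sm f'"
  shows "Lap \<rho> (\<lambda>r. f r + f' r) q = Lap \<rho> f q + Lap \<rho> f' q"
proof -
  interpret s: bounded_bilinear "star H \<rho>" by (rule bounded_bilinear_star[OF \<rho>])
  note bbs = bounded_bilinear_star[OF \<rho>] and bbt = bounded_bilinear_star[OF tens_representation[OF \<rho>]]
  have 1: "N \<rho> (\<lambda>r. f r + f' r) r = N \<rho> f r + N \<rho> f' r" if "r \<in> U" for r
    by (simp add: vec_eq_iff N_nth nB_add[OF bbs that f f'])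
  have "N (tens \<rho>) (N \<rho> (\<lambda>r. f r + f' r)) q = N (tens \<rho>) (\<lambda>r. N \<rho> f r + N \<rho> f' r) q"
    by (rule N_cong[OF q sm_N[OF \<rho> sm_add[OF f f']] 1])
  also have "\<dots> = N (tens \<rho>) (N \<rho> f) q + N (tens \<rho>) (N \<rho> f') q"
    by (simp add: vec_eq_iff N_nth[of "tens \<rho>"] nB_add[OF bbt q sm_N[OF \<rho> f] sm_N[OF \<rho> f']])
  finally show ?thesis
    by (simp add: Lap_def Q_def sum.distrib s.add_right scaleR_add_right)
qed

lemma Lap_equivariant:
  assumes \<rho>: "lie_representation H \<rho>" and \<rho>': "lie_representation H \<rho>'" and L: "linear L"
    and eq: "\<And>h v. h \<in> H \<Longrightarrow> L (\<rho> h v) = \<rho>' h (L v)" and q: "q \<in> U" and f: "sm f"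
  shows "Lap \<rho>' (\<lambda>r. L (f r)) q = L (Lap \<rho> f q)"
proof -
  \<comment> \<open>\<open>M\<close> is the identity of T tensored with L; it intertwines the
    \<open>tens\<close> representations, so L passes through both covariant derivatives.\<close>
  define M where "M F = (\<chi> i. L (F $ i))" for F :: "'a ^ 'n"
  have M: "linear M" by (rule linearI) (simp_all add: M_def vec_eq_iff linear_add[OF L] linear_cmul[OF L])
  have Me: "M (tens \<rho> h F) = tens \<rho>' h (M F)" if "h \<in> H" for h F
    by (simp add: M_def tens_def vec_eq_iff linear_sum[OF L] linear_cmul[OF L] eq[OF that])
  have 1: "N \<rho>' (\<lambda>r. L (f r)) r = M (N \<rho> f r)" if "r \<in> U" for r
  proof -
    have "nB (star H \<rho>') i (\<lambda>r. L (f r)) r = L (nB (star H \<rho>) i f r)" for i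
      by (rule nB_equivariant[OF \<rho> \<rho>' L _ that f]) (rule eq)
    then show ?thesis by (simp add: vec_eq_iff N_nth M_def)
  qed
  have 2: "N (tens \<rho>') (N \<rho>' (\<lambda>r. L (f r))) q $ i $ i = L (N (tens \<rho>) (N \<rho> f) q $ i $ i)" for i
  proof -
    have "N (tens \<rho>') (N \<rho>' (\<lambda>r. L (f r))) q = N (tens \<rho>') (\<lambda>r. M (N \<rho> f r)) q"
      by (rule N_cong[OF q sm_N[OF \<rho>' smooth_fun_linear[OF L f]] 1])
    moreover have "nB (star H (tens \<rho>')) i (\<lambda>r. M (N \<rho> f r)) q = M (nB (star H (tens \<rho>)) i (N \<rho> f) q)"
      by (rule nB_equivariant[OF tens_representation[OF \<rho>] tens_representation[OF \<rho>'] M _ q sm_N[OF \<rho> f]])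
        (rule Me)
    ultimately have "N (tens \<rho>') (N \<rho>' (\<lambda>r. L (f r))) q $ i = M (N (tens \<rho>) (N \<rho> f) q $ i)"
      by (simp only: N_nth[of "tens \<rho>"] N_nth[of "tens \<rho>'"])
    then show ?thesis by (simp only: M_def vec_lambda_beta)
  qed
  have st: "L (star H \<rho> X v) = star H \<rho>' X (L v)" for X v
    by (rule star_equivariant[OF \<rho> \<rho>' L]) (rule eq)
  have 3: "L (Q \<rho> (f q) q) = Q \<rho>' (L (f q)) q"
    unfolding Q_def by (simp only: linear_cmul[OF L] linear_sum[OF L] st)
  show ?thesis
    unfolding Lap_def 2 by (simp only: linear_add[OF L] linear_neg[OF L] linear_sum[OF L] 3)
qed

end

theorem corollary3p3:
  fixes A :: "('m::{t2_space,second_countable_topology}, 'n::finite) atlas"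
    and g :: "'m metric"
    and nab :: "'m conn"
    and H :: "'n mat set"
    and P :: "('m \<times> ('m, 'n) frame) set"
    and C :: "'n dcurv set"
    and \<rho> :: "'n mat \<Rightarrow> 'v::euclidean_space \<Rightarrow> 'v"
    and \<rho>' :: "'n mat \<Rightarrow> 'w::euclidean_space \<Rightarrow> 'w"
    and D :: "('m, 'n, 'v) sec \<Rightarrow> ('m, 'n, 'w) sec"
  assumes "riemannian_manifold A g"
    and "metric_connection A g nab"
    and "parallel_skew_torsion A g nab"
    and "holonomy_reduction A g nab H P"
    and "dcurv_subrep H C"
    and "nabla_curvature_section_of A nab P C"
    and "lie_representation H \<rho>"
    and "lie_representation H \<rho>'"
    and "natural_first_order A nab H P \<rho> \<rho>' D"
    and "Hom_rep H C \<rho> \<rho>' = {\<lambda>\<kappa> v. 0}"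
  shows "\<forall>s\<in>sections A H P \<rho>. \<forall>pu\<in>P.
           standard_laplace A nab H P \<rho>' (D s) pu - D (standard_laplace A nab H P \<rho> s) pu = 0"
proof (intro ballI)
  interpret geometry A g nab H P by unfold_locales (rule assms)+
  note \<rho> = assms(7) and \<rho>' = assms(8)
  obtain dia F where dia: "bilinear dia" and dia_eq: "\<And>h x v. h \<in> H \<Longrightarrow> dia (h *v x) (\<rho> h v) = \<rho>' h (dia x v)"
    and F: "linear F" and F_eq: "\<And>h v. h \<in> H \<Longrightarrow> F (\<rho> h v) = \<rho>' h (F v)"
    and D: "\<And>s pu. s \<in> sections A H P \<rho> \<Longrightarrow> pu \<in> P \<Longrightarrow> D s pu = D_diamond A nab H P \<rho> dia s pu + F (s pu)"
    using assms(9) unfolding natural_first_order_def by blast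
  interpret b: bounded_bilinear dia using dia by (simp add: bilinear_conv_bounded_bilinear)
  \<comment> \<open>\<open>dia\<close> regarded as a linear map on T \<otimes> V, so that D becomes
    the composition of L with \<open>nabla\<close>, plus F.\<close>
  define L where "L V = (\<Sum>k\<in>UNIV. dia (axis k 1) (V $ k))" for V :: "'v ^ 'n"
  have L: "linear L" by (rule linearI) (simp_all add: L_def b.add_right b.scaleR_right sum.distrib scaleR_sum_right)
  have L_eq: "L (tens \<rho> h V) = \<rho>' h (L V)" if h: "h \<in> H" for h V
  proof -
    have he: "h *v axis l 1 = (\<Sum>k\<in>UNIV. (h $ k $ l) *\<^sub>R axis k 1)" for l
      using real_vec_expansion[of "h *v axis l 1"] by (simp add: matrix_mult_axis)
    have "L (tens \<rho> h V) = (\<Sum>k\<in>UNIV. \<Sum>l\<in>UNIV. (h $ k $ l) *\<^sub>R dia (axis k 1) (\<rho> h (V $ l)))"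
      by (simp add: L_def tens_def b.sum_right b.scaleR_right)
    also have "\<dots> = (\<Sum>l\<in>UNIV. \<Sum>k\<in>UNIV. (h $ k $ l) *\<^sub>R dia (axis k 1) (\<rho> h (V $ l)))" by (rule sum.swap)
    also have "\<dots> = (\<Sum>l\<in>UNIV. dia (h *v axis l 1) (\<rho> h (V $ l)))"
      unfolding he by (simp add: b.sum_left b.scaleR_left)
    finally show ?thesis by (simp add: L_def dia_eq[OF h] linear_sum[OF rep_linear[OF \<rho>' h]])
  qed
  have D_nabla: "D s (p, u) = L (nabla \<rho> s (p, u)) + F (s (p, u))"
    if s: "s \<in> sections A H P \<rho>" and pu: "(p, u) \<in> P" for s p u
  proof -
    obtain W where W: "gauge_at A P p u p = u" using gauge_at_section[OF pu] by blast
    have "cov_deriv A nab H P \<rho> (gauge_field A P p u k) s (p, u) = nabla \<rho> s (p, u) $ k" for k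
      unfolding nabla_def cov_deriv_def gauge_field_def by (simp add: W)
    then show ?thesis using D[OF s pu] by (simp add: D_diamond_def L_def)
  qed
  fix s pu assume s: "s \<in> sections A H P \<rho>" and pu: "pu \<in> P"
  obtain p u where "pu = (p, u)" by (cases pu)
  with pu obtain U \<sigma> where U: "p \<in> U" "local_section A P U \<sigma>" and pu': "pu = (p, \<sigma> p)"
    using P_section by metis
  \<comment> \<open>Computing the Laplacian of D s in the gauge requires D s to be an equivariant
    smooth function.\<close>
  have Ds: "D s \<in> sections A H P \<rho>'"
  proof (rule sectionsI)
    fix W \<tau> assume \<tau>: "local_section A P W \<tau>"
    show "smooth_fun A W (\<lambda>q. D s (q, \<tau> q))"
      by (rule smooth_fun_cong[OF smooth_fun_add[OF smooth_fun_linear[OF L sections_smooth[OF nabla_sections[OF \<rho> s] \<tau>]]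
            smooth_fun_linear[OF F sections_smooth[OF s \<tau>]]]])
        (rule D_nabla[OF s section_P[OF \<tau>], symmetric])
    fix q h assume q: "q \<in> W" and h: "h \<in> H"
    note qP = section_P[OF \<tau> q] and tP = section_P[OF section_right_translate[OF \<tau> h] q] and ht = H_transpose[OF h]
    show "D s (q, frame_act (\<tau> q) h) = \<rho>' (transpose h) (D s (q, \<tau> q))"
      unfolding D_nabla[OF s qP] D_nabla[OF s tP] sections_equivariant[OF s qP h]
        sections_equivariant[OF nabla_sections[OF \<rho> s] qP h] L_eq[OF ht] F_eq[OF ht]
      by (rule linear_add[OF rep_linear[OF \<rho>' ht], symmetric])
  qed
  interpret g: gauge A g nab H P U \<sigma> by unfold_locales (rule U)
  let ?f = "\<lambda>r. s (r, \<sigma> r)"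
  have f: "g.sm ?f" by (rule sections_smooth[OF s U(2)])
  have "standard_laplace A nab H P \<rho>' (D s) pu = g.Lap \<rho>' (\<lambda>r. D s (r, \<sigma> r)) p"
    unfolding pu' by (rule g.standard_laplace_Lap[OF \<rho>' Ds U(1)])
  also have "\<dots> = g.Lap \<rho>' (\<lambda>r. L (g.N \<rho> ?f r) + F (?f r)) p"
    by (rule g.Lap_cong[OF \<rho>' U(1) sections_smooth[OF Ds U(2)]])
      (simp add: D_nabla[OF s section_P[OF U(2)]] g.nabla_N[OF \<rho> s])
  also have "\<dots> = g.Lap \<rho>' (\<lambda>r. L (g.N \<rho> ?f r)) p + g.Lap \<rho>' (\<lambda>r. F (?f r)) p"
    by (rule g.Lap_add[OF \<rho>' U(1) smooth_fun_linear[OF L g.sm_N[OF \<rho> f]] smooth_fun_linear[OF F f]])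
  also have "g.Lap \<rho>' (\<lambda>r. L (g.N \<rho> ?f r)) p = L (g.Lap (tens \<rho>) (g.N \<rho> ?f) p)"
    by (rule g.Lap_equivariant[OF tens_representation[OF \<rho>] \<rho>' L _ U(1) g.sm_N[OF \<rho> f]]) (rule L_eq)
  also have "g.Lap \<rho>' (\<lambda>r. F (?f r)) p = F (g.Lap \<rho> ?f p)"
    by (rule g.Lap_equivariant[OF \<rho> \<rho>' F _ U(1) f]) (rule F_eq)
  finally have lhs: "standard_laplace A nab H P \<rho>' (D s) pu = L (g.Lap (tens \<rho>) (g.N \<rho> ?f) p) + F (g.Lap \<rho> ?f p)" .
  note Ls = standard_laplace_sections[OF \<rho> s]
  have "nabla \<rho> (standard_laplace A nab H P \<rho> s) (p, \<sigma> p) = g.N \<rho> (\<lambda>r. standard_laplace A nab H P \<rho> s (r, \<sigma> r)) p"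
    by (rule g.nabla_N[OF \<rho> Ls U(1)])
  also have "\<dots> = g.N \<rho> (g.Lap \<rho> ?f) p"
    by (rule g.N_cong[OF U(1) sections_smooth[OF Ls U(2)] g.standard_laplace_Lap[OF \<rho> s]])
  finally have rhs: "D (standard_laplace A nab H P \<rho> s) pu = L (g.N \<rho> (g.Lap \<rho> ?f) p) + F (g.Lap \<rho> ?f p)"
    unfolding pu' D_nabla[OF Ls section_P[OF U(2,1)]] g.standard_laplace_Lap[OF \<rho> s U(1)] by simp
  define \<kappa> where "\<kappa> = nabla_curvature_form A nab \<sigma> p"
  have \<kappa>: "\<kappa> \<in> C" using assms(6) U unfolding nabla_curvature_section_of_def \<kappa>_def by blast
  have DR: "g.DR m i j p = \<kappa> (axis m 1) (axis i 1) (axis j 1)" for m i j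
    unfolding \<kappa>_def by (rule g.nabla_curvature_form_DR[OF U(1), symmetric])
  \<comment> \<open>F commutes with the Laplacian and contributes equally to both sides; this
    difference is the whole commutator.\<close>
  have "L (g.Lap (tens \<rho>) (g.N \<rho> ?f) p) - L (g.N \<rho> (g.Lap \<rho> ?f) p) = - commutator_map \<rho> dia \<kappa> (?f p)"
  proof -
    have "L (g.Lap (tens \<rho>) (g.N \<rho> ?f) p) - L (g.N \<rho> (g.Lap \<rho> ?f) p) =
        (\<Sum>k\<in>UNIV. dia (axis k 1) (g.Lap (tens \<rho>) (g.N \<rho> ?f) p $ k - g.nB (star H \<rho>) k (g.Lap \<rho> ?f) p))"
      by (simp add: L_def b.diff_right sum_subtractf g.N_nth)
    then show ?thesis
      unfolding g.Lap_nabla_commutator[OF \<rho> U(1) f] DR commutator_map_def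
      by (simp add: b.diff_right b.minus_right b.sum_right b.scaleR_right sum_subtractf sum_negf scaleR_sum_right)
  qed
  moreover have "commutator_map \<rho> dia \<kappa> (?f p) = 0"
  proof -
    \<comment> \<open>The Hom space consists of zero only; evaluating at \<nabla>R, which lies in C,
      removes the remaining term.\<close>
    have "(\<lambda>\<kappa>. if \<kappa> \<in> C then commutator_map \<rho> dia \<kappa> else (\<lambda>v. 0)) = (\<lambda>\<kappa> v. 0)"
      using commutator_map_in_Hom[OF \<rho> \<rho>' dia dia_eq assms(5)] assms(10) by simp
    then show ?thesis using \<kappa> by (metis (mono_tags, lifting))
  qed
  ultimately show "standard_laplace A nab H P \<rho>' (D s) pu - D (standard_laplace A nab H P \<rho> s) pu = 0"
    unfolding lhs rhs by simp
qed

end
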